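(* Let $G=SL_2(\mathbb Z)$, let $\Gamma\le G$ be a congruence subgroup with an algorithmic membership test (an algorithm deciding, for any matrix $A\in G$, whether $A\in\Gamma$), and let $g\in GL_2(\mathbb Q)$. Then the Hecke operator $T_g\colon H^m(\Gamma,\mathbb Z)\to H^m(\Gamma,\mathbb Z)$ can be implemented on a computer for every $m\ge 0$. That is, there is an algorithm which, given the membership test for $\Gamma$, the matrix $g$ and the degree $m$, outputs a finite presentation of an abelian group $M$ and an integer matrix describing an endomorphism $\tau\colon M\to M$, such that there is an isomorphism $M\cong H^m(\Gamma,\mathbb Z)$ carrying $\tau$ to $T_g$.
   Context: A subgroup $\Gamma\le SL_2(\mathbb Z)$ is a congruence subgroup if, for some integer $N\ge1$, it contains the kernel of the canonical homomorphism $SL_2(\mathbb Z)\to SL_2(\mathbb Z/N\mathbb Z)$. Cohomology is group cohomology with coefficients in the trivial module $\mathbb Z$. Hecke operators: for $g\in GL_2(\mathbb Q)$ put $\Gamma'=\Gamma\cap g\Gamma g^{-1}$, a finite index subgroup of $\Gamma$. There are homomorphisms $$\Gamma\ \hookleftarrow\ \Gamma'\ \xrightarrow{\ \gamma\mapsto g^{-1}\gamma g\ }\ g^{-1}\Gamma' g\ \hookrightarrow\ \Gamma,$$ inducing $$H^m(\Gamma,\mathbb Z)\xleftarrow{\ tr\ }H^m(\Gamma',\mathbb Z)\xleftarrow{\ \alpha\ }H^m(g^{-1}\Gamma' g,\mathbb Z)\xleftarrow{\ \beta\ }H^m(\Gamma,\mathbb Z),$$ where $\alpha$ and $\beta$ are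 the functorially induced maps (by the conjugation isomorphism and by the inclusion respectively) and $tr$ is the transfer (corestriction) map. The Hecke operator determined by $g$ is $T_g=tr\circ\alpha\circ\beta$. *)

theory Defs
  imports
    "HOL-Analysis.Determinants"
    "HOL-Algebra.Free_Abelian_Groups"
    "HOL-Library.Nat_Bijection"
begin

section \<open>Group cohomology with trivial integer coefficients\<close>

text \<open>
  Cohomology is computed by homogeneous cochains: the \<open>m\<close>-cochains of \<open>G\<close> are the
  \<open>G\<close>-invariant functions on \<open>G\<^sup>m\<^sup>+\<^sup>1\<close>, i.e. the homomorphisms of \<open>G\<close>-modules from the
  standard free resolution of the trivial module \<open>\<int>\<close> to \<open>\<int>\<close>.  Functions are set to \<open>0\<close>
  outside \<open>G\<^sup>m\<^sup>+\<^sup>1\<close>.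
\<close>

definition tuples :: "('a, 'b) monoid_scheme \<Rightarrow> nat \<Rightarrow> 'a list set" where
  "tuples G k = {xs. length xs = k \<and> set xs \<subseteq> carrier G}"

definition cochains :: "('a, 'b) monoid_scheme \<Rightarrow> nat \<Rightarrow> ('a list \<Rightarrow> int) monoid" where
  "cochains G m =
    \<lparr>carrier = {f. (\<forall>xs. xs \<notin> tuples G (Suc m) \<longrightarrow> f xs = 0) \<and>
                  (\<forall>a\<in>carrier G. \<forall>xs\<in>tuples G (Suc m). f (map (\<lambda>x. a \<otimes>\<^bsub>G\<^esub> x) xs) = f xs)},
     monoid.mult = (\<lambda>f h xs. f xs + h xs),
     one = (\<lambda>xs. 0)\<rparr>"

definition coboundary :: "('a, 'b) monoid_scheme \<Rightarrow> nat \<Rightarrow> ('a list \<Rightarrow> int) \<Rightarrow> 'a list \<Rightarrow> int" where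
  "coboundary G m f = (\<lambda>xs. if xs \<in> tuples G (Suc (Suc m))
     then \<Sum>i\<le>Suc m. (- 1) ^ i * f (take i xs @ drop (Suc i) xs) else 0)"

definition cocycles :: "('a, 'b) monoid_scheme \<Rightarrow> nat \<Rightarrow> ('a list \<Rightarrow> int) set" where
  "cocycles G m = kernel (cochains G m) (cochains G (Suc m)) (coboundary G m)"

fun coboundaries :: "('a, 'b) monoid_scheme \<Rightarrow> nat \<Rightarrow> ('a list \<Rightarrow> int) set" where
  "coboundaries G 0 = {\<lambda>xs. 0}"
| "coboundaries G (Suc m) = coboundary G m ` carrier (cochains G m)"

definition cohomology :: "('a, 'b) monoid_scheme \<Rightarrow> nat \<Rightarrow> ('a list \<Rightarrow> int) set monoid" where
  "cohomology G m = (cochains G m)\<lparr>carrier := cocycles G m\<rparr> Mod coboundaries G m"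

text \<open>
  The map into \<open>H\<^sup>m(G)\<close> induced by a map \<open>F\<close> of cochains: when \<open>F\<close> is the degree \<open>m\<close> part of a
  cochain map, all members of the union below are the coset of \<open>F f\<close>, for any \<open>f\<close> in the class.
\<close>

definition induced_map ::
  "('a, 'b) monoid_scheme \<Rightarrow> nat \<Rightarrow> (('c list \<Rightarrow> int) \<Rightarrow> ('a list \<Rightarrow> int)) \<Rightarrow>
   ('c list \<Rightarrow> int) set \<Rightarrow> ('a list \<Rightarrow> int) set" where
  "induced_map G m F C = (\<Union>f\<in>C. coboundaries G m #>\<^bsub>cochains G m\<^esub> F f)"

text \<open>For a homomorphism \<open>h\<close> from \<open>G\<close> to \<open>K\<close>, the map \<open>H\<^sup>m(K) \<rightarrow> H\<^sup>m(G)\<close>.\<close>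

definition pullback ::
  "('a, 'b) monoid_scheme \<Rightarrow> nat \<Rightarrow> ('a \<Rightarrow> 'c) \<Rightarrow> ('c list \<Rightarrow> int) set \<Rightarrow> ('a list \<Rightarrow> int) set" where
  "pullback G m h = induced_map G m (\<lambda>f xs. if xs \<in> tuples G (Suc m) then f (map h xs) else 0)"

text \<open>
  Transfer (corestriction) from a finite index subgroup \<open>U\<close> to \<open>G\<close>.  With \<open>r\<close> a system of
  representatives of the right cosets of \<open>U\<close>, it is given on homogeneous cochains by the usual
  formula
    \<open>(tr f) (x\<^sub>0, \<dots>, x\<^sub>m) = (\<Sum>c. f (y\<^sub>0, \<dots>, y\<^sub>m))\<close>  where  \<open>y\<^sub>i = r(c) x\<^sub>i r(c x\<^sub>i)\<^sup>-\<^sup>1 \<in> U\<close>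
  and the sum is over all right cosets; on cohomology it does not depend on \<open>r\<close>.
\<close>

definition coset_rep :: "'a set \<Rightarrow> 'a" where
  "coset_rep c = (SOME x. x \<in> c)"

definition transfer_cochain ::
  "('a, 'b) monoid_scheme \<Rightarrow> 'a set \<Rightarrow> nat \<Rightarrow> ('a list \<Rightarrow> int) \<Rightarrow> 'a list \<Rightarrow> int" where
  "transfer_cochain G U m f = (\<lambda>xs. if xs \<in> tuples G (Suc m)
     then \<Sum>c\<in>rcosets\<^bsub>G\<^esub> U.
            f (map (\<lambda>x. coset_rep c \<otimes>\<^bsub>G\<^esub> x \<otimes>\<^bsub>G\<^esub> inv\<^bsub>G\<^esub> coset_rep (c #>\<^bsub>G\<^esub> x)) xs)
     else 0)"

definition transfer ::
  "('a, 'b) monoid_scheme \<Rightarrow> 'a set \<Rightarrow> nat \<Rightarrow> ('a list \<Rightarrow> int) set \<Rightarrow> ('a list \<Rightarrow> int) set" where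
  "transfer G U m = induced_map G m (transfer_cochain G U m)"


section \<open>Congruence subgroups and Hecke operators\<close>

definition GL2Q :: "(rat^2^2) monoid" where
  "GL2Q = \<lparr>carrier = {A. invertible A}, monoid.mult = (**), one = mat 1\<rparr>"

definition SL2Z :: "(rat^2^2) monoid" where
  "SL2Z = GL2Q\<lparr>carrier := {A. (\<forall>i j. A $ i $ j \<in> \<int>) \<and> det A = 1}\<rparr>"

definition reduce :: "int \<Rightarrow> int^2^2 \<Rightarrow> int^2^2" where
  "reduce N A = (\<chi> i j. A $ i $ j mod N)"

text \<open>\<open>SL\<^sub>2(\<int>/N\<int>)\<close>, with residue classes represented by \<open>{0..<N}\<close>.\<close>

definition SL2_mod :: "int \<Rightarrow> (int^2^2) monoid" where
  "SL2_mod N = \<lparr>carrier = {A. (\<forall>i j. A $ i $ j \<in> {0..<N}) \<and> det A mod N = 1 mod N},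
     monoid.mult = (\<lambda>A B. reduce N (A ** B)), one = reduce N (mat 1)\<rparr>"

text \<open>The entries are integers here; the floor only changes their type.\<close>

definition canonical_hom :: "int \<Rightarrow> rat^2^2 \<Rightarrow> int^2^2" where
  "canonical_hom N A = reduce N (\<chi> i j. \<lfloor>A $ i $ j\<rfloor>)"

definition congruence_subgroup :: "(rat^2^2) set \<Rightarrow> bool" where
  "congruence_subgroup \<Gamma> \<longleftrightarrow> subgroup \<Gamma> SL2Z \<and>
     (\<exists>N\<ge>1. kernel SL2Z (SL2_mod N) (canonical_hom N) \<subseteq> \<Gamma>)"

text \<open>
  The Hecke operator \<open>T\<^sub>g\<close> on \<open>H\<^sup>m(\<Gamma>)\<close>, where \<open>G\<close> is an ambient group containing \<open>\<Gamma>\<close> and \<open>g\<close>.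
  Below, \<open>\<Gamma>'\<close> is \<open>\<Gamma> \<inter> g \<Gamma> g\<^sup>-\<^sup>1\<close> and \<open>\<Gamma>''\<close> is \<open>g\<^sup>-\<^sup>1 \<Gamma>' g\<close>.
\<close>

definition hecke_operator ::
  "('a, 'b) monoid_scheme \<Rightarrow> 'a set \<Rightarrow> 'a \<Rightarrow> nat \<Rightarrow> ('a list \<Rightarrow> int) set \<Rightarrow> ('a list \<Rightarrow> int) set" where
  "hecke_operator G \<Gamma> g m =
    (let conj = (\<lambda>x. inv\<^bsub>G\<^esub> g \<otimes>\<^bsub>G\<^esub> x \<otimes>\<^bsub>G\<^esub> g);
         \<Gamma>' = \<Gamma> \<inter> (\<lambda>x. g \<otimes>\<^bsub>G\<^esub> x \<otimes>\<^bsub>G\<^esub> inv\<^bsub>G\<^esub> g) ` \<Gamma>;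
         \<Gamma>'' = conj ` \<Gamma>';
         \<beta> = pullback (G\<lparr>carrier := \<Gamma>''\<rparr>) m (\<lambda>x. x);
         \<alpha> = pullback (G\<lparr>carrier := \<Gamma>'\<rparr>) m conj;
         tr = transfer (G\<lparr>carrier := \<Gamma>\<rparr>) \<Gamma>' m
     in tr \<circ> \<alpha> \<circ> \<beta>)"


section \<open>Algorithms\<close>

text \<open>
  Partial recursive functions on natural numbers; \<open>Sub\<close> calls a subroutine that is supplied when
  the program is run.
\<close>

datatype recf =
    Zero
  | Succ
  | Proj nat
  | Comp recf "recf list"
  | PrimRec recf recf
  | Mu recf
  | Sub

text \<open>
  \<open>evaluates S p xs y\<close>: the program \<open>p\<close> halts on the arguments \<open>xs\<close> with output \<open>y\<close>, where \<open>S\<close> is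
  the graph of the subroutine.  A call of the subroutine outside its domain does not halt.
\<close>

inductive evaluates :: "(nat list \<Rightarrow> nat \<Rightarrow> bool) \<Rightarrow> recf \<Rightarrow> nat list \<Rightarrow> nat \<Rightarrow> bool"
  for S :: "nat list \<Rightarrow> nat \<Rightarrow> bool" where
  Zero: "evaluates S Zero xs 0"
| Succ: "evaluates S Succ [x] (Suc x)"
| Proj: "i < length xs \<Longrightarrow> evaluates S (Proj i) xs (xs ! i)"
| Comp: "list_all2 (\<lambda>q y. evaluates S q xs y) qs ys \<Longrightarrow> evaluates S p ys z \<Longrightarrow>
    evaluates S (Comp p qs) xs z"
| PrimRec_0: "evaluates S p xs y \<Longrightarrow> evaluates S (PrimRec p q) (0 # xs) y"
| PrimRec_Suc: "evaluates S (PrimRec p q) (k # xs) y \<Longrightarrow> evaluates S q (k # y # xs) z \<Longrightarrow>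
    evaluates S (PrimRec p q) (Suc k # xs) z"
| Mu: "evaluates S p (k # xs) 0 \<Longrightarrow> \<forall>i<k. \<exists>y. evaluates S p (i # xs) (Suc y) \<Longrightarrow>
    evaluates S (Mu p) xs k"
| Sub: "S xs y \<Longrightarrow> evaluates S Sub xs y"

lemma evaluates_deterministic:
  assumes S: "\<And>xs y z. S xs y \<Longrightarrow> S xs z \<Longrightarrow> y = z"
    and "evaluates S p xs y" and "evaluates S p xs z"
  shows "y = z"
  using assms(2,3)
proof (induction arbitrary: z rule: evaluates.induct)
  case (Comp xs qs ys p w)
  from Comp.prems obtain ys' where ys': "list_all2 (\<lambda>q y. evaluates S q xs y) qs ys'"
    and z: "evaluates S p ys' z"
    by cases auto
  have "ys = ys'"
    using Comp.IH(1) ys' by (auto simp: list_all2_conv_all_nth intro!: nth_equalityI)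
  then show ?case
    using Comp.IH(2) z by blast
next
  case (PrimRec_0 p xs y q)
  from PrimRec_0.prems show ?case
    by cases (auto intro: PrimRec_0.IH)
next
  case (PrimRec_Suc p q k xs y w)
  from PrimRec_Suc.prems show ?case
    by cases (use PrimRec_Suc.IH in blast)
next
  case (Mu p k xs)
  from Mu.prems show ?case
  proof cases
    case Mu
    with Mu.IH show ?thesis
      by (metis nat.distinct(1) nat_neq_iff)
  qed
next
  case (Sub xs y)
  from Sub.prems show ?case
    by cases (use S Sub.hyps in blast)
qed (auto elim: evaluates.cases)

text \<open>A program on its own, in which \<open>Sub\<close> never halts.\<close>

definition runs :: "recf \<Rightarrow> nat list \<Rightarrow> nat \<Rightarrow> bool" where
  "runs p = evaluates (\<lambda>xs y. False) p"

text \<open>A program that is given another program \<open>t\<close> and may call it.\<close>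

definition runs_with :: "recf \<Rightarrow> recf \<Rightarrow> nat list \<Rightarrow> nat \<Rightarrow> bool" where
  "runs_with t p = evaluates (runs t) p"

definition entries :: "'a^2^2 \<Rightarrow> 'a list" where
  "entries A = [A $ 1 $ 1, A $ 1 $ 2, A $ 2 $ 1, A $ 2 $ 2]"

text \<open>Only the behaviour of \<open>t\<close> on (codes of) elements of \<open>SL\<^sub>2(\<int>)\<close> is prescribed.\<close>

definition membership_test :: "recf \<Rightarrow> (rat^2^2) set \<Rightarrow> bool" where
  "membership_test t \<Gamma> \<longleftrightarrow>
     (\<forall>A\<in>carrier SL2Z. runs t (map (\<lambda>x. int_encode \<lfloor>x\<rfloor>) (entries A)) (if A \<in> \<Gamma> then 1 else 0))"

text \<open>Numerator and positive denominator, in lowest terms.\<close>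

definition rat_encode :: "rat \<Rightarrow> nat" where
  "rat_encode x = (case quotient_of x of (a, b) \<Rightarrow> prod_encode (int_encode a, int_encode b))"

definition hecke_input :: "rat^2^2 \<Rightarrow> nat \<Rightarrow> nat list" where
  "hecke_input g m = m # map rat_encode (entries g)"


section \<open>Finitely presented abelian groups\<close>

text \<open>
  A presentation consists of the number \<open>n\<close> of generators and a list of relators, each a row of
  \<open>n\<close> integers.  The \<open>i\<close>-th row of the matrix of an endomorphism expresses the image of the \<open>i\<close>-th
  generator.
\<close>

definition row_vector :: "int list \<Rightarrow> nat \<Rightarrow>\<^sub>0 int" where
  "row_vector r = (\<Sum>i<length r. frag_cmul (r ! i) (frag_of i))"

definition integer_matrix :: "nat \<Rightarrow> int list list \<Rightarrow> bool" where
  "integer_matrix n A \<longleftrightarrow> (\<forall>r\<in>set A. length r = n)"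

definition relation_subgroup :: "nat \<Rightarrow> int list list \<Rightarrow> (nat \<Rightarrow>\<^sub>0 int) set" where
  "relation_subgroup n rels = generate (free_Abelian_group {..<n}) (row_vector ` set rels)"

definition presented_group :: "nat \<Rightarrow> int list list \<Rightarrow> (nat \<Rightarrow>\<^sub>0 int) set monoid" where
  "presented_group n rels = free_Abelian_group {..<n} Mod relation_subgroup n rels"

definition describes_endomorphism ::
  "nat \<Rightarrow> int list list \<Rightarrow> int list list \<Rightarrow> ((nat \<Rightarrow>\<^sub>0 int) set \<Rightarrow> (nat \<Rightarrow>\<^sub>0 int) set) \<Rightarrow> bool" where
  "describes_endomorphism n rels A \<tau> \<longleftrightarrow>
     integer_matrix n A \<and> length A = n \<and>
     \<tau> \<in> hom (presented_group n rels) (presented_group n rels) \<and>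
     (\<forall>v\<in>carrier (free_Abelian_group {..<n}).
        \<tau> (relation_subgroup n rels #>\<^bsub>free_Abelian_group {..<n}\<^esub> v) =
        relation_subgroup n rels #>\<^bsub>free_Abelian_group {..<n}\<^esub> frag_extend (\<lambda>i. row_vector (A ! i)) v)"

definition matrix_encode :: "int list list \<Rightarrow> nat" where
  "matrix_encode A = list_encode (map (\<lambda>r. list_encode (map int_encode r)) A)"

definition hecke_output :: "nat \<Rightarrow> int list list \<Rightarrow> int list list \<Rightarrow> nat" where
  "hecke_output n rels A = prod_encode (n, prod_encode (matrix_encode rels, matrix_encode A))"

end

theory Submission
  imports Defs
begin

text \<open>
  The program searches blindly, by a single \<open>Mu\<close>, for an output together with a finite certificate
  of its correctness; only the checking of certificates must be computable, while their existence
  is proved without any algorithm.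

  Finiteness comes from the tree of \<open>SL\<^sub>2(\<int>)\<close>. Call two elements of \<open>\<Gamma>\<close> close if their quotient
  lies in a fixed ball of \<open>SL\<^sub>2(\<int>)\<close>, and let \<open>E\<close> be the set of tuples of pairwise close elements. When
  the ball is large enough, the chain complex on \<open>E\<close> is acyclic: a finite subset is contracted by
  repeatedly replacing an element whose vertex is deepest in the tree by one closer to the root. Hence an
  equivariant chain map retracts the standard resolution onto the chains on \<open>E\<close>, so that each
  cocycle on \<open>E\<close> extends to all of \<open>\<Gamma>\<close> and a cocycle that vanishes on \<open>E\<close> is a
  coboundary. Since \<open>\<Gamma>\<close> has finitely many orbits on the tuples of \<open>E\<close> of a given length,
  \<open>H\<^sup>m(\<Gamma>)\<close> is the cohomology of a complex of integer matrices.

  The Hecke operator acts on cochains by a finite sum over coset representatives, which can be found in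
  a ball; changing them does not affect the class. It sends tuples of one ball size to tuples of a
  larger one, on which the cocycles are known as well.

  A certificate contains a basis of the cocycles on \<open>E\<close>. That it is one is witnessed by a dual family
  and a matrix identity, so that the check needs no linear algebra.
\<close>

section \<open>Computability relative to a membership test\<close>

text \<open>A group with torsion has no free resolution of finite length, and a resolution made for
  \<Gamma> would call for a fundamental domain. Both are avoided because \<Gamma> acts here on
  tuples of its own elements and not on the tree: left translation of nonempty tuples is free,
  whatever the torsion, so invariant cochains on E give group cohomology in all degrees. E is a
  Vietoris-Rips complex of \<Gamma>, in the metric of the tree, with ordered tuples and repetitions.
  Such complexes of hyperbolic spaces become contractible at large scale, and for a tree the scale
  is explicit: if every element of the group is within distance D of \<Gamma>, then 2 D + 1 is
  enough. The obstacle to a direct computation is that the level of \<Gamma> is not part of the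
  input, and finitely many answers of the membership test put no bound on it. Hence D cannot be
  bounded in advance. A proposed D, however, can be verified on the ball of radius D + 1 alone, and
  once it is verified, everything else in a certificate is finite integer arithmetic. This asymmetry
  between finding and verifying is what makes the blind search natural.\<close>

class enc =
  fixes enc :: "'a \<Rightarrow> nat" and dec :: "nat \<Rightarrow> 'a"
  assumes dec_enc [simp]: "dec (enc x) = x" and enc_dec [simp]: "enc (dec n) = n"

lemma enc_eq [simp]: "enc x = enc y \<longleftrightarrow> x = y"
  by (metis dec_enc)

instantiation nat :: enc begin
definition "enc_nat (n::nat) = n"
definition "dec_nat (n::nat) = n"
instance by standard (auto simp: enc_nat_def dec_nat_def)
end

instantiation int :: enc begin
definition "enc_int = int_encode"
definition "dec_int = int_decode"
instance by standard (auto simp: enc_int_def dec_int_def)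
end

instantiation prod :: (enc, enc) enc begin
definition "enc_prod x = prod_encode (enc (fst x), enc (snd x))"
definition "dec_prod n = (dec (fst (prod_decode n)), dec (snd (prod_decode n)))"
instance by standard (auto simp: enc_prod_def dec_prod_def)
end

instantiation list :: (enc) enc begin
definition "enc_list xs = list_encode (map enc xs)"
definition "dec_list n = map dec (list_decode n)"
instance by standard (auto simp: enc_list_def dec_list_def o_def)
end

type_synonym quad = "int \<times> int \<times> int \<times> int"

text \<open>
  \<open>P\<close> is false off \<open>SL\<^sub>2(\<int>)\<close> because nothing is known about the runs of \<open>t\<close> there, and a call might
  not halt.
\<close>

definition oracle_for :: "recf \<Rightarrow> (quad \<Rightarrow> bool) \<Rightarrow> bool" where
  "oracle_for t P \<longleftrightarrow> (\<forall>a b c d. if a * d - b * c = 1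
     then runs t [enc a, enc b, enc c, enc d] (if P (a, b, c, d) then 1 else 0)
     else \<not> P (a, b, c, d))"

text \<open>The program is chosen before \<open>t\<close> and \<open>P\<close>, so one program
  serves all subgroups, and \<open>F\<close> can learn about its predicate only by calling
  \<open>t\<close>.\<close>

definition computable_on :: "nat \<Rightarrow> ((quad \<Rightarrow> bool) \<Rightarrow> nat list \<Rightarrow> nat) \<Rightarrow> bool" where
  "computable_on r F \<longleftrightarrow> (\<exists>p. \<forall>t P xs. oracle_for t P \<longrightarrow> length xs = r \<longrightarrow> runs_with t p xs (F P xs))"

lemma computable_onI:
  "(\<And>t P xs. oracle_for t P \<Longrightarrow> length xs = r \<Longrightarrow> runs_with t p xs (F P xs)) \<Longrightarrow> computable_on r F"
  by (auto simp: computable_on_def)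

lemma computable_on_cong:
  assumes "computable_on r F" "\<And>P xs. length xs = r \<Longrightarrow> F P xs = G P xs"
  shows "computable_on r G"
  using assms by (simp add: computable_on_def)

section \<open>Programs on natural numbers\<close>

lemma computable_on_Zero: "computable_on r (\<lambda>P xs. 0)"
  by (rule computable_onI[of _ Zero]) (auto simp: runs_with_def intro: evaluates.intros)

lemma computable_on_nth: "i < r \<Longrightarrow> computable_on r (\<lambda>P xs. xs ! i)"
  by (rule computable_onI[of _ "Proj i"]) (auto simp: runs_with_def intro: evaluates.intros)

lemma computable_on_hd: "0 < r \<Longrightarrow> computable_on r (\<lambda>P xs. hd xs)"
  by (rule computable_on_cong[OF computable_on_nth[of 0]]) (auto simp: hd_conv_nth)

lemma computable_on_Comp:
  assumes "computable_on k F" and "length Gs = k" and "\<And>G. G \<in> set Gs \<Longrightarrow> computable_on r G"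
  shows "computable_on r (\<lambda>P xs. F P (map (\<lambda>G. G P xs) Gs))"
proof -
  from assms(1) obtain p where
    p: "\<And>t P xs. oracle_for t P \<Longrightarrow> length xs = k \<Longrightarrow> runs_with t p xs (F P xs)"
    by (auto simp: computable_on_def)
  have "\<forall>G. \<exists>q. G \<in> set Gs \<longrightarrow>
      (\<forall>t P xs. oracle_for t P \<longrightarrow> length xs = r \<longrightarrow> runs_with t q xs (G P xs))"
    using assms(3) by (auto simp: computable_on_def)
  then obtain q where q: "\<And>G t P xs. G \<in> set Gs \<Longrightarrow> oracle_for t P \<Longrightarrow> length xs = r \<Longrightarrow>
      runs_with t (q G) xs (G P xs)"
    by metis
  show ?thesis
  proof (rule computable_onI[of _ "Comp p (map q Gs)"])
    fix t P and xs :: "nat list"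
    assume *: "oracle_for t P" "length xs = r"
    show "runs_with t (Comp p (map q Gs)) xs (F P (map (\<lambda>G. G P xs) Gs))"
      unfolding runs_with_def
    proof (rule evaluates.Comp)
      show "list_all2 (\<lambda>q y. evaluates (runs t) q xs y) (map q Gs) (map (\<lambda>G. G P xs) Gs)"
        using q[OF _ *] by (auto simp: list_all2_conv_all_nth runs_with_def)
      show "evaluates (runs t) p (map (\<lambda>G. G P xs) Gs) (F P (map (\<lambda>G. G P xs) Gs))"
        using p[OF *(1)] assms(2) by (auto simp: runs_with_def)
    qed
  qed
qed

lemma computable_on_comp1:
  assumes "computable_on 1 (\<lambda>P xs. F P (hd xs))" "computable_on r G"
  shows "computable_on r (\<lambda>P xs. F P (G P xs))"
  using computable_on_Comp[OF assms(1), of "[G]" r] assms(2) by auto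

lemma computable_on_comp2:
  assumes "computable_on 2 (\<lambda>P xs. F P (xs ! 0) (xs ! 1))" "computable_on r G" "computable_on r H"
  shows "computable_on r (\<lambda>P xs. F P (G P xs) (H P xs))"
  using computable_on_Comp[OF assms(1), of "[G, H]" r] assms(2,3) by auto

lemma computable_on_rec_nat:
  assumes "computable_on r F" "computable_on (Suc (Suc r)) G"
  shows "computable_on (Suc r) (\<lambda>P xs. rec_nat (F P (tl xs)) (\<lambda>k y. G P (k # y # tl xs)) (hd xs))"
proof -
  from assms(1) obtain p where
    p: "\<And>t P xs. oracle_for t P \<Longrightarrow> length xs = r \<Longrightarrow> runs_with t p xs (F P xs)"
    by (auto simp: computable_on_def)
  from assms(2) obtain q where
    q: "\<And>t P xs. oracle_for t P \<Longrightarrow> length xs = Suc (Suc r) \<Longrightarrow> runs_with t q xs (G P xs)"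
    by (auto simp: computable_on_def)
  show ?thesis
  proof (rule computable_onI[of _ "PrimRec p q"])
    fix t P and xs :: "nat list"
    assume *: "oracle_for t P" "length xs = Suc r"
    then obtain n ys where xs: "xs = n # ys" "length ys = r" by (cases xs) auto
    have "evaluates (runs t) (PrimRec p q) (n # ys) (rec_nat (F P ys) (\<lambda>k y. G P (k # y # ys)) n)"
    proof (induction n)
      case 0
      then show ?case using p[OF *(1) xs(2)] by (auto simp: runs_with_def intro: evaluates.intros)
    next
      case (Suc n)
      then show ?case using q[OF *(1)] xs(2) by (auto simp: runs_with_def intro: evaluates.intros)
    qed
    then show "runs_with t (PrimRec p q) xs (rec_nat (F P (tl xs)) (\<lambda>k y. G P (k # y # tl xs)) (hd xs))"
      by (simp add: xs runs_with_def)
  qed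
qed

lemma computable_on_Least:
  assumes "computable_on (Suc r) F" "\<And>P xs. length xs = r \<Longrightarrow> \<exists>k. F P (k # xs) = 0"
  shows "computable_on r (\<lambda>P xs. LEAST k. F P (k # xs) = 0)"
proof -
  from assms(1) obtain p where
    p: "\<And>t P xs. oracle_for t P \<Longrightarrow> length xs = Suc r \<Longrightarrow> runs_with t p xs (F P xs)"
    by (auto simp: computable_on_def)
  show ?thesis
  proof (rule computable_onI[of _ "Mu p"])
    fix t P and xs :: "nat list"
    assume *: "oracle_for t P" "length xs = r"
    define k where "k = (LEAST k. F P (k # xs) = 0)"
    have k: "F P (k # xs) = 0"
      unfolding k_def using assms(2)[OF *(2)] by (rule LeastI_ex)
    have "\<exists>y. F P (i # xs) = Suc y" if "i < k" for i
      using not_less_Least[OF that[unfolded k_def]] by (auto simp: not0_implies_Suc)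
    moreover have "evaluates (runs t) p (i # xs) (F P (i # xs))" for i
      using p[OF *(1), of "i # xs"] *(2) by (simp add: runs_with_def)
    ultimately show "runs_with t (Mu p) xs k"
      unfolding runs_with_def using k by (intro evaluates.Mu) metis+
  qed
qed

lemma computable_on_Suc:
  assumes "computable_on r F" shows "computable_on r (\<lambda>P xs. Suc (F P xs))"
proof (rule computable_on_comp1[of "\<lambda>P. Suc"])
  show "computable_on 1 (\<lambda>P xs. Suc (hd xs))"
  proof (rule computable_onI[of _ Succ])
    fix t P and xs :: "nat list"
    assume "length xs = 1"
    then show "runs_with t Succ xs (Suc (hd xs))"
      by (cases xs) (auto simp: runs_with_def intro: evaluates.intros)
  qed
qed (rule assms)

lemma computable_on_const: "computable_on r (\<lambda>P xs. c)"
  by (induction c) (auto intro: computable_on_Zero computable_on_Suc)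

lemma computable_on_rec1:
  assumes "computable_on 2 (\<lambda>P xs. g (xs ! 0) (xs ! 1))"
  shows "computable_on 1 (\<lambda>P xs. rec_nat c g (hd xs))"
  using computable_on_rec_nat[OF computable_on_const[of 0 c], of "\<lambda>P xs. g (xs ! 0) (xs ! 1)"] assms
  by (simp add: numeral_2_eq_2)

lemma computable_on_rec2:
  assumes "computable_on 3 (\<lambda>P xs. g P (xs ! 0) (xs ! 1) (xs ! 2))" "computable_on 1 (\<lambda>P xs. f P (hd xs))"
  shows "computable_on 2 (\<lambda>P xs. rec_nat (f P (xs ! 1)) (\<lambda>k y. g P k y (xs ! 1)) (xs ! 0))"
proof -
  have "computable_on (Suc 1) (\<lambda>P xs. rec_nat (f P (hd (tl xs)))
      (\<lambda>k y. (\<lambda>P xs. g P (xs ! 0) (xs ! 1) (xs ! 2)) P (k # y # tl xs)) (hd xs))"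
    using assms by (intro computable_on_rec_nat) (simp_all add: numeral_3_eq_3)
  then show ?thesis
    unfolding numeral_2_eq_2 One_nat_def by (rule computable_on_cong) (auto simp: length_Suc_conv)
qed

lemma computable_on_add:
  assumes "computable_on r F" "computable_on r G"
  shows "computable_on r (\<lambda>P xs. F P xs + G P xs)"
proof (rule computable_on_comp2[OF _ assms])
  have "computable_on 2 (\<lambda>P xs. rec_nat (xs ! 1) (\<lambda>k y. Suc y) (xs ! 0))"
    by (rule computable_on_rec2) (intro computable_on_Suc computable_on_nth computable_on_hd; simp)+
  moreover have "rec_nat b (\<lambda>k y. Suc y) a = a + b" for a b :: nat
    by (induction a) auto
  ultimately show "computable_on 2 (\<lambda>P xs. xs ! 0 + xs ! 1)" by simp
qed

lemma computable_on_pred: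
  assumes "computable_on r F" shows "computable_on r (\<lambda>P xs. F P xs - 1)"
proof (rule computable_on_comp1[OF _ assms])
  have "computable_on 1 (\<lambda>P xs. rec_nat 0 (\<lambda>k y. k) (hd xs))"
    by (rule computable_on_rec1) (auto intro: computable_on_nth)
  moreover have "rec_nat 0 (\<lambda>k y. k) a = a - 1" for a :: nat
    by (cases a) auto
  ultimately show "computable_on 1 (\<lambda>P xs. hd xs - 1)" by simp
qed

lemma computable_on_diff:
  assumes "computable_on r F" "computable_on r G"
  shows "computable_on r (\<lambda>P xs. F P xs - G P xs)"
proof (rule computable_on_comp2[of "\<lambda>P a b. b - a", OF _ assms(2,1)])
  have "computable_on 2 (\<lambda>P xs. rec_nat (xs ! 1) (\<lambda>k y. y - 1) (xs ! 0))"
    by (rule computable_on_rec2) (intro computable_on_pred computable_on_nth computable_on_hd; simp)+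
  moreover have "rec_nat b (\<lambda>k y. y - Suc 0) a = b - a" for a b :: nat
    by (induction a) auto
  ultimately show "computable_on 2 (\<lambda>P xs. xs ! 1 - xs ! 0)" by simp
qed

lemma computable_on_mult:
  assumes "computable_on r F" "computable_on r G"
  shows "computable_on r (\<lambda>P xs. F P xs * G P xs)"
proof (rule computable_on_comp2[OF _ assms])
  have "computable_on 2 (\<lambda>P xs. rec_nat 0 (\<lambda>k y. xs ! 1 + y) (xs ! 0))"
    by (rule computable_on_rec2[where f = "\<lambda>_ _. 0" and g = "\<lambda>_ k y x. x + y"])
       (intro computable_on_add computable_on_nth computable_on_Zero; simp)+
  moreover have "rec_nat 0 (\<lambda>k y. b + y) a = a * b" for a b :: nat
    by (induction a) auto
  ultimately show "computable_on 2 (\<lambda>P xs. xs ! 0 * xs ! 1)" by simp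
qed

lemma computable_on_triangle:
  assumes "computable_on r F" shows "computable_on r (\<lambda>P xs. triangle (F P xs))"
proof (rule computable_on_comp1[OF _ assms])
  have "computable_on 1 (\<lambda>P xs. rec_nat 0 (\<lambda>k y. y + Suc k) (hd xs))"
    by (rule computable_on_rec1) (intro computable_on_nth computable_on_add computable_on_Suc; simp)
  moreover have "rec_nat 0 (\<lambda>k y. y + Suc k) a = triangle a" for a :: nat
    by (induction a) auto
  ultimately show "computable_on 1 (\<lambda>P xs. triangle (hd xs))" by simp
qed

lemma computable_on_prod_encode:
  assumes "computable_on r F" "computable_on r G"
  shows "computable_on r (\<lambda>P xs. prod_encode (F P xs, G P xs))"
  using assms by (simp add: prod_encode_def computable_on_add computable_on_triangle)

lemma triangle_mono: "m \<le> n \<Longrightarrow> triangle m \<le> triangle n"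
  by (induction n) (auto simp: le_Suc_eq)

text \<open>The code of (a, b) is \<open>triangle (a + b) + a\<close>, so the codes with sum a + b
  begin at \<open>triangle (a + b)\<close> and end before \<open>triangle (Suc (a + b))\<close>. The
  least \<open>w\<close> for which \<open>triangle (Suc w)\<close> exceeds the code is thus the sum,
  and subtraction then gives both components.\<close>

lemma Least_triangle:
  "(LEAST w. Suc (prod_encode (a, b)) - triangle (Suc w) = 0) = a + b"
proof (rule Least_equality)
  fix w assume w: "Suc (prod_encode (a, b)) - triangle (Suc w) = 0"
  show "a + b \<le> w"
  proof (rule ccontr)
    assume "\<not> a + b \<le> w"
    then have "triangle (Suc w) \<le> triangle (a + b)" by (intro triangle_mono) auto
    then show False using w by (auto simp: prod_encode_def)
  qed
qed (auto simp: prod_encode_def)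

lemma computable_on_prod_decode:
  assumes "computable_on r F"
  shows "computable_on r (\<lambda>P xs. fst (prod_decode (F P xs)))"
    and "computable_on r (\<lambda>P xs. snd (prod_decode (F P xs)))"
proof -
  define W where "W z = (LEAST w. Suc z - triangle (Suc w) = 0)" for z
  have W: "W (prod_encode (a, b)) = a + b" for a b
    unfolding W_def by (rule Least_triangle)
  have "computable_on 2 (\<lambda>P xs. Suc (xs ! 1) - triangle (Suc (xs ! 0)))"
    by (intro computable_on_diff computable_on_Suc computable_on_triangle computable_on_nth) auto
  then have "computable_on 1 (\<lambda>P xs. LEAST w. Suc ((w # xs) ! 1) - triangle (Suc ((w # xs) ! 0)) = 0)"
  proof (intro computable_on_Least, simp add: numeral_2_eq_2)
    fix xs :: "nat list"
    obtain a b where "xs ! 0 = prod_encode (a, b)" by (metis prod_decode_inverse surj_pair)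
    then show "\<exists>w. Suc ((w # xs) ! 1) - triangle (Suc ((w # xs) ! 0)) = 0"
      by (intro exI[of _ "a + b"]) (auto simp: prod_encode_def)
  qed
  then have "computable_on 1 (\<lambda>P xs. W (hd xs))"
    by (rule computable_on_cong) (auto simp: W_def length_Suc_conv)
  then have 1: "computable_on r (\<lambda>P xs. W (F P xs))"
    by (rule computable_on_comp1[of "\<lambda>P. W"]) (rule assms)
  have "z - triangle (W z) = fst (prod_decode z) \<and> W z - fst (prod_decode z) = snd (prod_decode z)" for z
  proof -
    obtain a b where "z = prod_encode (a, b)" by (metis prod_decode_inverse surj_pair)
    then show ?thesis by (simp add: W) (simp add: prod_encode_def)
  qed
  then show fst: "computable_on r (\<lambda>P xs. fst (prod_decode (F P xs)))"
    and "computable_on r (\<lambda>P xs. snd (prod_decode (F P xs)))"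
    using computable_on_diff[OF assms computable_on_triangle[OF 1]]
      computable_on_diff[OF 1 computable_on_diff[OF assms computable_on_triangle[OF 1]]]
    by simp_all
qed

text \<open>Several arguments are packed into one tuple, so that all closure rules have the same
  one-argument shape. Since \<open>enc\<close> is a bijection, every number is a legitimate code,
  and a search over numbers is a search over all values of the type.\<close>

definition computable :: "((quad \<Rightarrow> bool) \<Rightarrow> 'a::enc \<Rightarrow> 'b::enc) \<Rightarrow> bool" where
  "computable f \<longleftrightarrow> computable_on 1 (\<lambda>P xs. enc (f P (dec (hd xs))))"

definition decidable :: "((quad \<Rightarrow> bool) \<Rightarrow> 'a::enc \<Rightarrow> bool) \<Rightarrow> bool" where
  "decidable Q \<longleftrightarrow> computable (\<lambda>P x. if Q P x then 1 else 0 :: nat)"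

named_theorems computable_intros

lemma computable_comp:
  assumes "computable g" "computable f"
  shows "computable (\<lambda>P x. g P (f P x))"
  using computable_on_comp1[OF assms(1)[unfolded computable_def] assms(2)[unfolded computable_def]]
  by (simp add: computable_def)

lemma computable2:
  assumes "computable_on 2 (\<lambda>P xs. enc (h P (dec (xs ! 0)) (dec (xs ! 1))))" "computable f" "computable g"
  shows "computable (\<lambda>P x. h P (f P x) (g P x))"
  using computable_on_comp2[of "\<lambda>P a b. enc (h P (dec a) (dec b))", OF assms(1) assms(2,3)[unfolded computable_def]]
  by (simp add: computable_def)

lemma computable_id [computable_intros]: "computable (\<lambda>P x. x)"
  by (simp add: computable_def computable_on_hd)

lemma computable_const [computable_intros]: "computable (\<lambda>P x. c)"
  by (simp add: computable_def computable_on_const)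

lemma computable_Pair [computable_intros]:
  "computable f \<Longrightarrow> computable g \<Longrightarrow> computable (\<lambda>P x. (f P x, g P x))"
  by (simp add: computable_def enc_prod_def computable_on_prod_encode)

lemma computable_fst [computable_intros]: "computable f \<Longrightarrow> computable (\<lambda>P x. fst (f P x))"
  using computable_on_prod_decode(1)[of 1 "\<lambda>P xs. enc (f P (dec (hd xs)))"]
  by (simp add: computable_def enc_prod_def)

lemma computable_snd [computable_intros]: "computable f \<Longrightarrow> computable (\<lambda>P x. snd (f P x))"
  using computable_on_prod_decode(2)[of 1 "\<lambda>P xs. enc (f P (dec (hd xs)))"]
  by (simp add: computable_def enc_prod_def)

lemma computable_Suc [computable_intros]: "computable f \<Longrightarrow> computable (\<lambda>P x. Suc (f P x))"
  by (simp add: computable_def enc_nat_def computable_on_Suc)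

lemma computable_add_nat [computable_intros]:
  "computable f \<Longrightarrow> computable g \<Longrightarrow> computable (\<lambda>P x. f P x + g P x :: nat)"
  by (simp add: computable_def enc_nat_def computable_on_add)

lemma computable_mult_nat [computable_intros]:
  "computable f \<Longrightarrow> computable g \<Longrightarrow> computable (\<lambda>P x. f P x * g P x :: nat)"
  by (simp add: computable_def enc_nat_def computable_on_mult)

lemma computable_diff_nat [computable_intros]:
  "computable f \<Longrightarrow> computable g \<Longrightarrow> computable (\<lambda>P x. f P x - g P x :: nat)"
  by (simp add: computable_def enc_nat_def computable_on_diff)

lemma computable_enc [computable_intros]: "computable f \<Longrightarrow> computable (\<lambda>P x. enc (f P x))"
  by (simp add: computable_def enc_nat_def)

lemma computable_dec [computable_intros]: "computable f \<Longrightarrow> computable (\<lambda>P x. dec (f P x))"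
  by (simp add: computable_def enc_nat_def)

lemma computable_rec_nat [computable_intros]:
  assumes f: "computable f" and h: "computable (\<lambda>P z. h P (fst z) (fst (snd z)) (snd (snd z)))"
    and n: "computable n"
  shows "computable (\<lambda>P x. rec_nat (f P x) (h P x) (n P x))"
proof -
  define H where "H P z = (\<lambda>z::'a \<times> nat \<times> 'b. enc (h P (fst z) (fst (snd z)) (snd (snd z)))) (dec z)" for P z
  have "computable_on 1 (\<lambda>P xs. H P (hd xs))"
    using h unfolding H_def computable_def by assumption
  moreover have "computable_on 3 (\<lambda>P xs. prod_encode (xs ! 2, prod_encode (xs ! 0, xs ! 1)))"
    by (intro computable_on_prod_encode computable_on_nth) simp_all
  ultimately have "computable_on 3 (\<lambda>P xs. H P (prod_encode (xs ! 2, prod_encode (xs ! 0, xs ! 1))))"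
    by (rule computable_on_comp1)
  then have "computable_on 2 (\<lambda>P xs. rec_nat (enc (f P (dec (xs ! 1))))
      (\<lambda>k y. H P (prod_encode (xs ! 1, prod_encode (k, y)))) (xs ! 0))"
    by (rule computable_on_rec2[of "\<lambda>P k y x. H P (prod_encode (x, prod_encode (k, y)))" "\<lambda>P n. enc (f P (dec n))"])
       (use f in \<open>simp add: computable_def\<close>)
  moreover have "rec_nat (enc (f P x)) (\<lambda>k y. H P (prod_encode (enc x, prod_encode (k, y)))) m
      = enc (rec_nat (f P x) (h P x) m)"
    for P x m by (induction m) (auto simp: H_def dec_prod_def dec_nat_def)
  from this[of _ "dec x" for x] have "rec_nat (enc (f P (dec x))) (\<lambda>k y. H P (prod_encode (x, prod_encode (k, y)))) m
      = enc (rec_nat (f P (dec x)) (h P (dec x)) m)" for P x m by simp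
  ultimately have "computable_on 2 (\<lambda>P xs. enc ((\<lambda>P m x. rec_nat (f P x) (h P x) m) P (dec (xs ! 0)) (dec (xs ! 1))))"
    by (simp only: dec_nat_def)
  from computable2[OF this n computable_id] show ?thesis .
qed

lemma computable_If [computable_intros]:
  assumes "decidable Q" "computable f" "computable g"
  shows "computable (\<lambda>P x. if Q P x then f P x else g P x)"
proof -
  have "computable (\<lambda>P x. rec_nat (g P x) (\<lambda>k y. f P x) (if Q P x then 1 else 0))"
    by (intro computable_rec_nat assms(3) assms(1)[unfolded decidable_def]
        computable_comp[OF assms(2)] computable_fst computable_id)
  then show ?thesis
    by (rule back_subst[of computable]) (auto simp: fun_eq_iff)
qed

lemma decidable_eq_0: "computable f \<Longrightarrow> decidable (\<lambda>P x. f P x = (0::nat))"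
proof -
  assume "computable f"
  then have "computable (\<lambda>P x. 1 - f P x)" by (intro computable_intros)
  then show ?thesis
    unfolding decidable_def by (rule back_subst[of computable]) (auto simp: fun_eq_iff)
qed

lemma decidable_not [computable_intros]: "decidable Q \<Longrightarrow> decidable (\<lambda>P x. \<not> Q P x)"
  using decidable_eq_0[of "\<lambda>P x. if Q P x then 1 else 0"]
  unfolding decidable_def by (rule back_subst[of computable]) (auto simp: fun_eq_iff)

lemma decidable_conj [computable_intros]:
  assumes "decidable Q" "decidable R" shows "decidable (\<lambda>P x. Q P x \<and> R P x)"
proof -
  have "computable (\<lambda>P x. if Q P x then (if R P x then 1 else 0) else 0 :: nat)"
    using assms by (intro computable_intros)
  then show ?thesis
    unfolding decidable_def by (rule back_subst[of computable]) (auto simp: fun_eq_iff)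
qed

lemma decidable_disj [computable_intros]:
  assumes "decidable Q" "decidable R" shows "decidable (\<lambda>P x. Q P x \<or> R P x)"
  using decidable_not[OF decidable_conj[OF decidable_not[OF assms(1)] decidable_not[OF assms(2)]]] by simp

lemma decidable_imp [computable_intros]:
  assumes "decidable Q" "decidable R" shows "decidable (\<lambda>P x. Q P x \<longrightarrow> R P x)"
  using decidable_disj[OF decidable_not[OF assms(1)] assms(2)] unfolding imp_conv_disj .

lemma decidable_le [computable_intros]:
  assumes "computable f" "computable g" shows "decidable (\<lambda>P x. f P x \<le> (g P x :: nat))"
  using decidable_eq_0[OF computable_diff_nat[OF assms]] by simp

lemma decidable_eq [computable_intros]:
  assumes "computable f" "computable g" shows "decidable (\<lambda>P x. f P x = g P x)"
proof -
  have "decidable (\<lambda>P x. enc (f P x) \<le> enc (g P x) \<and> enc (g P x) \<le> enc (f P x))"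
    using assms by (intro computable_intros)
  then show ?thesis
    by (simp flip: order_eq_iff)
qed

text \<open>Unbounded search for the value, which halts because each input has one. This replaces an
  algorithm by a test of correctness, as for division, whose graph is given by a few
  inequalities.\<close>

lemma computable_graph:
  assumes "decidable (\<lambda>P z. R P (fst z) (snd z))" and R: "\<And>P x y. R P x y \<longleftrightarrow> y = f P x"
  shows "computable f"
proof -
  let ?F = "\<lambda>P z. if R P (fst z) (snd z) then 0 else 1 :: nat"
  have "computable ?F"
    using assms(1) by (intro computable_intros)
  then have "computable_on 2 (\<lambda>P xs. ?F P (dec (prod_encode (xs ! 1, xs ! 0))))"
    unfolding computable_def enc_nat_def
    by (rule computable_on_comp1[of "\<lambda>P n. ?F P (dec n)"])
       (intro computable_on_prod_encode computable_on_nth; simp)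
  then have "computable_on 2 (\<lambda>P xs. if R P (dec (xs ! 1)) (dec (xs ! 0)) then 0 else 1)"
    by (simp add: dec_prod_def)
  then have "computable_on 1 (\<lambda>P xs. LEAST k. (if R P (dec ((k # xs) ! 1)) (dec ((k # xs) ! 0)) then 0 else 1 :: nat) = 0)"
  proof (intro computable_on_Least)
    fix P and xs :: "nat list"
    show "\<exists>k. (if R P (dec ((k # xs) ! 1)) (dec ((k # xs) ! 0)) then 0 else 1 :: nat) = 0"
      by (rule exI[of _ "enc (f P (dec (xs ! 0)))"]) (simp add: R)
  qed (simp add: numeral_2_eq_2)
  moreover have "(LEAST k. (if R P (dec ((k # xs) ! 1)) (dec ((k # xs) ! 0)) then 0 else 1 :: nat) = 0)
      = enc (f P (dec (hd xs)))" if "length xs = 1" for P xs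
  proof (rule Least_equality)
    fix k
    assume "(if R P (dec ((k # xs) ! 1)) (dec ((k # xs) ! 0)) then 0 else 1 :: nat) = 0"
    then have "dec k = f P (dec (xs ! 0))" by (simp add: R split: if_splits)
    from arg_cong[OF this, of enc] show "enc (f P (dec (hd xs))) \<le> k"
      using that by (cases xs) auto
  qed (use that in \<open>cases xs; simp add: R\<close>)
  ultimately show ?thesis
    unfolding computable_def by (rule computable_on_cong)
qed

lemma decidable_even [computable_intros]:
  assumes "computable f" shows "decidable (\<lambda>P x. even (f P x :: nat))"
proof -
  have "computable (\<lambda>P x. rec_nat 1 (\<lambda>k y. 1 - y) (f P x) :: nat)"
    using assms by (intro computable_intros)
  moreover have "rec_nat 1 (\<lambda>k y. 1 - y) n = (if even n then 1 else 0 :: nat)" for n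
    by (induction n) auto
  ultimately show ?thesis by (simp add: decidable_def)
qed

lemma computable_half [computable_intros]:
  assumes "computable f" shows "computable (\<lambda>P x. f P x div 2 :: nat)"
proof -
  have "computable (\<lambda>P n. n div 2 :: nat)"
  proof (rule computable_graph)
    show "decidable (\<lambda>P z. 2 * snd z = fst z \<or> Suc (2 * snd z) = (fst z :: nat))"
      by (intro computable_intros)
  qed presburger
  from computable_comp[OF this assms] show ?thesis .
qed

section \<open>Integer arithmetic\<close>

lemma enc_int_nonneg: "enc (int n) = 2 * n"
  by (simp add: enc_int_def int_encode_def sum_encode_def)

lemma enc_int_neg: "enc (- int n - 1) = Suc (2 * n)"
  by (simp add: enc_int_def int_encode_def sum_encode_def)

lemma computable_int [computable_intros]:
  assumes "computable f" shows "computable (\<lambda>P x. int (f P x))"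
proof -
  have "computable (\<lambda>P x. dec (2 * f P x) :: int)" using assms by (intro computable_intros)
  moreover have "dec (2 * n) = int n" for n by (metis dec_enc enc_int_nonneg)
  ultimately show ?thesis by simp
qed

lemma computable_nat [computable_intros]:
  assumes "computable f" shows "computable (\<lambda>P x. nat (f P x))"
proof -
  have "computable (\<lambda>P x. if even (enc (f P x)) then enc (f P x) div 2 else 0)"
    using assms by (intro computable_intros)
  moreover have "(if even (enc i) then enc i div 2 else 0) = nat i" for i :: int
  proof (cases "i \<ge> 0")
    case True
    then show ?thesis using enc_int_nonneg[of "nat i"] by simp
  next
    case False
    then show ?thesis using enc_int_neg[of "nat (- i - 1)"] by simp
  qed
  ultimately show ?thesis by simp
qed

text \<open>The bridge from natural numbers back to integers: addition and multiplication split
  their arguments into positive and negative parts, work on natural numbers, and recombine the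
  results here.\<close>

lemma computable_diff_of_nat:
  assumes "computable f" "computable g" shows "computable (\<lambda>P x. int (f P x) - int (g P x))"
proof -
  let ?d = "\<lambda>z. int (fst z) - int (snd z)"
  have "computable (\<lambda>P x. if snd x \<le> fst x then int (fst x - snd x) else dec (2 * (snd x - fst x) - 1))"
    by (intro computable_intros)
  moreover have "(if snd x \<le> fst x then int (fst x - snd x) else dec (2 * (snd x - fst x) - 1)) = ?d x" for x
  proof (cases "snd x \<le> fst x")
    case False
    then have "2 * (snd x - fst x) - 1 = Suc (2 * (snd x - fst x - 1))" by simp
    also have "\<dots> = enc (- int (snd x - fst x - 1) - 1)" by (rule enc_int_neg[symmetric])
    finally have "dec (2 * (snd x - fst x) - 1) = - int (snd x - fst x - 1) - 1" by (simp only: dec_enc)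
    then show ?thesis using False by simp
  qed auto
  ultimately have "computable (\<lambda>P. ?d)" by simp
  from computable_comp[OF this computable_Pair[OF assms]] show ?thesis by simp
qed

lemma computable_uminus_int [computable_intros]:
  assumes f: "computable f" shows "computable (\<lambda>P x. - f P x :: int)"
proof -
  have "computable (\<lambda>P n. if even n then int 0 - int (n div 2) else int (Suc (n div 2)))"
    by (intro computable_intros computable_diff_of_nat)
  moreover have "(if even n then int 0 - int (n div 2) else int (Suc (n div 2))) = - dec n" for n
    by (auto simp: dec_int_def int_decode_def sum_decode_def)
  ultimately have "computable (\<lambda>P n. - dec n :: int)" by simp
  from computable_comp[OF this computable_enc[OF f]] show ?thesis by simp
qed

lemma computable_add_int [computable_intros]:
  assumes "computable f" "computable g" shows "computable (\<lambda>P x. f P x + g P x :: int)"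
proof -
  have "computable (\<lambda>P x. int (nat (f P x) + nat (g P x)) - int (nat (- f P x) + nat (- g P x)))"
    using assms by (intro computable_diff_of_nat computable_intros)
  moreover have "int (nat i + nat j) - int (nat (- i) + nat (- j)) = i + j" for i j by simp
  ultimately show ?thesis by simp
qed

lemma computable_diff_int [computable_intros]:
  assumes "computable f" "computable g" shows "computable (\<lambda>P x. f P x - g P x :: int)"
  using computable_add_int[OF assms(1) computable_uminus_int[OF assms(2)]] by simp

lemma computable_mult_int [computable_intros]:
  assumes "computable f" "computable g" shows "computable (\<lambda>P x. f P x * g P x :: int)"
proof -
  have "computable (\<lambda>P x. int (nat (f P x) * nat (g P x) + nat (- f P x) * nat (- g P x))
     - int (nat (f P x) * nat (- g P x) + nat (- f P x) * nat (g P x)))"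
    using assms by (intro computable_diff_of_nat computable_intros)
  moreover have "int (nat i * nat j + nat (- i) * nat (- j)) - int (nat i * nat (- j) + nat (- i) * nat j) = i * j" for i j
    by (cases "i \<ge> 0"; cases "j \<ge> 0") (auto simp: not_le)
  ultimately show ?thesis by simp
qed

lemma decidable_le_int [computable_intros]:
  assumes "computable f" "computable g" shows "decidable (\<lambda>P x. f P x \<le> (g P x :: int))"
proof -
  have "decidable (\<lambda>P x. nat (f P x - g P x) = 0)" using assms by (intro computable_intros)
  then show ?thesis by simp
qed

lemma decidable_less_int [computable_intros]:
  assumes "computable f" "computable g" shows "decidable (\<lambda>P x. f P x < (g P x :: int))"
proof -
  have "decidable (\<lambda>P x. \<not> g P x \<le> f P x)" using assms by (intro computable_intros)
  then show ?thesis by (simp only: not_le)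
qed

lemma int_div_iff:
  fixes a b y :: int
  shows "y = a div b \<longleftrightarrow> (if b = 0 then y = 0 else if 0 < b then y * b \<le> a \<and> a < (y + 1) * b
     else a \<le> y * b \<and> (y + 1) * b < a)"
proof -
  have pos: "y = a div b \<longleftrightarrow> y * b \<le> a \<and> a < (y + 1) * b" if "0 < b" for a b :: int
  proof
    assume "y = a div b"
    then have "a = y * b + a mod b" by simp
    then show "y * b \<le> a \<and> a < (y + 1) * b"
      using pos_mod_bound[OF that, of a] pos_mod_sign[OF that, of a] by (simp only: distrib_right) linarith
  next
    assume "y * b \<le> a \<and> a < (y + 1) * b"
    then show "y = a div b"
      using int_div_pos_eq[of a b y "a - b * y"] by (auto simp: algebra_simps)
  qed
  have "y = a div b \<longleftrightarrow> a \<le> y * b \<and> (y + 1) * b < a" if "b < 0"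
    using pos[of "- b" "- a"] that by simp
  then show ?thesis using pos[of b a] by auto
qed

lemma computable_div_int [computable_intros]:
  assumes "computable f" "computable g" shows "computable (\<lambda>P x. f P x div g P x :: int)"
proof -
  have "computable (\<lambda>P z. fst z div snd z :: int)"
  proof (rule computable_graph)
    show "decidable (\<lambda>P z. (snd (fst z) = 0 \<longrightarrow> snd z = (0::int)) \<and> (snd (fst z) \<noteq> 0 \<longrightarrow>
         ((0 < snd (fst z) \<longrightarrow> snd z * snd (fst z) \<le> fst (fst z) \<and> fst (fst z) < (snd z + 1) * snd (fst z))
        \<and> (\<not> 0 < snd (fst z) \<longrightarrow> fst (fst z) \<le> snd z * snd (fst z) \<and> (snd z + 1) * snd (fst z) < fst (fst z)))))"
      by (intro computable_intros)
  qed (auto simp: int_div_iff)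
  from computable_comp[OF this computable_Pair[OF assms]] show ?thesis by simp
qed

section \<open>Lists\<close>

lemma computable_Cons [computable_intros]:
  assumes "computable f" "computable g" shows "computable (\<lambda>P x. f P x # g P x :: 'b::enc list)"
proof -
  have "computable (\<lambda>P x. dec (Suc (enc (f P x, enc (g P x)))) :: 'b list)"
    using assms by (intro computable_intros)
  moreover have "dec (Suc (enc (y, enc ys))) = y # ys" for y and ys :: "'b list"
    by (simp add: enc_prod_def dec_list_def enc_list_def enc_nat_def o_def)
  ultimately show ?thesis by simp
qed

text \<open>A variant of \<open>hd\<close> with a definite value on the empty list, read off from
  the code 0; about \<open>hd []\<close> nothing is known, in particular not that it can be computed
  uniformly.\<close>

definition lhd :: "'a::enc list \<Rightarrow> 'a" where
  "lhd xs = dec (fst (dec (enc xs - 1) :: nat \<times> nat))"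

lemma enc_Nil [simp]: "enc [] = 0"
  by (simp add: enc_list_def)

lemma enc_Cons: "enc (x # xs) = Suc (enc (enc x, enc xs))"
  by (simp add: enc_list_def enc_prod_def enc_nat_def)

lemma lhd_Cons [simp]: "lhd (x # xs) = x"
  by (simp add: lhd_def enc_Cons)

lemma lhd_eq_hd: "xs \<noteq> [] \<Longrightarrow> lhd xs = hd xs"
  by (cases xs) auto

lemma computable_lhd [computable_intros]:
  assumes "computable f" shows "computable (\<lambda>P x. lhd (f P x))"
  unfolding lhd_def using assms by (intro computable_intros)

lemma computable_tl [computable_intros]:
  assumes "computable f" shows "computable (\<lambda>P x. tl (f P x :: 'b::enc list))"
proof -
  have "computable (\<lambda>P x. if enc (f P x) = 0 then [] else dec (snd (dec (enc (f P x) - 1) :: nat \<times> nat)) :: 'b list)"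
    using assms by (intro computable_intros)
  moreover have "(if enc ys = 0 then [] else dec (snd (dec (enc ys - 1) :: nat \<times> nat))) = tl ys" for ys :: "'b list"
    by (cases ys) (auto simp: enc_Cons)
  ultimately show ?thesis by simp
qed

text \<open>Recursion over a list is an iteration whose number of rounds has to be computable
  beforehand. The code itself is a bound; surplus rounds find an empty list and change
  nothing.\<close>

lemma length_le_enc: "length xs \<le> enc xs"
proof (induction xs)
  case (Cons x xs)
  then show ?case
    using le_prod_encode_2[of "enc xs" "enc x"] by (simp add: enc_Cons enc_prod_def enc_nat_def)
qed simp

lemma computable_comp2:
  assumes "computable (\<lambda>P z. h P (fst z) (snd z))" "computable f" "computable g"
  shows "computable (\<lambda>P x. h P (f P x) (g P x))"
  using computable_comp[OF assms(1) computable_Pair[OF assms(2,3)]] by simp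

lemma computable_comp3:
  assumes "computable (\<lambda>P z. h P (fst z) (fst (snd z)) (snd (snd z)))" "computable e" "computable f" "computable g"
  shows "computable (\<lambda>P x. h P (e P x) (f P x) (g P x))"
  using computable_comp[OF assms(1) computable_Pair[OF assms(2) computable_Pair[OF assms(3,4)]]] by simp

lemma decidable_comp2:
  assumes "decidable (\<lambda>P z. Q P (fst z) (snd z))" "computable f" "computable g"
  shows "decidable (\<lambda>P x. Q P (f P x) (g P x))"
  using computable_comp2[OF assms(1)[unfolded decidable_def] assms(2,3)] by (simp add: decidable_def)

lemma computable_fold:
  assumes "computable (\<lambda>P z. h P (fst z) (fst (snd z)) (snd (snd z)))" "computable f" "computable g"
  shows "computable (\<lambda>P x. fold (h P x) (f P x) (g P x))"
proof -
  have "computable (\<lambda>P x. snd (rec_nat (f P x, g P x)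
     (\<lambda>k s. if fst s = [] then s else (tl (fst s), h P x (lhd (fst s)) (snd s))) (enc (f P x))))"
    by (intro computable_intros assms computable_comp3[OF assms(1)])
  moreover have "snd (rec_nat (ys, a)
     (\<lambda>k s. if fst s = [] then s else (tl (fst s), h' (lhd (fst s)) (snd s))) (enc ys)) = fold h' ys a"
    for ys :: "'b list" and a and h' :: "'b \<Rightarrow> 'c \<Rightarrow> 'c"
  proof -
    have "rec_nat (ys, a)
     (\<lambda>k s. if fst s = [] then s else (tl (fst s), h' (lhd (fst s)) (snd s))) n = (drop n ys, fold h' (take n ys) a)" for n
    proof (induction n)
      case (Suc n)
      show ?case
      proof (cases "n < length ys")
        case True
        then have "drop n ys = ys ! n # drop (Suc n) ys" by (simp add: Cons_nth_drop_Suc)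
        then show ?thesis using Suc True by (simp add: take_Suc_conv_app_nth)
      qed (use Suc in auto)
    qed auto
    then show ?thesis by (simp add: length_le_enc)
  qed
  ultimately show ?thesis by simp
qed

lemma computable_rev [computable_intros]:
  assumes "computable f" shows "computable (\<lambda>P x. rev (f P x))"
proof -
  have "computable (\<lambda>P x. fold (#) (f P x) [])"
    by (intro computable_fold computable_intros assms)
  then show ?thesis by (simp add: fold_Cons_rev)
qed

lemma computable_foldr [computable_intros]:
  assumes "computable (\<lambda>P z. h P (fst z) (fst (snd z)) (snd (snd z)))" "computable f" "computable g"
  shows "computable (\<lambda>P x. foldr (h P x) (f P x) (g P x))"
  unfolding foldr_conv_fold by (intro computable_fold computable_rev assms)

lemma computable_append [computable_intros]:
  assumes "computable f" "computable g" shows "computable (\<lambda>P x. f P x @ g P x)"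
proof -
  have "computable (\<lambda>P x. foldr (#) (f P x) (g P x))" by (intro computable_intros assms)
  moreover have "foldr (#) xs ys = xs @ ys" for xs ys :: "'b list" by (induction xs) auto
  ultimately show ?thesis by simp
qed

lemma computable_map [computable_intros]:
  assumes "computable (\<lambda>P z. h P (fst z) (snd z))" "computable f"
  shows "computable (\<lambda>P x. map (h P x) (f P x))"
proof -
  have "computable (\<lambda>P x. foldr (\<lambda>y r. h P x y # r) (f P x) [])"
    by (intro computable_intros computable_comp2[OF assms(1)] assms(2))
  moreover have "foldr (\<lambda>y r. h' y # r) ys [] = map h' ys" for h' :: "'b \<Rightarrow> 'c" and ys
    by (induction ys) auto
  ultimately show ?thesis by simp
qed

lemma computable_filter [computable_intros]:
  assumes "decidable (\<lambda>P z. Q P (fst z) (snd z))" "computable f"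
  shows "computable (\<lambda>P x. filter (Q P x) (f P x))"
proof -
  have "computable (\<lambda>P x. foldr (\<lambda>y r. if Q P x y then y # r else r) (f P x) [])"
    by (intro computable_intros decidable_comp2[OF assms(1)] assms(2))
  moreover have "foldr (\<lambda>y r. if Q' y then y # r else r) ys [] = filter Q' ys" for Q' :: "'b \<Rightarrow> bool" and ys
    by (induction ys) auto
  ultimately show ?thesis by simp
qed

lemma decidable_Ball [computable_intros]:
  assumes "decidable (\<lambda>P z. Q P (fst z) (snd z))" "computable f"
  shows "decidable (\<lambda>P x. \<forall>y\<in>set (f P x). Q P x y)"
proof -
  have "decidable (\<lambda>P x. filter (\<lambda>y. \<not> Q P x y) (f P x) = [])"
    by (intro computable_intros assms)
  then show ?thesis by (simp add: filter_empty_conv)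
qed

lemma decidable_Bex [computable_intros]:
  assumes "decidable (\<lambda>P z. Q P (fst z) (snd z))" "computable f"
  shows "decidable (\<lambda>P x. \<exists>y\<in>set (f P x). Q P x y)"
  using decidable_not[OF decidable_Ball[OF decidable_not[OF assms(1)] assms(2)]] by simp

lemma decidable_member [computable_intros]:
  assumes "computable g" "computable f" shows "decidable (\<lambda>P x. g P x \<in> set (f P x))"
proof -
  have "decidable (\<lambda>P x. \<exists>y\<in>set (f P x). y = g P x)"
    by (intro computable_intros assms(2) computable_comp[OF assms(1)])
  then show ?thesis by simp
qed

lemma computable_length [computable_intros]:
  assumes "computable f" shows "computable (\<lambda>P x. length (f P x))"
proof -
  have "computable (\<lambda>P x. foldr (\<lambda>y. Suc) (f P x) 0)" by (intro computable_intros assms)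
  moreover have "foldr (\<lambda>y. Suc) xs 0 = length xs" for xs :: "'b list" by (induction xs) auto
  ultimately show ?thesis by simp
qed

lemma computable_concat [computable_intros]:
  assumes "computable f" shows "computable (\<lambda>P x. concat (f P x))"
  unfolding concat_conv_foldr by (intro computable_intros assms)

lemma computable_sum_list [computable_intros]:
  assumes "computable f" shows "computable (\<lambda>P x. sum_list (f P x) :: int)"
proof -
  have "computable (\<lambda>P x. foldr (+) (f P x) 0 :: int)" by (intro computable_intros assms)
  then show ?thesis by (simp add: sum_list.eq_foldr)
qed

lemma computable_upt [computable_intros]:
  assumes "computable n" shows "computable (\<lambda>P x. [0..<n P x])"
proof -
  have "computable (\<lambda>P x. rec_nat [] (\<lambda>k r. r @ [k]) (n P x))" by (intro computable_intros assms)
  moreover have "rec_nat [] (\<lambda>k r. r @ [k]) m = [0..<m]" for m by (induction m) auto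
  ultimately show ?thesis by simp
qed

lemma computable_drop [computable_intros]:
  assumes "computable n" "computable f" shows "computable (\<lambda>P x. drop (n P x) (f P x))"
proof -
  have "computable (\<lambda>P x. rec_nat (f P x) (\<lambda>k r. tl r) (n P x))" by (intro computable_intros assms)
  moreover have "rec_nat xs (\<lambda>k r. tl r) m = drop m xs" for m and xs :: "'b list"
    by (induction m) (auto simp: drop_Suc tl_drop)
  ultimately show ?thesis by simp
qed

lemma computable_take [computable_intros]:
  assumes "computable n" "computable f" shows "computable (\<lambda>P x. take (n P x) (f P x))"
proof -
  have "computable (\<lambda>P x. rev (drop (length (f P x) - n P x) (rev (f P x))))"
    by (intro computable_intros assms)
  moreover have "rev (drop (length xs - m) (rev xs)) = take m xs" for m and xs :: "'b list"
    by (cases "m \<le> length xs") (simp_all add: rev_drop)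
  ultimately show ?thesis by simp
qed

definition lnth :: "'a::enc list \<Rightarrow> nat \<Rightarrow> 'a" where
  "lnth xs n = lhd (drop n xs)"

lemma lnth_eq_nth [simp]: "n < length xs \<Longrightarrow> lnth xs n = xs ! n"
  by (simp add: lnth_def hd_drop_conv_nth lhd_eq_hd)

lemma computable_lnth [computable_intros]:
  assumes "computable f" "computable n" shows "computable (\<lambda>P x. lnth (f P x) (n P x))"
  unfolding lnth_def by (intro computable_intros assms)

lemma computable_remdups [computable_intros]:
  assumes "computable f" shows "computable (\<lambda>P x. remdups (f P x))"
proof -
  have "computable (\<lambda>P x. foldr (\<lambda>y r. if y \<in> set r then r else y # r) (f P x) [])"
    by (intro computable_intros assms)
  moreover have "foldr (\<lambda>y r. if y \<in> set r then r else y # r) xs [] = remdups xs" for xs :: "'b list"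
  proof (induction xs)
    case (Cons x xs)
    then show ?case by (simp only: foldr.simps o_apply remdups.simps set_remdups)
  qed simp
  ultimately show ?thesis by simp
qed

text \<open>A call of the test off determinant 1 must not even be started, but composition evaluates
  all of its arguments. Primitive recursion evaluates its step only if the counter is positive, so
  the determinant condition, as a counter 0 or 1, guards the call.\<close>

lemma decidable_oracle [computable_intros]:
  assumes f: "computable f" shows "decidable (\<lambda>P x. P (f P x))"
proof -
  define a b c d where "a P x = fst (f P x)" and "b P x = fst (snd (f P x))"
    and "c P x = fst (snd (snd (f P x)))" and "d P x = snd (snd (snd (f P x)))" for P x
  note abcd = a_def b_def c_def d_def
  have g: "computable (\<lambda>P x. if a P x * d P x - b P x * c P x = 1 then 1 else 0 :: nat)"
    unfolding abcd by (intro computable_intros f)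
  have ab: "computable a" "computable b" "computable c" "computable d"
    unfolding abcd[abs_def] by (intro computable_intros f)+
  have prg: "\<exists>p. \<forall>t P n. oracle_for t P \<longrightarrow> runs_with t p [n] (enc (e P (dec n)))"
    if "computable e" for e :: "_ \<Rightarrow> _ \<Rightarrow> 'z::enc"
    using that unfolding computable_def computable_on_def
    by (metis One_nat_def length_Cons list.sel(1) list.size(3))
  obtain pg where
    pg: "\<And>t P n. oracle_for t P \<Longrightarrow> runs_with t pg [n] (if a P (dec n) * d P (dec n) - b P (dec n) * c P (dec n) = 1 then 1 else 0)"
    using prg[OF g] unfolding enc_nat_def by blast
  obtain pa where pa: "\<And>t P n. oracle_for t P \<Longrightarrow> runs_with t pa [n] (enc (a P (dec n)))"
    using prg[OF ab(1)] by blast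
  obtain pb where pb: "\<And>t P n. oracle_for t P \<Longrightarrow> runs_with t pb [n] (enc (b P (dec n)))"
    using prg[OF ab(2)] by blast
  obtain pc where pc: "\<And>t P n. oracle_for t P \<Longrightarrow> runs_with t pc [n] (enc (c P (dec n)))"
    using prg[OF ab(3)] by blast
  obtain pd where pd: "\<And>t P n. oracle_for t P \<Longrightarrow> runs_with t pd [n] (enc (d P (dec n)))"
    using prg[OF ab(4)] by blast
  \<comment> \<open>The step of the recursion receives the counter, the previous value and the
    parameter; \<open>Proj 2\<close> selects the parameter, which is the code of the input.\<close>
  let ?call = "Comp (Comp Sub [pa, pb, pc, pd]) [Proj 2]"
  let ?p = "Comp (PrimRec Zero ?call) [pg, Proj 0]"
  have main: "runs_with t ?p [n] (if P (f P (dec n)) then 1 else 0)" if t: "oracle_for t P" for t P n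
  proof -
    let ?x = "dec n"
    have fP: "f P ?x = (a P ?x, b P ?x, c P ?x, d P ?x)" by (simp add: abcd)
    let ?g = "if a P ?x * d P ?x - b P ?x * c P ?x = 1 then 1 else 0 :: nat"
    let ?r = "if P (f P ?x) then 1 else 0 :: nat"
    have or: "if a P ?x * d P ?x - b P ?x * c P ?x = 1
      then runs t [enc (a P ?x), enc (b P ?x), enc (c P ?x), enc (d P ?x)] ?r else \<not> P (f P ?x)"
      using t unfolding oracle_for_def fP by blast
    have "evaluates (runs t) (PrimRec Zero ?call) [?g, n] ?r"
    proof (cases "a P ?x * d P ?x - b P ?x * c P ?x = 1")
      case True
      have "evaluates (runs t) (Comp Sub [pa, pb, pc, pd]) [n] ?r"
      proof (rule evaluates.Comp)
        show "evaluates (runs t) Sub [enc (a P ?x), enc (b P ?x), enc (c P ?x), enc (d P ?x)] ?r"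
          using or True by (intro evaluates.Sub) (simp only: if_True)
        show "list_all2 (\<lambda>q y. evaluates (runs t) q [n] y) [pa, pb, pc, pd]
            [enc (a P ?x), enc (b P ?x), enc (c P ?x), enc (d P ?x)]"
          using pa[OF t, of n] pb[OF t, of n] pc[OF t, of n] pd[OF t, of n] by (simp add: runs_with_def)
      qed
      then have "evaluates (runs t) ?call [0, 0, n] ?r"
        using evaluates.Proj[of 2 "[0, 0, n]" "runs t"]
        by - (rule evaluates.Comp[where ys = "[n]", rotated], assumption, simp)
      then have "evaluates (runs t) (PrimRec Zero ?call) [Suc 0, n] ?r"
        by (rule evaluates.PrimRec_Suc[OF evaluates.PrimRec_0[OF evaluates.Zero]])
      then show ?thesis using True by simp
    next
      case False
      then have "\<not> P (f P ?x)" using or by simp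
      moreover have "evaluates (runs t) (PrimRec Zero ?call) [0, n] 0"
        by (intro evaluates.PrimRec_0 evaluates.Zero)
      ultimately show ?thesis using False by simp
    qed
    moreover have "evaluates (runs t) (Proj 0) [n] n"
      using evaluates.Proj[of 0 "[n]" "runs t"] by simp
    ultimately show ?thesis
      unfolding runs_with_def using pg[OF t, of n]
      by - (rule evaluates.Comp[where ys = "[?g, n]", rotated], assumption, simp add: runs_with_def)
  qed
  have "runs_with t ?p xs (enc (if P (f P (dec (hd xs))) then 1 else 0 :: nat))"
    if "oracle_for t P" "length xs = 1" for t P xs
  proof -
    from that(2) obtain n where "xs = [n]" by (auto simp: length_Suc_conv)
    then show ?thesis using main[OF that(1), of n] by (simp add: enc_nat_def)
  qed
  then show ?thesis
    unfolding decidable_def computable_def by (rule computable_onI)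
qed

section \<open>Chains of tuples\<close>

definition ev :: "('a \<Rightarrow> int) \<Rightarrow> ('a \<Rightarrow>\<^sub>0 int) \<Rightarrow> int" where
  "ev f c = (\<Sum>x\<in>Poly_Mapping.keys c. Poly_Mapping.lookup c x * f x)"

lemma lookup_sum_frag: "finite I \<Longrightarrow> Poly_Mapping.lookup (sum g I) x = (\<Sum>i\<in>I. Poly_Mapping.lookup (g i) x)"
  by (induction I rule: finite_induct) (auto simp: Poly_Mapping.lookup_add)

text \<open>The integers are seen as the free abelian group on one generator, which reduces the
  linearity of \<open>ev\<close> to that of \<open>frag_extend\<close>.\<close>

lemma ev_conv: "ev f c = Poly_Mapping.lookup (frag_extend (\<lambda>x. frag_cmul (f x) (frag_of ())) c) ()"
  by (simp add: ev_def frag_extend_def lookup_sum_frag)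

lemma ev_0 [simp]: "ev f 0 = 0"
  by (simp add: ev_def)

lemma ev_frag_of [simp]: "ev f (frag_of x) = f x"
  by (simp add: ev_conv)

lemma ev_add: "ev f (c + d) = ev f c + ev f d"
  by (simp add: ev_conv frag_extend_add Poly_Mapping.lookup_add)

lemma ev_diff: "ev f (c - d) = ev f c - ev f d"
  by (simp add: ev_conv frag_extend_diff Poly_Mapping.lookup_minus)

lemma ev_cong: "(\<And>x. x \<in> Poly_Mapping.keys c \<Longrightarrow> f x = g x) \<Longrightarrow> ev f c = ev g c"
  by (simp add: ev_def)

lemma ev_add_fun: "ev (\<lambda>x. f x + g x) c = ev f c + ev g c"
  by (simp add: ev_def sum.distrib algebra_simps)

lemma ev_diff_fun: "ev (\<lambda>x. f x - g x) c = ev f c - ev g c"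
  by (simp add: ev_def sum_subtractf algebra_simps)

lemma ev_sum_fun: "ev (\<lambda>x. \<Sum>i\<in>I. f i x) c = (\<Sum>i\<in>I. ev (f i) c)"
  unfolding ev_def by (subst sum.swap) (simp add: sum_distrib_left)

lemma ev_cmul_fun: "ev (\<lambda>x. k * f x) c = k * ev f c"
  by (simp add: ev_def sum_distrib_left algebra_simps)

lemma ev_zero_fun [simp]: "ev (\<lambda>x. 0) c = 0"
  by (simp add: ev_def)

lemma frag_extend_frag_extend: "frag_extend f (frag_extend g c) = frag_extend (\<lambda>x. frag_extend f (g x)) c"
  using subset_UNIV by (induction c rule: frag_induction) (auto simp: frag_extend_diff)

lemma ev_frag_extend: "ev f (frag_extend g c) = ev (\<lambda>x. ev f (g x)) c"
  using subset_UNIV by (induction c rule: frag_induction) (auto simp: frag_extend_diff ev_diff)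

lemma frag_extend_diff_fun: "frag_extend (\<lambda>x. f x - g x) c = frag_extend f c - frag_extend g c"
  using subset_UNIV by (induction c rule: frag_induction) (auto simp: frag_extend_diff)

lemma frag_extend_cong [fundef_cong]:
  "c = d \<Longrightarrow> (\<And>x. x \<in> Poly_Mapping.keys d \<Longrightarrow> f x = g x) \<Longrightarrow> frag_extend f c = frag_extend g d"
  using frag_extend_eq by blast

lemma keys_frag_extend_subset:
  "(\<And>x. x \<in> Poly_Mapping.keys c \<Longrightarrow> Poly_Mapping.keys (f x) \<subseteq> S) \<Longrightarrow> Poly_Mapping.keys (frag_extend f c) \<subseteq> S"
  using keys_frag_extend[of f c] by blast

lemma keys_diff_subset:
  "Poly_Mapping.keys c \<subseteq> S \<Longrightarrow> Poly_Mapping.keys d \<subseteq> S \<Longrightarrow> Poly_Mapping.keys (c - d) \<subseteq> S"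
  using keys_diff[of c d] by blast

section \<open>Boundary, cones and prisms\<close>

definition precons :: "'a \<Rightarrow> ('a list \<Rightarrow>\<^sub>0 int) \<Rightarrow> ('a list \<Rightarrow>\<^sub>0 int)" where
  "precons x = frag_extend (\<lambda>xs. frag_of (x # xs))"

text \<open>The alternating sum of faces, generated by the rule that the boundary of a cone is its
  base minus the cone over the boundary. The complex is augmented: a tuple of length 1 has the empty
  tuple as boundary, so degrees are shifted by one against lengths.\<close>

primrec bd :: "'a list \<Rightarrow> ('a list \<Rightarrow>\<^sub>0 int)" where
  "bd [] = 0"
| "bd (x # xs) = frag_of xs - precons x (bd xs)"

abbreviation Bd :: "('a list \<Rightarrow>\<^sub>0 int) \<Rightarrow> ('a list \<Rightarrow>\<^sub>0 int)" where
  "Bd \<equiv> frag_extend bd"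

definition maps :: "('a \<Rightarrow> 'b) \<Rightarrow> ('a list \<Rightarrow>\<^sub>0 int) \<Rightarrow> ('b list \<Rightarrow>\<^sub>0 int)" where
  "maps h = frag_extend (\<lambda>xs. frag_of (map h xs))"

lemma precons_add: "precons x (c + d) = precons x c + precons x d"
  by (simp add: precons_def frag_extend_add)

lemma precons_simps [simp]:
  "precons x 0 = 0" "precons x (frag_of xs) = frag_of (x # xs)"
  "precons x (c - d) = precons x c - precons x d"
  by (auto simp: precons_def frag_extend_diff)

lemma maps_simps [simp]:
  "maps h 0 = 0" "maps h (frag_of xs) = frag_of (map h xs)"
  "maps h (c - d) = maps h c - maps h d"
  by (auto simp: maps_def frag_extend_diff)

lemma keys_precons: "Poly_Mapping.keys (precons x c) \<subseteq> (#) x ` Poly_Mapping.keys c"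
  unfolding precons_def by (rule order_trans[OF keys_frag_extend]) auto

lemma keys_maps: "Poly_Mapping.keys (maps h c) \<subseteq> map h ` Poly_Mapping.keys c"
  unfolding maps_def by (rule order_trans[OF keys_frag_extend]) auto

lemma keys_bd: "Poly_Mapping.keys (bd xs) \<subseteq> {ys. set ys \<subseteq> set xs \<and> Suc (length ys) = length xs}"
proof (induction xs)
  case (Cons x xs)
  have "Poly_Mapping.keys (precons x (bd xs)) \<subseteq> {ys. set ys \<subseteq> set (x # xs) \<and> Suc (length ys) = length (x # xs)}"
    using Cons keys_precons[of x "bd xs"] by fastforce
  then show ?case unfolding bd.simps by (intro keys_diff_subset) auto
qed simp

lemma maps_precons: "maps h (precons x c) = precons (h x) (maps h c)"
  by (simp add: maps_def precons_def frag_extend_frag_extend)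

lemma maps_maps: "maps g (maps h c) = maps (\<lambda>x. g (h x)) c"
  by (simp add: maps_def frag_extend_frag_extend o_def)

lemma maps_cong:
  assumes "\<And>xs x. xs \<in> Poly_Mapping.keys c \<Longrightarrow> x \<in> set xs \<Longrightarrow> g x = h x" shows "maps g c = maps h c"
  unfolding maps_def by (rule frag_extend_eq) (use assms in \<open>metis map_cong\<close>)

lemma bd_map: "bd (map h xs) = maps h (bd xs)"
  by (induction xs) (auto simp: maps_precons)

lemma Bd_maps: "Bd (maps h c) = maps h (Bd c)"
  unfolding maps_def by (simp add: frag_extend_frag_extend bd_map[unfolded maps_def])

text \<open>Taking the cone over a fixed vertex contracts the complex of all tuples: a cycle is the
  boundary of its cone.\<close>

lemma Bd_precons: "Bd (precons x c) = c - precons x (Bd c)"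
proof -
  have "Bd (precons x c) = frag_extend (\<lambda>xs. frag_of xs - precons x (bd xs)) c"
    by (simp add: precons_def frag_extend_frag_extend)
  also have "\<dots> = c - frag_extend (\<lambda>xs. precons x (bd xs)) c"
    by (simp add: frag_extend_diff_fun flip: frag_expansion)
  also have "frag_extend (\<lambda>xs. precons x (bd xs)) c = precons x (Bd c)"
    by (simp add: precons_def frag_extend_frag_extend)
  finally show ?thesis .
qed

lemma Bd_bd [simp]: "Bd (bd xs) = 0"
  by (induction xs) (auto simp: frag_extend_diff Bd_precons)

text \<open>The chain homotopy between the maps induced by \<open>f\<close> and \<open>g\<close>:
  the alternating sum of the tuples (f x_0, ..., f x_i, g x_i, ..., g x_n). Its tuples mix values of
  both functions, which is what any family containing them must tolerate.\<close>

primrec prism :: "('a \<Rightarrow> 'b) \<Rightarrow> ('a \<Rightarrow> 'b) \<Rightarrow> 'a list \<Rightarrow> ('b list \<Rightarrow>\<^sub>0 int)" where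
  "prism f g [] = 0"
| "prism f g (x # xs) = frag_of (f x # g x # map g xs) - precons (f x) (prism f g xs)"

lemma prism_precons: "frag_extend (prism f g) (precons x c)
    = precons (f x) (precons (g x) (maps g c)) - precons (f x) (frag_extend (prism f g) c)"
  using subset_UNIV by (induction c rule: frag_induction) (auto simp: frag_extend_diff)

lemma Bd_prism: "Bd (prism f g xs) = frag_of (map g xs) - frag_of (map f xs) - frag_extend (prism f g) (bd xs)"
proof (induction xs)
  case (Cons x xs)
  show ?case
    by (simp add: frag_extend_diff Bd_precons Cons prism_precons bd_map precons_add algebra_simps)
qed simp

lemma keys_prism:
  "Poly_Mapping.keys (prism f g xs) \<subseteq> {ys. set ys \<subseteq> f ` set xs \<union> g ` set xs \<and> length ys = Suc (length xs)}"
proof (induction xs)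
  case (Cons x xs)
  have "Poly_Mapping.keys (precons (f x) (prism f g xs))
      \<subseteq> {ys. set ys \<subseteq> f ` set (x # xs) \<union> g ` set (x # xs) \<and> length ys = Suc (length (x # xs))}"
    using Cons keys_precons[of "f x" "prism f g xs"] by fastforce
  then show ?case unfolding prism.simps by (intro keys_diff_subset) auto
qed simp

lemma prism_map: "prism (\<lambda>x. h (f x)) (\<lambda>x. h (g x)) xs = maps h (prism f g xs)"
  by (induction xs) (auto simp: maps_precons o_def)

lemma prism_map2: "prism f g (map h xs) = prism (\<lambda>x. f (h x)) (\<lambda>x. g (h x)) xs"
  by (induction xs) (auto simp: o_def)

lemma prism_cong: "(\<And>x. x \<in> set xs \<Longrightarrow> f x = f' x \<and> g x = g' x) \<Longrightarrow> prism f g xs = prism f' g' xs"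
proof (induction xs)
  case (Cons x xs)
  then have "prism f g xs = prism f' g' xs" "map g xs = map g' xs" by auto
  moreover have "f x = f' x" "g x = g' x" using Cons.prems[of x] by auto
  ultimately show ?case by (simp only: prism.simps)
qed simp

lemma ev_precons: "ev f (precons x c) = ev (\<lambda>xs. f (x # xs)) c"
  by (simp add: precons_def ev_frag_extend)

lemma ev_bd: "ev f (bd xs) = (\<Sum>i<length xs. (- 1) ^ i * f (take i xs @ drop (Suc i) xs))"
proof (induction xs arbitrary: f)
  case (Cons x xs)
  have "ev f (bd (x # xs)) = f xs - (\<Sum>i<length xs. (- 1) ^ i * f (x # take i xs @ drop (Suc i) xs))"
    by (simp add: ev_diff ev_precons Cons)
  also have "\<dots> = (\<Sum>i<length (x # xs). (- 1) ^ i * f (take i (x # xs) @ drop (Suc i) (x # xs)))"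
    by (simp add: sum.lessThan_Suc_shift sum_negf del: sum.lessThan_Suc)
  finally show ?case .
qed simp

lemma coboundary_eq_ev:
  "coboundary G m f = (\<lambda>xs. if xs \<in> tuples G (Suc (Suc m)) then ev f (bd xs) else 0)"
  by (auto simp: coboundary_def ev_bd fun_eq_iff tuples_def lessThan_Suc_atMost)

lemma carrier_cochains:
  "f \<in> carrier (cochains G m) \<longleftrightarrow> (\<forall>xs. xs \<notin> tuples G (Suc m) \<longrightarrow> f xs = 0) \<and>
    (\<forall>a\<in>carrier G. \<forall>xs\<in>tuples G (Suc m). f (map (\<lambda>x. a \<otimes>\<^bsub>G\<^esub> x) xs) = f xs)"
  by (simp add: cochains_def)

lemma cochains_simps [simp]:
  "\<one>\<^bsub>cochains G m\<^esub> = (\<lambda>xs. 0)" "f \<otimes>\<^bsub>cochains G m\<^esub> h = (\<lambda>xs. f xs + h xs)"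
  by (simp_all add: cochains_def)

lemma cocycles_iff:
  "f \<in> cocycles G m \<longleftrightarrow> f \<in> carrier (cochains G m) \<and> (\<forall>xs\<in>tuples G (Suc (Suc m)). ev f (bd xs) = 0)"
  by (auto simp: cocycles_def kernel_def coboundary_eq_ev fun_eq_iff)

lemma keys_bd_tuples: "xs \<in> tuples G (Suc m) \<Longrightarrow> Poly_Mapping.keys (bd xs) \<subseteq> tuples G m"
  using keys_bd[of xs] by (fastforce simp: tuples_def)

section \<open>Left translation of tuples\<close>

context group begin

abbreviation shift :: "'a \<Rightarrow> 'a list \<Rightarrow> 'a list" where
  "shift a \<equiv> map (\<lambda>x. a \<otimes> x)"

text \<open>The representative with first entry 1 of an orbit of nonempty tuples. Translation is
  free there, so an equivariant map may be prescribed arbitrarily on such tuples.\<close>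

definition normalized :: "'a list \<Rightarrow> 'a list" where
  "normalized xs = shift (inv (hd xs)) xs"

lemma shift_shift: "a \<in> carrier G \<Longrightarrow> b \<in> carrier G \<Longrightarrow> set xs \<subseteq> carrier G \<Longrightarrow> shift a (shift b xs) = shift (a \<otimes> b) xs"
  by (auto simp: m_assoc)

lemma shift_one: "set xs \<subseteq> carrier G \<Longrightarrow> shift \<one> xs = xs"
  by (induction xs) auto

lemma shift_carrier: "a \<in> carrier G \<Longrightarrow> set xs \<subseteq> carrier G \<Longrightarrow> set (shift a xs) \<subseteq> carrier G"
  by auto

lemma shift_tuples: "a \<in> carrier G \<Longrightarrow> xs \<in> tuples G m \<Longrightarrow> shift a xs \<in> tuples G m"
  by (auto simp: tuples_def)

lemma hd_carrier: "set xs \<subseteq> carrier G \<Longrightarrow> xs \<noteq> [] \<Longrightarrow> hd xs \<in> carrier G"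
  by (cases xs) auto

lemma length_normalized [simp]: "length (normalized xs) = length xs"
  by (simp add: normalized_def)

lemma normalized_carrier: "set xs \<subseteq> carrier G \<Longrightarrow> xs \<noteq> [] \<Longrightarrow> set (normalized xs) \<subseteq> carrier G"
  unfolding normalized_def by (intro shift_carrier inv_closed hd_carrier)

lemma shift_normalized: "set xs \<subseteq> carrier G \<Longrightarrow> xs \<noteq> [] \<Longrightarrow> shift (hd xs) (normalized xs) = xs"
  unfolding normalized_def using hd_carrier[of xs]
  by (subst shift_shift) (auto simp: shift_one simp del: map_map)

lemma normalized_shift:
  assumes "set xs \<subseteq> carrier G" "xs \<noteq> []" "a \<in> carrier G"
  shows "normalized (shift a xs) = normalized xs"
proof -
  have h: "hd xs \<in> carrier G" using assms hd_carrier by blast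
  have "inv (a \<otimes> hd xs) \<otimes> (a \<otimes> x) = inv (hd xs) \<otimes> x" if "x \<in> carrier G" for x
  proof -
    have "inv (a \<otimes> hd xs) \<otimes> (a \<otimes> x) = inv (hd xs) \<otimes> (inv a \<otimes> (a \<otimes> x))"
      using assms h that by (simp add: inv_mult_group m_assoc)
    then show ?thesis using assms that by (simp add: m_assoc[symmetric])
  qed
  then show ?thesis
    using assms unfolding normalized_def by (auto simp: hd_map)
qed

lemma maps_shift_shift:
  assumes "a \<in> carrier G" "b \<in> carrier G" "\<And>xs. xs \<in> Poly_Mapping.keys c \<Longrightarrow> set xs \<subseteq> carrier G"
  shows "maps ((\<otimes>) a) (maps ((\<otimes>) b) c) = maps ((\<otimes>) (a \<otimes> b)) c"
  unfolding maps_maps by (rule maps_cong) (use assms in \<open>simp add: m_assoc subset_iff\<close>)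

lemma ev_maps_shift:
  assumes "\<And>xs. xs \<in> Poly_Mapping.keys c \<Longrightarrow> f (shift a xs) = f xs"
  shows "ev f (maps ((\<otimes>) a) c) = ev f c"
  unfolding maps_def by (simp add: ev_frag_extend) (rule ev_cong, use assms in simp)

lemma coboundary_closed:
  assumes "f \<in> carrier (cochains G m)" shows "coboundary G m f \<in> cocycles G (Suc m)"
  unfolding cocycles_iff carrier_cochains
proof (intro conjI allI impI ballI)
  fix a xs assume a: "a \<in> carrier G" and xs: "xs \<in> tuples G (Suc (Suc m))"
  have "ev f (bd (shift a xs)) = ev f (bd xs)"
    using assms keys_bd_tuples[OF xs] a
    by (subst bd_map, intro ev_maps_shift) (auto simp: carrier_cochains)
  then show "coboundary G m f (shift a xs) = coboundary G m f xs"
    using xs shift_tuples[OF a xs] by (simp add: coboundary_eq_ev)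
next
  fix xs assume xs: "xs \<in> tuples G (Suc (Suc (Suc m)))"
  have "ev (coboundary G m f) (bd xs) = ev (\<lambda>ys. ev f (bd ys)) (bd xs)"
    by (rule ev_cong) (use keys_bd_tuples[OF xs] in \<open>auto simp: coboundary_eq_ev\<close>)
  also have "\<dots> = 0" by (simp flip: ev_frag_extend)
  finally show "ev (coboundary G m f) (bd xs) = 0" .
qed (auto simp: coboundary_eq_ev)

end

text \<open>The members of \<open>E\<close> are the ordered tuples, repetitions allowed, with
  entries in a simplex of a translation invariant simplicial complex on the group. As the complex is
  augmented, \<open>E_acyclic\<close> for n = 0 says that there are vertices and for n = 1 that the
  complex is connected.\<close>

locale acyclic_family = group G for G (structure) +
  fixes E :: "'a list set"
  assumes E_carrier: "xs \<in> E \<Longrightarrow> set xs \<subseteq> carrier G"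
    and E_Nil: "[] \<in> E"
    and E_subset: "xs \<in> E \<Longrightarrow> set ys \<subseteq> set xs \<Longrightarrow> ys \<in> E"
    and E_shift: "a \<in> carrier G \<Longrightarrow> xs \<in> E \<Longrightarrow> shift a xs \<in> E"
    and E_acyclic: "Poly_Mapping.keys c \<subseteq> {xs \<in> E. length xs = n} \<Longrightarrow> Bd c = 0 \<Longrightarrow>
      \<exists>b. Poly_Mapping.keys b \<subseteq> {xs \<in> E. length xs = Suc n} \<and> Bd b = c"
begin

lemma E_shift_iff:
  assumes "a \<in> carrier G" "set xs \<subseteq> carrier G" shows "shift a xs \<in> E \<longleftrightarrow> xs \<in> E"
proof
  assume "shift a xs \<in> E"
  from E_shift[OF inv_closed[OF assms(1)] this] have "shift (inv a) (shift a xs) \<in> E" .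
  moreover have "shift (inv a) (shift a xs) = xs"
    using assms by (subst shift_shift) (simp_all add: shift_one)
  ultimately show "xs \<in> E" by (simp only:)
qed (use assms E_shift in blast)

definition fill :: "nat \<Rightarrow> ('a list \<Rightarrow>\<^sub>0 int) \<Rightarrow> ('a list \<Rightarrow>\<^sub>0 int)" where
  "fill n c = (SOME b. Poly_Mapping.keys b \<subseteq> {xs \<in> E. length xs = Suc n} \<and> Bd b = c)"

lemma fill:
  assumes "Poly_Mapping.keys c \<subseteq> {xs \<in> E. length xs = n}" "Bd c = 0"
  shows "Poly_Mapping.keys (fill n c) \<subseteq> {xs \<in> E. length xs = Suc n}" "Bd (fill n c) = c"
  using someI_ex[OF E_acyclic[OF assms]] by (auto simp: fill_def)

text \<open>An equivariant retraction of the full complex of tuples onto the complex of tuples in \<open>E\<close>.\<close>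

function psi :: "'a list \<Rightarrow> ('a list \<Rightarrow>\<^sub>0 int)" where
  "psi xs = (if xs \<in> E then frag_of xs
     else maps ((\<otimes>) (hd xs)) (fill (length xs - 1) (frag_extend psi (bd (normalized xs)))))"
  by auto
termination
  by (relation "measure length") (use keys_bd in fastforce)+

declare psi.simps [simp del]

lemma psi_E: "xs \<in> E \<Longrightarrow> psi xs = frag_of xs"
  by (simp add: psi.simps)

text \<open>The claims need each other: the chain to be filled is a cycle because \<open>psi\<close>
  commutes with the boundary on shorter tuples, and the boundary of the translated filling is the
  right one because \<open>psi\<close> is equivariant on shorter tuples.\<close>

lemma psi_props:
  assumes "set xs \<subseteq> carrier G"
  shows "Poly_Mapping.keys (psi xs) \<subseteq> {ys \<in> E. length ys = length xs} \<and> Bd (psi xs) = frag_extend psi (bd xs)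
    \<and> (\<forall>a\<in>carrier G. psi (shift a xs) = maps ((\<otimes>) a) (psi xs))"
  using assms
proof (induction "length xs" arbitrary: xs rule: less_induct)
  case less
  show ?case
  proof (cases "xs \<in> E")
    case True
    have "Bd (psi xs) = frag_extend psi (bd xs)"
    proof -
      have "frag_extend psi (bd xs) = frag_extend frag_of (bd xs)"
        by (rule frag_extend_eq) (use True keys_bd[of xs] E_subset in \<open>auto intro!: psi_E\<close>)
      then show ?thesis using True by (simp add: psi_E flip: frag_expansion)
    qed
    then show ?thesis using True by (auto simp: psi_E E_shift)
  next
    case False
    then have ne: "xs \<noteq> []" using E_Nil by auto
    define b where "b = normalized xs"
    have b: "set b \<subseteq> carrier G" "length b = length xs"
      using normalized_carrier[OF less.prems ne] by (auto simp: b_def)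
    have h: "hd xs \<in> carrier G" using hd_carrier less.prems ne by blast
    define c where "c = frag_extend psi (bd b)"
    have IH: "Poly_Mapping.keys (psi ys) \<subseteq> {zs \<in> E. length zs = length xs - 1} \<and>
        Bd (psi ys) = frag_extend psi (bd ys) \<and> (\<forall>a\<in>carrier G. psi (shift a ys) = maps ((\<otimes>) a) (psi ys))"
      if "ys \<in> Poly_Mapping.keys (bd b)" for ys
    proof -
      have "set ys \<subseteq> set b" "Suc (length ys) = length xs" using that keys_bd[of b] b(2) by auto
      then have "length ys < length xs" "set ys \<subseteq> carrier G" and len: "length xs - 1 = length ys" using b(1) by auto
      from less.hyps[OF this(1,2)] show ?thesis unfolding len .
    qed
    have kc: "Poly_Mapping.keys c \<subseteq> {zs \<in> E. length zs = length xs - 1}"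
      unfolding c_def by (rule keys_frag_extend_subset) (use IH in blast)
    have "Bd c = frag_extend (\<lambda>ys. frag_extend psi (bd ys)) (bd b)"
      unfolding c_def frag_extend_frag_extend by (rule frag_extend_eq) (use IH in blast)
    also have "\<dots> = 0" by (simp flip: frag_extend_frag_extend)
    finally have "Bd c = 0" .
    note f = fill[OF kc this]
    have p: "psi xs = maps ((\<otimes>) (hd xs)) (fill (length xs - 1) c)"
      using False by (subst psi.simps) (simp add: c_def b_def)
    have k: "Poly_Mapping.keys (psi xs) \<subseteq> {ys \<in> E. length ys = length xs}"
    proof
      fix ys assume "ys \<in> Poly_Mapping.keys (psi xs)"
      then obtain zs where zs: "zs \<in> Poly_Mapping.keys (fill (length xs - 1) c)" "ys = shift (hd xs) zs"
        using p keys_maps by fastforce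
      then show "ys \<in> {ys \<in> E. length ys = length xs}"
        using f(1) h ne E_shift by auto
    qed
    have "Bd (psi xs) = maps ((\<otimes>) (hd xs)) c"
      unfolding p Bd_maps f(2) ..
    also have "\<dots> = frag_extend (\<lambda>ys. maps ((\<otimes>) (hd xs)) (psi ys)) (bd b)"
      by (simp add: c_def maps_def frag_extend_frag_extend)
    also have "\<dots> = frag_extend (\<lambda>ys. psi (shift (hd xs) ys)) (bd b)"
      by (rule frag_extend_eq) (use IH h in simp)
    also have "\<dots> = frag_extend psi (maps ((\<otimes>) (hd xs)) (bd b))"
      by (simp add: maps_def frag_extend_frag_extend)
    also have "\<dots> = frag_extend psi (bd xs)"
      by (simp add: shift_normalized[OF less.prems ne] b_def flip: bd_map)
    finally have B: "Bd (psi xs) = frag_extend psi (bd xs)" .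
    have "psi (shift a xs) = maps ((\<otimes>) a) (psi xs)" if a: "a \<in> carrier G" for a
    proof -
      have "shift a xs \<notin> E" using E_shift_iff[OF a less.prems] False by simp
      then have "psi (shift a xs) = maps ((\<otimes>) (hd (shift a xs))) (fill (length xs - 1) c)"
        using normalized_shift[OF less.prems ne a] by (subst psi.simps) (simp add: c_def b_def)
      also have "\<dots> = maps ((\<otimes>) (a \<otimes> hd xs)) (fill (length xs - 1) c)"
        using ne by (simp add: hd_map)
      also have "\<dots> = maps ((\<otimes>) a) (psi xs)"
        unfolding p by (rule maps_shift_shift[symmetric]) (use a h f(1) E_carrier in auto)
      finally show ?thesis .
    qed
    with k B show ?thesis by blast
  qed
qed

text \<open>A homotopy from the retraction to the identity, built with the cone over \<open>1\<close>.\<close>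

function htp :: "'a list \<Rightarrow> ('a list \<Rightarrow>\<^sub>0 int)" where
  "htp xs = (if xs = [] then 0 else maps ((\<otimes>) (hd xs)) (precons \<one>
     (frag_of (normalized xs) - psi (normalized xs) - frag_extend htp (bd (normalized xs)))))"
  by auto
termination
  by (relation "measure length") (use keys_bd in fastforce)+

declare htp.simps [simp del]

text \<open>The homotopy may leave \<open>E\<close>, so the cycle that measures the defect is filled
  by a cone in the complex of all tuples. Coning over 1 after normalizing amounts to coning over the
  first entry, an equivariant choice of apex.\<close>

lemma htp_props:
  assumes "set xs \<subseteq> carrier G"
  shows "Poly_Mapping.keys (htp xs) \<subseteq> tuples G (Suc (length xs))
    \<and> Bd (htp xs) = frag_of xs - psi xs - frag_extend htp (bd xs)
    \<and> (\<forall>a\<in>carrier G. htp (shift a xs) = maps ((\<otimes>) a) (htp xs))"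
  using assms
proof (induction "length xs" arbitrary: xs rule: less_induct)
  case less
  show ?case
  proof (cases "xs = []")
    case True
    then show ?thesis by (simp add: htp.simps psi_E E_Nil)
  next
    case ne: False
    define b where "b = normalized xs"
    have b: "set b \<subseteq> carrier G" "length b = length xs"
      using normalized_carrier[OF less.prems ne] by (auto simp: b_def)
    have h: "hd xs \<in> carrier G" using hd_carrier less.prems ne by blast
    define c where "c = frag_of b - psi b - frag_extend htp (bd b)"
    have IH: "Poly_Mapping.keys (htp ys) \<subseteq> tuples G (length xs) \<and>
        Bd (htp ys) = frag_of ys - psi ys - frag_extend htp (bd ys) \<and>
        (\<forall>a\<in>carrier G. htp (shift a ys) = maps ((\<otimes>) a) (htp ys))"
      if "ys \<in> Poly_Mapping.keys (bd b)" for ys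
    proof -
      have "set ys \<subseteq> set b" "Suc (length ys) = length xs" using that keys_bd[of b] b(2) by auto
      then have "length ys < length xs" "set ys \<subseteq> carrier G" and len: "length xs = Suc (length ys)" using b(1) by auto
      from less.hyps[OF this(1,2)] show ?thesis unfolding len .
    qed
    have kc: "Poly_Mapping.keys c \<subseteq> tuples G (length xs)"
      unfolding c_def
    proof (intro keys_diff_subset keys_frag_extend_subset)
      show "Poly_Mapping.keys (psi b) \<subseteq> tuples G (length xs)"
        using psi_props[OF b(1)] E_carrier b(2) by (fastforce simp: tuples_def)
    qed (use IH b in \<open>auto simp: tuples_def\<close>)
    have "Bd (frag_extend htp (bd b)) = frag_extend (\<lambda>ys. frag_of ys - psi ys - frag_extend htp (bd ys)) (bd b)"
      unfolding frag_extend_frag_extend by (rule frag_extend_eq) (use IH in blast)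
    also have "\<dots> = bd b - frag_extend psi (bd b)"
      by (simp add: frag_extend_diff_fun flip: frag_extend_frag_extend frag_expansion)
    finally have Bc: "Bd c = 0"
      using psi_props[OF b(1)] by (simp add: c_def frag_extend_diff)
    have p: "htp xs = maps ((\<otimes>) (hd xs)) (precons \<one> c)"
      using ne by (subst htp.simps) (simp add: c_def b_def)
    have kcone: "Poly_Mapping.keys (precons \<one> c) \<subseteq> tuples G (Suc (length xs))"
      using keys_precons[of \<one> c] kc by (fastforce simp: tuples_def)
    have k: "Poly_Mapping.keys (htp xs) \<subseteq> tuples G (Suc (length xs))"
      using keys_maps[of "(\<otimes>) (hd xs)" "precons \<one> c"] kcone shift_tuples[OF h] unfolding p by fastforce
    have "Bd (htp xs) = maps ((\<otimes>) (hd xs)) c"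
      by (simp add: p Bd_maps Bd_precons Bc)
    also have "\<dots> = frag_of xs - maps ((\<otimes>) (hd xs)) (psi b) - maps ((\<otimes>) (hd xs)) (frag_extend htp (bd b))"
      using shift_normalized[OF less.prems ne] by (simp add: c_def b_def)
    also have "maps ((\<otimes>) (hd xs)) (psi b) = psi xs"
      using psi_props[OF b(1)] h shift_normalized[OF less.prems ne] by (metis b_def)
    also have "maps ((\<otimes>) (hd xs)) (frag_extend htp (bd b)) = frag_extend (\<lambda>ys. maps ((\<otimes>) (hd xs)) (htp ys)) (bd b)"
      by (simp add: maps_def frag_extend_frag_extend)
    also have "\<dots> = frag_extend (\<lambda>ys. htp (shift (hd xs) ys)) (bd b)"
      by (rule frag_extend_eq) (use IH h in simp)
    also have "\<dots> = frag_extend htp (maps ((\<otimes>) (hd xs)) (bd b))"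
      by (simp add: maps_def frag_extend_frag_extend)
    also have "\<dots> = frag_extend htp (bd xs)"
      by (simp add: shift_normalized[OF less.prems ne] b_def flip: bd_map)
    finally have B: "Bd (htp xs) = frag_of xs - psi xs - frag_extend htp (bd xs)" .
    have "htp (shift a xs) = maps ((\<otimes>) a) (htp xs)" if a: "a \<in> carrier G" for a
    proof -
      have "htp (shift a xs) = maps ((\<otimes>) (hd (shift a xs))) (precons \<one> c)"
        using normalized_shift[OF less.prems ne a] ne by (subst htp.simps) (simp add: c_def b_def)
      also have "\<dots> = maps ((\<otimes>) (a \<otimes> hd xs)) (precons \<one> c)"
        using ne by (simp add: hd_map)
      also have "\<dots> = maps ((\<otimes>) a) (htp xs)"
        unfolding p by (rule maps_shift_shift[symmetric]) (use a h kcone in \<open>auto simp: tuples_def\<close>)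
      finally show ?thesis .
    qed
    with k B show ?thesis by blast
  qed
qed

text \<open>Composition with the retraction \<open>psi\<close> does it: \<open>psi\<close> is an
  equivariant chain map with values in \<open>E\<close> and fixes the tuples of
  \<open>E\<close>.\<close>

lemma extend_cocycle:
  assumes inv: "\<And>a xs. a \<in> carrier G \<Longrightarrow> xs \<in> E \<Longrightarrow> length xs = Suc m \<Longrightarrow> f (shift a xs) = f xs"
    and cocycle: "\<And>xs. xs \<in> E \<Longrightarrow> length xs = Suc (Suc m) \<Longrightarrow> ev f (bd xs) = 0"
  shows "\<exists>F\<in>cocycles G m. \<forall>xs\<in>E. length xs = Suc m \<longrightarrow> F xs = f xs"
proof
  define F where "F xs = (if xs \<in> tuples G (Suc m) then ev f (psi xs) else 0)" for xs
  show "\<forall>xs\<in>E. length xs = Suc m \<longrightarrow> F xs = f xs"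
    using E_carrier by (auto simp: F_def tuples_def psi_E)
  show "F \<in> cocycles G m"
    unfolding cocycles_iff carrier_cochains
  proof (intro conjI ballI allI impI)
    fix a xs assume a: "a \<in> carrier G" and xs: "xs \<in> tuples G (Suc m)"
    have "ev f (psi (shift a xs)) = ev f (maps ((\<otimes>) a) (psi xs))"
      using psi_props[of xs] xs a by (simp add: tuples_def)
    also have "\<dots> = ev f (psi xs)"
      using psi_props[of xs] xs inv[OF a] by (intro ev_maps_shift) (auto simp: tuples_def)
    finally show "F (shift a xs) = F xs"
      using xs shift_tuples[OF a xs] by (simp add: F_def)
  next
    fix xs assume xs: "xs \<in> tuples G (Suc (Suc m))"
    then have car: "set xs \<subseteq> carrier G" by (simp add: tuples_def)
    have "ev F (bd xs) = ev (\<lambda>ys. ev f (psi ys)) (bd xs)"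
      by (rule ev_cong) (use keys_bd_tuples[OF xs] in \<open>auto simp: F_def\<close>)
    also have "\<dots> = ev f (Bd (psi xs))"
      using psi_props[OF car] by (simp add: ev_frag_extend)
    also have "\<dots> = ev (\<lambda>ys. ev f (bd ys)) (psi xs)"
      by (simp add: ev_frag_extend)
    also have "\<dots> = ev (\<lambda>ys. 0) (psi xs)"
      by (rule ev_cong) (use psi_props[OF car] cocycle xs in \<open>auto simp: tuples_def\<close>)
    finally show "ev F (bd xs) = 0" by simp
  qed (auto simp: F_def)
qed

text \<open>Evaluate \<open>F\<close> on the homotopy formula: the term with \<open>psi\<close>
  vanishes because it lies in \<open>E\<close>, the boundary of \<open>htp\<close> because
  \<open>F\<close> is a cocycle. What remains exhibits \<open>F\<close> as the coboundary of its
  composition with \<open>htp\<close>.\<close>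

lemma cocycle_vanishing_on_E:
  assumes F: "F \<in> cocycles G m" and 0: "\<And>xs. xs \<in> E \<Longrightarrow> length xs = Suc m \<Longrightarrow> F xs = 0"
  shows "F \<in> coboundaries G m"
proof -
  have inv: "F (shift a xs) = F xs" if "a \<in> carrier G" "xs \<in> tuples G (Suc m)" for a xs
    using F that by (simp add: cocycles_iff carrier_cochains)
  have F0: "F xs = 0" if "xs \<notin> tuples G (Suc m)" for xs
    using F that by (simp add: cocycles_iff carrier_cochains)
  define u where "u xs = (if xs \<in> tuples G m then ev F (htp xs) else 0)" for xs
  have Fu: "F xs = ev u (bd xs)" if xs: "xs \<in> tuples G (Suc m)" for xs
  proof -
    have car: "set xs \<subseteq> carrier G" and len: "length xs = Suc m" using xs by (auto simp: tuples_def)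
    have "frag_of xs = psi xs + frag_extend htp (bd xs) + Bd (htp xs)"
      using htp_props[OF car] by simp
    then have "ev F (frag_of xs) = ev F (psi xs) + ev F (frag_extend htp (bd xs)) + ev F (Bd (htp xs))"
      by (simp only: ev_add)
    moreover have "ev F (psi xs) = ev (\<lambda>x. 0) (psi xs)"
      by (rule ev_cong) (use psi_props[OF car] len 0 in auto)
    moreover have "ev F (Bd (htp xs)) = ev (\<lambda>x. 0) (htp xs)"
      unfolding ev_frag_extend by (rule ev_cong) (use htp_props[OF car] len F in \<open>auto simp: cocycles_iff\<close>)
    moreover have "ev F (frag_extend htp (bd xs)) = ev u (bd xs)"
      unfolding ev_frag_extend by (rule ev_cong) (use keys_bd_tuples[OF xs] in \<open>auto simp: u_def\<close>)
    ultimately show ?thesis by simp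
  qed
  show ?thesis
  proof (cases m)
    \<comment> \<open>Here \<open>u\<close> would have degree -1 and lives on the empty tuple alone,
      where \<open>htp\<close> is 0. So \<open>F\<close> itself is zero, as the convention for
      coboundaries in degree 0 demands.\<close>
    case 0
    have "F xs = 0" for xs
    proof (cases "xs \<in> tuples G (Suc m)")
      case True
      have "u [] = 0" by (simp add: u_def htp.simps)
      moreover have "Poly_Mapping.keys (bd xs) \<subseteq> {[]}"
        using keys_bd_tuples[OF True] 0 by (auto simp: tuples_def)
      ultimately have "ev u (bd xs) = ev (\<lambda>x. 0) (bd xs)" by (intro ev_cong) auto
      then show ?thesis using Fu[OF True] by simp
    qed (rule F0)
    then show ?thesis using 0 by auto
  next
    case (Suc k)
    have "u \<in> carrier (cochains G k)"
      unfolding carrier_cochains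
    proof (intro conjI ballI allI impI)
      fix a xs assume a: "a \<in> carrier G" and xs: "xs \<in> tuples G (Suc k)"
      have "ev F (htp (shift a xs)) = ev F (maps ((\<otimes>) a) (htp xs))"
        using htp_props[of xs] xs a by (simp add: tuples_def)
      also have "\<dots> = ev F (htp xs)"
        using htp_props[of xs] xs inv[OF a] Suc by (intro ev_maps_shift) (auto simp: tuples_def)
      finally show "u (shift a xs) = u xs"
        using xs shift_tuples[OF a xs] Suc by (simp add: u_def)
    qed (auto simp: u_def Suc)
    moreover have "F = coboundary G k u"
      using Fu F0 Suc by (auto simp: fun_eq_iff coboundary_eq_ev)
    ultimately show ?thesis using Suc by auto
  qed
qed

end

text \<open>Induction on the total depth of the finitely many vertices that occur in a cycle. The
  deepest vertex v can be moved to \<open>f v\<close>, since all its neighbours among these vertices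
  are neighbours of \<open>f v\<close>; the prism then joins the cycle to its image. When all depths
  are at most \<open>B\<close>, any vertices are related and the cone over \<open>a\<close> fills
  the cycle.\<close>

lemma acyclic_dismantlable:
  fixes V :: "'a set" and R :: "'a \<Rightarrow> 'a \<Rightarrow> bool" and depth :: "'a \<Rightarrow> nat"
  defines "E \<equiv> {xs. set xs \<subseteq> V \<and> (\<forall>x\<in>set xs. \<forall>y\<in>set xs. R x y)}"
  assumes sym: "\<And>x y. x \<in> V \<Longrightarrow> y \<in> V \<Longrightarrow> R x y \<Longrightarrow> R y x"
    and refl: "\<And>x. x \<in> V \<Longrightarrow> R x x"
    and step: "\<And>v. v \<in> V \<Longrightarrow> B < depth v \<Longrightarrow> f v \<in> V \<and> depth (f v) < depth v \<and>
      (\<forall>w\<in>V. R v w \<longrightarrow> depth w \<le> depth v \<longrightarrow> R (f v) w)"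
    and base: "\<And>v w. v \<in> V \<Longrightarrow> w \<in> V \<Longrightarrow> depth v \<le> B \<Longrightarrow> depth w \<le> B \<Longrightarrow> R v w"
    and a: "a \<in> V" "depth a \<le> B"
    and c: "Poly_Mapping.keys c \<subseteq> {xs \<in> E. length xs = n}" "Bd c = 0"
  shows "\<exists>b. Poly_Mapping.keys b \<subseteq> {xs \<in> E. length xs = Suc n} \<and> Bd b = c"
proof -
  have main: "\<exists>b. Poly_Mapping.keys b \<subseteq> {xs \<in> E. length xs = Suc n} \<and> Bd b = c"
    if "finite W" "W \<subseteq> V" "Poly_Mapping.keys c \<subseteq> {xs \<in> E. length xs = n \<and> set xs \<subseteq> W}" "Bd c = 0" for W c
    using that
  proof (induction "\<Sum>w\<in>W. depth w" arbitrary: W c rule: less_induct)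
    case less
    show ?case
    proof (cases "\<forall>w\<in>W. depth w \<le> B")
      case True
      have "Poly_Mapping.keys (precons a c) \<subseteq> {xs \<in> E. length xs = Suc n}"
      proof
        fix ys assume "ys \<in> Poly_Mapping.keys (precons a c)"
        then obtain xs where xs': "ys = a # xs" "xs \<in> Poly_Mapping.keys c"
          using keys_precons[of a c] by blast
        then have xs: "ys = a # xs" "xs \<in> E" "length xs = n" "set xs \<subseteq> W"
          using less.prems(3) by auto
        have "R a x \<and> R x a" if "x \<in> set xs" for x
          using that xs True less.prems(2) base a by blast
        then show "ys \<in> {xs \<in> E. length xs = Suc n}"
          using xs a refl by (auto simp: E_def)
      qed
      moreover have "Bd (precons a c) = c" using less.prems(4) by (simp add: Bd_precons)
      ultimately show ?thesis by blast
    next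
      case False
      then have "W \<noteq> {}" by auto
      then have "Max (depth ` W) \<in> depth ` W" using less.prems(1) by simp
      then obtain v where "v \<in> W" "depth v = Max (depth ` W)" by auto
      then have v: "v \<in> W" "\<And>w. w \<in> W \<Longrightarrow> depth w \<le> depth v" using less.prems(1) by auto
      then have "B < depth v" using False by (meson not_le order_trans)
      then have fv: "f v \<in> V" "depth (f v) < depth v"
        "\<And>w. w \<in> W \<Longrightarrow> R v w \<Longrightarrow> R (f v) w"
        using step[of v] v less.prems(2) by auto
      define g where "g x = (if x = v then f v else x)" for x
      \<comment> \<open>The tuples of the prism contain entries of \<open>xs\<close> together with
        \<open>f v\<close>, so \<open>f v\<close> has to be related to everything that v was related
        to, and to v itself.\<close>
      have E1: "ys \<in> E" if xs: "xs \<in> E" "set xs \<subseteq> W" and ys: "set ys \<subseteq> (\<lambda>x. x) ` set xs \<union> g ` set xs" for xs ys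
      proof (cases "v \<in> set xs")
        case True
        have "R (f v) x \<and> R x (f v)" if "x \<in> set xs" for x
        proof -
          have "R v x" "x \<in> W" "x \<in> V" using that True xs by (auto simp: E_def)
          then show ?thesis using fv(3)[of x] sym[OF fv(1)] by blast
        qed
        moreover have "set ys \<subseteq> insert (f v) (set xs)" using ys by (auto simp: g_def split: if_splits)
        moreover have "set xs \<subseteq> V" "\<And>x y. x \<in> set xs \<Longrightarrow> y \<in> set xs \<Longrightarrow> R x y"
          using xs(1) by (auto simp: E_def)
        ultimately show ?thesis using fv(1) refl[OF fv(1)] unfolding E_def by blast
      next
        case False
        then have "set ys \<subseteq> set xs" using ys by (auto simp: g_def split: if_splits)
        then show ?thesis using xs unfolding E_def by blast
      qed
      define W' where "W' = insert (f v) (W - {v})"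
      \<comment> \<open>Only an inequality, since \<open>f v\<close> may already be a vertex of the
        cycle.\<close>
      have "sum depth W' \<le> depth (f v) + sum depth (W - {v})"
        using less.prems(1) by (cases "f v \<in> W - {v}") (auto simp: W'_def insert_absorb)
      also have "\<dots> < sum depth W"
        using less.prems(1) v(1) fv(2) by (subst (2) sum.remove[of _ v]) auto
      finally have "sum depth W' < sum depth W" .
      moreover have "Poly_Mapping.keys (maps g c) \<subseteq> {xs \<in> E. length xs = n \<and> set xs \<subseteq> W'}"
      proof
        fix ys assume "ys \<in> Poly_Mapping.keys (maps g c)"
        then obtain xs where "ys = map g xs" "xs \<in> Poly_Mapping.keys c" using keys_maps[of g c] by blast
        moreover from this(2) less.prems(3) have "xs \<in> E" "length xs = n" "set xs \<subseteq> W" by auto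
        ultimately show "ys \<in> {xs \<in> E. length xs = n \<and> set xs \<subseteq> W'}"
          using E1[of xs ys] by (auto simp: W'_def g_def split: if_splits)
      qed
      moreover have "Bd (maps g c) = 0" by (simp add: Bd_maps less.prems(4))
      ultimately obtain b where b: "Poly_Mapping.keys b \<subseteq> {xs \<in> E. length xs = Suc n}" "Bd b = maps g c"
        using less.hyps[of W' "maps g c"] less.prems(1,2) fv(1) unfolding W'_def by blast
      \<comment> \<open>The boundary of \<open>p\<close> is the moved cycle minus the original one,
        so \<open>b - p\<close> fills the latter.\<close>
      define p where "p = frag_extend (prism (\<lambda>x. x) g) c"
      have "Bd p = frag_extend (\<lambda>xs. frag_of (map g xs) - frag_of xs - frag_extend (prism (\<lambda>x. x) g) (bd xs)) c"
        by (simp add: p_def frag_extend_frag_extend Bd_prism)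
      also have "\<dots> = maps g c - c"
        using less.prems(4) by (simp add: frag_extend_diff_fun maps_def flip: frag_extend_frag_extend frag_expansion)
      finally have "Bd (b - p) = c" by (simp add: frag_extend_diff b)
      moreover have "Poly_Mapping.keys p \<subseteq> {xs \<in> E. length xs = Suc n}"
        unfolding p_def
      proof (rule keys_frag_extend_subset)
        fix xs assume "xs \<in> Poly_Mapping.keys c"
        then have "xs \<in> E" "length xs = n" "set xs \<subseteq> W" using less.prems(3) by auto
        then have "{ys. set ys \<subseteq> (\<lambda>x. x) ` set xs \<union> g ` set xs \<and> length ys = Suc (length xs)}
            \<subseteq> {xs \<in> E. length xs = Suc n}"
          using E1[of xs] by auto
        with keys_prism show "Poly_Mapping.keys (prism (\<lambda>x. x) g xs) \<subseteq> {xs \<in> E. length xs = Suc n}"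
          by (rule order_trans)
      qed
      ultimately show ?thesis using keys_diff_subset[OF b(1)] by blast
    qed
  qed
  let ?W = "\<Union> (set ` Poly_Mapping.keys c)"
  have "Poly_Mapping.keys c \<subseteq> {xs \<in> E. length xs = n \<and> set xs \<subseteq> ?W}" using c(1) by auto
  moreover have "?W \<subseteq> V" using c(1) by (auto simp: E_def)
  ultimately show ?thesis using main[of ?W c] c(2) by auto
qed

section \<open>Acyclicity from a tree\<close>

text \<open>Rooted trees are given by a parent function \<open>p\<close>, which fixes the root.\<close>

definition tree_close :: "('v \<Rightarrow> 'v) \<Rightarrow> nat \<Rightarrow> 'v \<Rightarrow> 'v \<Rightarrow> bool" where
  "tree_close p d v w \<longleftrightarrow> (\<exists>i j. i + j \<le> d \<and> (p ^^ i) v = (p ^^ j) w)"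

lemma tree_close_refl: "tree_close p d v v"
  unfolding tree_close_def by (rule exI[of _ 0], rule exI[of _ 0]) simp

lemma tree_close_sym: "tree_close p d v w \<Longrightarrow> tree_close p d w v"
  unfolding tree_close_def by (metis add.commute)

lemma tree_close_mono: "tree_close p d v w \<Longrightarrow> d \<le> e \<Longrightarrow> tree_close p e v w"
  unfolding tree_close_def by (meson order_trans)

lemma tree_close_trans:
  assumes "tree_close p d u v" "tree_close p e v w" shows "tree_close p (d + e) u w"
proof -
  obtain i j where ij: "i + j \<le> d" "(p ^^ i) u = (p ^^ j) v" using assms(1) by (auto simp: tree_close_def)
  obtain k l where kl: "k + l \<le> e" "(p ^^ k) v = (p ^^ l) w" using assms(2) by (auto simp: tree_close_def)
  show ?thesis
  proof (cases "j \<le> k")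
    case True
    have "(p ^^ (k - j + i)) u = (p ^^ (k - j)) ((p ^^ j) v)" by (simp add: funpow_add ij)
    also have "\<dots> = (p ^^ (k - j + j)) v" by (simp only: funpow_add o_apply)
    also have "\<dots> = (p ^^ l) w" using True kl by simp
    finally show ?thesis unfolding tree_close_def
      using True ij(1) kl(1) by (intro exI[of _ "k - j + i"] exI[of _ l]) auto
  next
    case False
    have "(p ^^ (j - k + l)) w = (p ^^ (j - k)) ((p ^^ k) v)" by (simp add: funpow_add kl)
    also have "\<dots> = (p ^^ (j - k + k)) v" by (simp only: funpow_add o_apply)
    also have "\<dots> = (p ^^ i) u" using False ij by simp
    finally show ?thesis unfolding tree_close_def
      using False ij(1) kl(1) by (intro exI[of _ i] exI[of _ "j - k + l"]) auto
  qed
qed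

definition tree_depth :: "('v \<Rightarrow> 'v) \<Rightarrow> 'v \<Rightarrow> 'v \<Rightarrow> nat" where
  "tree_depth p r v = (LEAST n. (p ^^ n) v = r)"

context
  fixes p :: "'v \<Rightarrow> 'v" and r :: 'v
  assumes root: "p r = r"
begin

lemma funpow_root: "(p ^^ n) r = r"
  by (induction n) (auto simp: root)

lemma tree_depth_reach: "\<exists>n. (p ^^ n) v = r \<Longrightarrow> (p ^^ tree_depth p r v) v = r"
  unfolding tree_depth_def by (rule LeastI_ex)

lemma tree_depth_le_iff:
  assumes "\<exists>n. (p ^^ n) v = r" shows "tree_depth p r v \<le> n \<longleftrightarrow> (p ^^ n) v = r"
proof
  assume le: "tree_depth p r v \<le> n"
  have "(p ^^ n) v = (p ^^ (n - tree_depth p r v)) ((p ^^ tree_depth p r v) v)"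
    using le by (simp flip: funpow_add[unfolded o_def, THEN fun_cong])
  then show "(p ^^ n) v = r" by (simp add: tree_depth_reach[OF assms] funpow_root)
qed (simp add: tree_depth_def Least_le)

lemma tree_depth_funpow:
  assumes "\<exists>n. (p ^^ n) v = r" shows "tree_depth p r ((p ^^ k) v) = tree_depth p r v - k"
proof -
  have *: "(p ^^ n) ((p ^^ k) v) = (p ^^ (n + k)) v" for n by (simp add: funpow_add)
  have "\<exists>n. (p ^^ n) ((p ^^ k) v) = r"
    using tree_depth_le_iff[OF assms, of "tree_depth p r v + k"] by (auto simp: *)
  from tree_depth_le_iff[OF this] tree_depth_le_iff[OF assms]
  have "tree_depth p r ((p ^^ k) v) \<le> n \<longleftrightarrow> tree_depth p r v - k \<le> n" for n
    by (simp add: * le_diff_conv)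
  then show ?thesis by (metis order_antisym order_refl)
qed

text \<open>If the path from v to w climbs more than D edges, starting higher up only shortens it.
  Otherwise it descends at most as far as it climbed, because w is not deeper than v; then the new
  starting point is an ancestor of w at most D + 1 edges away. The constant 2 D + 1 is what makes D
  + 1 at most d - D.\<close>

lemma tree_close_ancestor:
  assumes v: "\<exists>n. (p ^^ n) v = r" and w: "\<exists>n. (p ^^ n) w = r"
    and le: "tree_depth p r w \<le> tree_depth p r v" and D: "D < tree_depth p r v"
    and close: "tree_close p d v w" and d: "2 * D + 1 \<le> d"
  shows "tree_close p (d - D) ((p ^^ Suc D) v) w"
proof -
  obtain i j where ij: "i + j \<le> d" "(p ^^ i) v = (p ^^ j) w" using close by (auto simp: tree_close_def)
  show ?thesis
  proof (cases "Suc D \<le> i")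
    case True
    have "(p ^^ (i - Suc D)) ((p ^^ Suc D) v) = (p ^^ (i - Suc D + Suc D)) v"
      by (simp only: funpow_add o_apply)
    then show ?thesis unfolding tree_close_def
      using True ij by (intro exI[of _ "i - Suc D"] exI[of _ j]) auto
  next
    case False
    have "tree_depth p r v - i = tree_depth p r w - j"
      using tree_depth_funpow[OF v, of i] tree_depth_funpow[OF w, of j] ij by simp
    then have "j \<le> i" using False D le by linarith
    have "(p ^^ (Suc D - i + j)) w = (p ^^ (Suc D - i)) ((p ^^ i) v)"
      by (simp add: funpow_add ij)
    also have "\<dots> = (p ^^ (Suc D - i + i)) v" by (simp only: funpow_add o_apply)
    also have "\<dots> = (p ^^ Suc D) v" using False by simp
    finally show ?thesis unfolding tree_close_def
      using False \<open>j \<le> i\<close> d by (intro exI[of _ 0] exI[of _ "Suc D - i + j"]) auto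
  qed
qed

end

text \<open>An ancestor need not be the vertex of an element of \<open>V\<close>, only within D of
  one. So v is moved to an element near the ancestor D + 1 levels up: an error of D still leaves it
  strictly higher, and D + (d - D) = d keeps its neighbours. Elements of depth at most D are
  pairwise within 2 D through the root.\<close>

lemma acyclic_tree:
  fixes V :: "'a set" and p :: "'v \<Rightarrow> 'v" and vt :: "'a \<Rightarrow> 'v"
  defines "E \<equiv> \<lambda>d. {xs. set xs \<subseteq> V \<and> (\<forall>x\<in>set xs. \<forall>y\<in>set xs. tree_close p d (vt x) (vt y))}"
  assumes root: "p r = r" and reach: "\<And>x. x \<in> V \<Longrightarrow> \<exists>n. (p ^^ n) (vt x) = r"
    and a: "a \<in> V" "vt a = r"
    and cover: "\<And>x n. x \<in> V \<Longrightarrow> \<exists>y\<in>V. tree_close p D (vt y) ((p ^^ n) (vt x))"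
    and d: "2 * D + 1 \<le> d"
    and c: "Poly_Mapping.keys c \<subseteq> {xs \<in> E d. length xs = n}" "Bd c = 0"
  shows "\<exists>b. Poly_Mapping.keys b \<subseteq> {xs \<in> E d. length xs = Suc n} \<and> Bd b = c"
proof -
  define f where "f x = (SOME y. y \<in> V \<and> tree_close p D (vt y) ((p ^^ Suc D) (vt x)))" for x
  have f: "f x \<in> V \<and> tree_close p D (vt (f x)) ((p ^^ Suc D) (vt x))" if "x \<in> V" for x
    unfolding f_def by (rule someI_ex) (use cover[OF that] in blast)
  have depth_close: "tree_depth p r (vt x) \<le> tree_depth p r w + k"
    if *: "x \<in> V" "\<exists>n. (p ^^ n) w = r" "tree_close p k (vt x) w" for x w k
  proof -
    obtain i j where ij: "i + j \<le> k" "(p ^^ i) (vt x) = (p ^^ j) w" using *(3) by (auto simp: tree_close_def)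
    have "tree_depth p r (vt x) - i = tree_depth p r w - j"
      using tree_depth_funpow[of p r, OF root reach[OF *(1)], of i] tree_depth_funpow[of p r, OF root *(2), of j] ij by simp
    then show ?thesis using ij(1) by linarith
  qed
  show ?thesis
    unfolding E_def
  proof (rule acyclic_dismantlable[of V "\<lambda>x y. tree_close p d (vt x) (vt y)" D "\<lambda>x. tree_depth p r (vt x)" f a c n])
    fix v assume v: "v \<in> V" and D: "D < tree_depth p r (vt v)"
    have "\<exists>n. (p ^^ n) ((p ^^ Suc D) (vt v)) = r"
      using tree_depth_le_iff[of p r, OF root reach[OF v], of "tree_depth p r (vt v) + Suc D"]
      by (auto simp only: funpow_add o_apply)
    from depth_close[OF _ this] f[OF v] have "tree_depth p r (vt (f v)) \<le> tree_depth p r (vt v) - Suc D + D"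
      using tree_depth_funpow[of p r, OF root reach[OF v], of "Suc D"] by fastforce
    moreover have "tree_close p d (vt (f v)) (vt w)"
      if "w \<in> V" "tree_close p d (vt v) (vt w)" "tree_depth p r (vt w) \<le> tree_depth p r (vt v)" for w
    proof -
      have "tree_close p (d - D) ((p ^^ Suc D) (vt v)) (vt w)"
        by (rule tree_close_ancestor[of p r, OF root]) (use that v D d reach in auto)
      from tree_close_trans[OF conjunct2[OF f[OF v]] this] show ?thesis using d by simp
    qed
    ultimately show "f v \<in> V \<and> tree_depth p r (vt (f v)) < tree_depth p r (vt v) \<and>
        (\<forall>w\<in>V. tree_close p d (vt v) (vt w) \<longrightarrow> tree_depth p r (vt w) \<le> tree_depth p r (vt v) \<longrightarrow>
          tree_close p d (vt (f v)) (vt w))"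
      using f[OF v] D by auto
  next
    fix v w assume "v \<in> V" "w \<in> V" "tree_depth p r (vt v) \<le> D" "tree_depth p r (vt w) \<le> D"
    then have "(p ^^ D) (vt v) = (p ^^ D) (vt w)"
      using tree_depth_le_iff[of p r, OF root reach] by metis
    then show "tree_close p d (vt v) (vt w)"
      unfolding tree_close_def using d by (intro exI[of _ D]) auto
  next
    show "tree_depth p r (vt a) \<le> D"
      using tree_depth_le_iff[of p r, OF root reach[OF a(1)], of D] funpow_root[of p r D, OF root] a(2) by simp
  qed (use a c in \<open>auto simp: tree_close_refl E_def intro: tree_close_sym\<close>)
qed

section \<open>The tree of the modular group\<close>

definition qmul :: "quad \<Rightarrow> quad \<Rightarrow> quad" where
  "qmul x y = (fst x * fst y + fst (snd x) * fst (snd (snd y)),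
     fst x * fst (snd y) + fst (snd x) * snd (snd (snd y)),
     fst (snd (snd x)) * fst y + snd (snd (snd x)) * fst (snd (snd y)),
     fst (snd (snd x)) * fst (snd y) + snd (snd (snd x)) * snd (snd (snd y)))"

text \<open>The adjugate serves as the inverse, as only determinant 1 matters.\<close>

definition qadj :: "quad \<Rightarrow> quad" where
  "qadj x = (snd (snd (snd x)), - fst (snd x), - fst (snd (snd x)), fst x)"

definition qdet :: "quad \<Rightarrow> int" where
  "qdet x = fst x * snd (snd (snd x)) - fst (snd x) * fst (snd (snd x))"

abbreviation qone :: quad where "qone \<equiv> (1, 0, 0, 1)"
abbreviation qS :: quad where "qS \<equiv> (0, -1, 1, 0)"
abbreviation qT :: quad where "qT \<equiv> (0, -1, 1, -1)"
abbreviation qT2 :: quad where "qT2 \<equiv> (-1, 1, -1, 0)"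

lemma qmul_simps [simp]: "qmul (a, b, c, d) (a', b', c', d') = (a * a' + b * c', a * b' + b * d', c * a' + d * c', c * b' + d * d')"
  by (simp add: qmul_def)

lemma qadj_simps [simp]: "qadj (a, b, c, d) = (d, -b, -c, a)"
  by (simp add: qadj_def)

lemma qdet_simps [simp]: "qdet (a, b, c, d) = a * d - b * c"
  by (simp add: qdet_def)

lemma qmul_assoc: "qmul (qmul x y) z = qmul x (qmul y z)"
  by (cases x; cases y; cases z) (simp add: algebra_simps)

lemma qmul_one [simp]: "qmul x qone = x" "qmul qone x = x"
  by (cases x; simp)+

lemma qdet_qmul [simp]: "qdet (qmul x y) = qdet x * qdet y"
  by (cases x; cases y) (simp add: algebra_simps)

lemma qdet_qadj [simp]: "qdet (qadj x) = qdet x"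
  by (cases x) (simp add: algebra_simps)

lemma qadj_qmul: "qadj (qmul x y) = qmul (qadj y) (qadj x)"
  by (cases x; cases y) (simp add: algebra_simps)

lemma qadj_qadj [simp]: "qadj (qadj x) = x"
  by (cases x) simp

lemma qmul_qadj [simp]: "qdet x = 1 \<Longrightarrow> qmul x (qadj x) = qone" "qdet x = 1 \<Longrightarrow> qmul (qadj x) x = qone"
  by (cases x; simp add: algebra_simps)+

lemma qmul_qadj2 [simp]:
  "qdet x = 1 \<Longrightarrow> qmul x (qmul (qadj x) y) = y" "qdet x = 1 \<Longrightarrow> qmul (qadj x) (qmul x y) = y"
  by (simp_all flip: qmul_assoc)

text \<open>The cyclic group of order 6 that fixes the root; vertices are its left cosets.\<close>

definition qH :: "quad list" where
  "qH = [qone, qT, qT2, (-1, 0, 0, -1), (0, 1, -1, 1), (1, -1, 1, 0)]"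

lemma qH_group:
  "x \<in> set qH \<Longrightarrow> y \<in> set qH \<Longrightarrow> qmul x y \<in> set qH"
  "x \<in> set qH \<Longrightarrow> qadj x \<in> set qH"
  "x \<in> set qH \<Longrightarrow> qdet x = 1" "qone \<in> set qH"
  by (auto simp: qH_def)

text \<open>SL_2(Z) is the amalgam of the cyclic groups of orders 4 and 6, generated by
  \<open>qS\<close> and given by \<open>qH\<close>, over their common subgroup of order 2. In its
  Bass-Serre tree the vertices of the first kind have valency 2 and are forgotten; what is left is
  the trivalent tree whose edges join the vertices of x and \<open>qmul x qS\<close>. The ball
  collects the elements whose vertex is within n edges of the root. The list contains
  repetitions.\<close>

primrec qball :: "nat \<Rightarrow> quad list" where
  "qball 0 = qH"
| "qball (Suc n) = qball n @ concat (map (\<lambda>b. map (\<lambda>h. qmul (qmul b qS) h) qH) (qball n))"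

lemma qball_Suc: "x \<in> set (qball (Suc n)) \<longleftrightarrow>
    x \<in> set (qball n) \<or> (\<exists>b\<in>set (qball n). \<exists>h\<in>set qH. x = qmul (qmul b qS) h)"
  by auto

lemma qdet_qball: "x \<in> set (qball n) \<Longrightarrow> qdet x = 1"
proof (induction n arbitrary: x)
  case (Suc n)
  from Suc.prems consider "x \<in> set (qball n)"
    | b h where "b \<in> set (qball n)" "h \<in> set qH" "x = qmul (qmul b qS) h"
    unfolding qball_Suc by blast
  then show ?case
  proof cases
    case 2
    then show ?thesis using Suc.IH[OF 2(1)] qH_group(3)[OF 2(2)] by simp
  qed (rule Suc.IH)
qed (simp add: qH_group)

lemma qball_H: "x \<in> set (qball n) \<Longrightarrow> h \<in> set qH \<Longrightarrow> qmul x h \<in> set (qball n)"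
proof (induction n arbitrary: x)
  case (Suc n)
  then show ?case unfolding qball_Suc using qH_group(1) by (metis qmul_assoc)
qed (auto simp: qH_group)

lemma qball_S: "x \<in> set (qball n) \<Longrightarrow> h \<in> set qH \<Longrightarrow> qmul x (qmul qS h) \<in> set (qball (Suc n))"
  unfolding qball_Suc by (metis qmul_assoc)

lemma qball_mono: "m \<le> n \<Longrightarrow> set (qball m) \<subseteq> set (qball n)"
  by (induction n) (auto simp: le_Suc_eq)

text \<open>
  The columns \<open>u\<close>, \<open>v\<close> of an element of \<open>SL\<^sub>2(\<int>)\<close> and \<open>w = - u - v\<close> form a superbase of \<open>\<int>\<^sup>2\<close>.
  Its Selling parameters \<open>-v\<cdot>w\<close>, \<open>-w\<cdot>u\<close>, \<open>-u\<cdot>v\<close> are taken for the inner product with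
  norm \<open>2(x\<^sup>2 - xy + y\<^sup>2)\<close>; the parent of a superbase is found by flipping the edge with negative
  parameter, as in Selling's reduction.
\<close>

definition inp :: "int \<times> int \<Rightarrow> int \<times> int \<Rightarrow> int" where
  "inp = (\<lambda>(p, q) (r, s). 2 * p * r - p * s - q * r + 2 * q * s)"

definition sel1 :: "quad \<Rightarrow> int" where
  "sel1 = (\<lambda>(a, b, c, d). inp (a, c) (b, d) + inp (b, d) (b, d))"
definition sel2 :: "quad \<Rightarrow> int" where
  "sel2 = (\<lambda>(a, b, c, d). inp (a, c) (b, d) + inp (a, c) (a, c))"
definition sel3 :: "quad \<Rightarrow> int" where
  "sel3 = (\<lambda>(a, b, c, d). - inp (a, c) (b, d))"

text \<open>Right multiplication by \<open>qT\<close> replaces the columns u, v by v, w and so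
  rotates the superbase.\<close>

lemma sel_T: "sel1 (qmul x qT) = sel2 x" "sel2 (qmul x qT) = sel3 x" "sel3 (qmul x qT) = sel1 x"
  by (cases x; simp add: sel1_def sel2_def sel3_def inp_def algebra_simps)+

lemma sel_S: "sel1 (qmul x qS) = sel2 x + 2 * sel3 x" "sel2 (qmul x qS) = sel1 x + 2 * sel3 x"
  "sel3 (qmul x qS) = - sel3 x"
  by (cases x; simp add: sel1_def sel2_def sel3_def inp_def algebra_simps)+

text \<open>The left side is the Gram determinant of the two columns, rewritten in Selling
  parameters, and the inner product has determinant 3.\<close>

lemma sel_prod: "sel1 x * sel2 x + sel2 x * sel3 x + sel3 x * sel1 x = 3 * (qdet x)\<^sup>2"
  by (cases x) (simp add: sel1_def sel2_def sel3_def inp_def power2_eq_square algebra_simps)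

lemma inp_pos: "(p, q) \<noteq> (0, 0) \<Longrightarrow> 0 < inp (p, q) (p, q)"
proof -
  assume *: "(p, q) \<noteq> (0, 0)"
  have eq: "inp (p, q) (p, q) = (p - q)\<^sup>2 + p\<^sup>2 + q\<^sup>2"
    by (simp add: inp_def power2_eq_square algebra_simps)
  have "0 < p\<^sup>2 + q\<^sup>2" using * by (simp add: sum_power2_gt_zero_iff)
  then show ?thesis unfolding eq by (simp add: add_nonneg_pos add.assoc)
qed

text \<open>The sums are the norms of the three vectors of the superbase. Consequently at most one
  parameter can be negative.\<close>

lemma sel_sum_pos:
  assumes "qdet x = 1" shows "0 < sel1 x + sel2 x" "0 < sel2 x + sel3 x" "0 < sel3 x + sel1 x"
proof -
  obtain a b c d where x: "x = (a, b, c, d)" by (cases x)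
  have "(a, c) \<noteq> (0, 0)" "(b, d) \<noteq> (0, 0)" "(a + b, c + d) \<noteq> (0, 0)"
    using assms by (auto simp: x add_eq_0_iff)
  note this[THEN inp_pos]
  moreover have "sel1 x + sel2 x = inp (a + b, c + d) (a + b, c + d)" "sel2 x + sel3 x = inp (a, c) (a, c)"
    "sel3 x + sel1 x = inp (b, d) (b, d)"
    by (simp_all add: x sel1_def sel2_def sel3_def inp_def algebra_simps)
  ultimately show "0 < sel1 x + sel2 x" "0 < sel2 x + sel3 x" "0 < sel3 x + sel1 x" by simp_all
qed

text \<open>Modulo 2 the parameter agrees with the determinant, so it is odd. Hence there are no
  ties: each edge of the tree has a direction.\<close>

lemma sel_nonzero:
  assumes "qdet x = 1" shows "sel3 x \<noteq> 0"
proof -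
  obtain a b c d where x: "x = (a, b, c, d)" by (cases x)
  have "a * d + b * c = 2 * (b * c) + 1" using assms by (simp add: x)
  then have "odd (a * d + b * c)" by simp
  moreover have "sel3 x = a * d + b * c - 2 * (a * b + c * d)"
    by (simp add: x sel3_def inp_def algebra_simps)
  ultimately have "odd (sel3 x)" by simp
  then show ?thesis by auto
qed

text \<open>By \<open>sel_prod\<close> the three products of positive integers add up to 3, so all
  parameters are 1. Both columns then have norm 2, and the hexagonal lattice has only six such
  vectors.\<close>

lemma sel_positive_imp_H:
  assumes "qdet x = 1" "0 < sel1 x" "0 < sel2 x" "0 < sel3 x"
  shows "x \<in> set qH"
proof -
  obtain a b c d where x: "x = (a, b, c, d)" by (cases x)
  have ge: "sel1 x * sel2 x \<ge> 1" "sel2 x * sel3 x \<ge> 1" "sel3 x * sel1 x \<ge> 1"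
    using assms(2-4) by (simp_all add: int_one_le_iff_zero_less)
  have "sel1 x * sel2 x = 1" "sel2 x * sel3 x = 1"
    using sel_prod[of x] assms(1) ge by auto
  then have 1: "sel1 x = 1" "sel2 x = 1" "sel3 x = 1"
    using assms(2-4) by (auto simp: zmult_eq_1_iff)
  have small: "p \<in> {-1, 0, 1} \<and> q \<in> {-1, 0, 1}" if "inp (p, q) (p, q) = 2" for p q
  proof -
    have "(p - q)\<^sup>2 + p\<^sup>2 + q\<^sup>2 = 2" using that by (simp add: inp_def power2_eq_square algebra_simps)
    then have "p\<^sup>2 \<le> 2" "q\<^sup>2 \<le> 2" by (smt (verit) zero_le_power2)+
    have "\<bar>z\<bar> \<le> 1" if "z\<^sup>2 \<le> 2" for z :: int
    proof (rule ccontr)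
      assume "\<not> \<bar>z\<bar> \<le> 1"
      then have "2\<^sup>2 \<le> z\<^sup>2" by (intro abs_le_square_iff[THEN iffD1]) auto
      then show False using that by simp
    qed
    from this[OF \<open>p\<^sup>2 \<le> 2\<close>] this[OF \<open>q\<^sup>2 \<le> 2\<close>] show ?thesis by auto
  qed
  have "inp (a, c) (a, c) = 2" "inp (b, d) (b, d) = 2"
    using 1 by (simp_all add: x sel1_def sel2_def sel3_def)
  from small[OF this(1)] small[OF this(2)]
  have "a \<in> {-1, 0, 1}" "c \<in> {-1, 0, 1}" "b \<in> {-1, 0, 1}" "d \<in> {-1, 0, 1}" by auto
  moreover have "a * d - b * c = 1" "inp (a, c) (b, d) = - 1" using assms(1) 1 by (simp_all add: x sel3_def)
  ultimately show ?thesis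
    unfolding x qH_def inp_def by (elim insertE emptyE) simp_all
qed

text \<open>\<open>qT\<close> and \<open>qT2\<close> rotate the negative parameter into third
  position, where \<open>qS\<close> flips it. If there is none, x lies over the root, which is its
  own parent.\<close>

definition qpar :: "quad \<Rightarrow> quad" where
  "qpar x = (if sel3 x < 0 then qmul x qS else if sel1 x < 0 then qmul (qmul x qT) qS
     else if sel2 x < 0 then qmul (qmul x qT2) qS else x)"

lemma qdet_qpar [simp]: "qdet (qpar x) = qdet x"
  by (simp add: qpar_def)

definition vertex :: "quad \<Rightarrow> quad set" where
  "vertex x = qmul x ` set qH"

lemma vertex_self: "x \<in> vertex x"
  unfolding vertex_def by (rule image_eqI[of _ _ qone]) (auto simp: qH_def)

lemma vertex_eq_iff:
  assumes "qdet x = 1" "qdet y = 1" shows "vertex x = vertex y \<longleftrightarrow> qmul (qadj x) y \<in> set qH"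
proof
  assume "vertex x = vertex y"
  then have "y \<in> vertex x" using vertex_self by simp
  then obtain h where "h \<in> set qH" "y = qmul x h" unfolding vertex_def by blast
  then show "qmul (qadj x) y \<in> set qH" using assms by simp
next
  assume h: "qmul (qadj x) y \<in> set qH"
  define k where "k = qmul (qadj x) y"
  have y: "y = qmul x k" using assms by (simp add: k_def)
  have k: "k \<in> set qH" "qadj k \<in> set qH" using h qH_group(2) by (auto simp: k_def)
  show "vertex x = vertex y"
  proof
    show "vertex y \<subseteq> vertex x" unfolding vertex_def y using qH_group(1)[OF k(1)] by (auto simp: qmul_assoc)
    show "vertex x \<subseteq> vertex y"
    proof
      fix z assume "z \<in> vertex x"
      then obtain h where "h \<in> set qH" "z = qmul x h" unfolding vertex_def by auto
      moreover have "qmul x h = qmul y (qmul (qadj k) h)"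
        using qH_group(3)[OF k(1)] unfolding y by (simp add: qmul_assoc)
      ultimately show "z \<in> vertex y" unfolding vertex_def using qH_group(1)[OF k(2)] by auto
    qed
  qed
qed

lemma vertex_H: "qdet x = 1 \<Longrightarrow> h \<in> set qH \<Longrightarrow> vertex (qmul x h) = vertex x"
  by (subst eq_commute) (simp add: vertex_eq_iff qH_group)

lemma sel_minus: "sel1 (qmul x (-1, 0, 0, -1)) = sel1 x" "sel2 (qmul x (-1, 0, 0, -1)) = sel2 x"
    "sel3 (qmul x (-1, 0, 0, -1)) = sel3 x"
  by (cases x; simp add: sel1_def sel2_def sel3_def inp_def algebra_simps)+

text \<open>At most one parameter is negative, so the order of the tests in \<open>qpar\<close> is
  immaterial, and rotating the superbase leads to the flip of the same edge.\<close>

lemma vertex_qpar_T: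
  assumes "qdet x = 1" shows "vertex (qpar (qmul x qT)) = vertex (qpar x)"
proof -
  have *: "qmul (qmul x qT) qT = qmul x qT2" "qmul (qmul x qT) qT2 = x"
    by (cases x; simp)+
  have "vertex (qmul x qT) = vertex x" by (rule vertex_H[OF assms]) (simp add: qH_def)
  then show ?thesis
    using sel_sum_pos[OF assms] unfolding qpar_def sel_T * by auto
qed

lemma vertex_qpar_minus:
  assumes "qdet x = 1" shows "vertex (qpar (qmul x (-1, 0, 0, -1))) = vertex (qpar x)"
proof -
  have "qpar (qmul x (-1, 0, 0, -1)) = qmul (qpar x) (-1, 0, 0, -1)"
    unfolding qpar_def sel_minus by (cases x) simp
  then show ?thesis by (simp, intro vertex_H) (simp_all add: qH_def assms)
qed

lemma vertex_qpar_H: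
  assumes "qdet x = 1" "h \<in> set qH" shows "vertex (qpar (qmul x h)) = vertex (qpar x)"
proof -
  let ?m = "(-1, 0, 0, -1) :: quad"
  have T2: "vertex (qpar (qmul x qT2)) = vertex (qpar x)" if "qdet x = 1" for x
  proof -
    have "qmul x qT2 = qmul (qmul x qT) qT" by (cases x) simp
    then show ?thesis using vertex_qpar_T[of "qmul x qT"] vertex_qpar_T[OF that] that by simp
  qed
  have mT: "vertex (qpar (qmul x (0, 1, -1, 1))) = vertex (qpar x)"
  proof -
    have "qmul x (0, 1, -1, 1) = qmul (qmul x qT) ?m" by (cases x) simp
    then show ?thesis using vertex_qpar_minus[of "qmul x qT"] vertex_qpar_T[OF assms(1)] assms(1) by simp
  qed
  have mT2: "vertex (qpar (qmul x (1, -1, 1, 0))) = vertex (qpar x)"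
  proof -
    have "qmul x (1, -1, 1, 0) = qmul (qmul x qT2) ?m" by (cases x) simp
    then show ?thesis using vertex_qpar_minus[of "qmul x qT2"] T2[OF assms(1)] assms(1) by simp
  qed
  show ?thesis
    using assms(2) vertex_qpar_T[OF assms(1)] vertex_qpar_minus[OF assms(1)] T2[OF assms(1)] mT mT2
    unfolding qH_def by auto
qed

section \<open>The parent function on vertices\<close>

definition vpar :: "quad set \<Rightarrow> quad set" where
  "vpar C = vertex (qpar (SOME x. x \<in> C))"

lemma vpar_vertex:
  assumes "qdet x = 1" shows "vpar (vertex x) = vertex (qpar x)"
proof -
  have "\<exists>y. y \<in> vertex x" using vertex_self by blast
  then have "(SOME y. y \<in> vertex x) \<in> vertex x" by (rule someI_ex)
  then obtain h where "h \<in> set qH" "(SOME y. y \<in> vertex x) = qmul x h" by (auto simp: vertex_def)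
  then show ?thesis unfolding vpar_def using vertex_qpar_H[OF assms] by simp
qed

lemma vpar_root: "vpar (vertex qone) = vertex qone"
  by (simp add: vpar_vertex) (simp add: qpar_def sel1_def sel2_def sel3_def inp_def)

text \<open>The third parameter changes sign across the edge and is never zero, so exactly one side
  sees it negative and flips towards the other.\<close>

lemma vpar_edge:
  assumes "qdet x = 1" shows "vpar (vertex x) = vertex (qmul x qS) \<or> vpar (vertex (qmul x qS)) = vertex x"
proof (cases "sel3 x < 0")
  case True
  then show ?thesis using assms by (simp add: vpar_vertex qpar_def)
next
  case False
  then have "sel3 (qmul x qS) < 0" using sel_nonzero[OF assms] by (simp add: sel_S)
  then have "qpar (qmul x qS) = qmul x (-1, 0, 0, -1)" by (cases x) (simp add: qpar_def)
  moreover have "vertex (qmul x (-1, 0, 0, -1)) = vertex x"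
    by (rule vertex_H[OF assms]) (simp add: qH_def)
  ultimately show ?thesis using assms by (simp add: vpar_vertex)
qed

text \<open>Selling's descent: flipping an edge with negative parameter s changes the sum of the
  parameters by 2 s. That sum is half the sum of the three norms, hence stays positive, and the
  descent ends.\<close>

lemma vpar_reach:
  assumes "qdet x = 1" shows "\<exists>n. (vpar ^^ n) (vertex x) = vertex qone"
  using assms
proof (induction "nat (sel1 x + sel2 x + sel3 x)" arbitrary: x rule: less_induct)
  case less
  show ?case
  proof (cases "0 < sel1 x \<and> 0 < sel2 x \<and> 0 < sel3 x")
    case True
    then have "vertex x = vertex qone"
      using less.prems sel_positive_imp_H[of x] vertex_H[of qone x] by simp
    then show ?thesis by (intro exI[of _ 0]) simp
  next
    case False
    have T2: "qmul x qT2 = qmul (qmul x qT) qT" by (cases x) simp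
    have nz: "sel1 x \<noteq> 0" "sel2 x \<noteq> 0" "sel3 x \<noteq> 0"
      using sel_nonzero[of x] sel_nonzero[of "qmul x qT"] sel_nonzero[of "qmul x qT2"] less.prems
      unfolding T2 sel_T by simp_all
    have "sel1 (qpar x) + sel2 (qpar x) + sel3 (qpar x) < sel1 x + sel2 x + sel3 x"
      using False nz unfolding qpar_def T2 by (auto simp only: sel_S sel_T split: if_splits)
    moreover have "0 < sel1 x + sel2 x + sel3 x"
      using sel_sum_pos[OF less.prems] by linarith
    ultimately obtain n where "(vpar ^^ n) (vertex (qpar x)) = vertex qone"
      using less.hyps[of "qpar x"] less.prems by auto
    then show ?thesis
      using less.prems by (intro exI[of _ "Suc n"]) (simp add: vpar_vertex funpow_Suc_right del: funpow.simps)
  qed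
qed

section \<open>Balls and distance in the tree\<close>

lemma qball_vpar_up:
  assumes "qdet x = 1" "qdet y = 1" "qmul (qadj x) y \<in> set (qball n)"
  shows "qmul (qadj x) (qpar y) \<in> set (qball (Suc n))"
proof -
  have *: "qmul (qadj x) (qmul (qmul y t) qS) \<in> set (qball (Suc n))" if "t \<in> set qH" for t
    using qball_S[OF qball_H[OF assms(3) that] qH_group(4)] by (simp add: qmul_assoc del: qball.simps)
  have "qmul (qadj x) y \<in> set (qball (Suc n))" using assms(3) by simp
  then show ?thesis
    using *[of qone] *[of qT] *[of qT2] by (simp add: qpar_def qH_def del: qball.simps qmul_simps)
qed

lemma qball_vpar_down:
  assumes "qdet x = 1" "qdet y = 1" "qmul (qadj x) (qpar y) \<in> set (qball n)"
  shows "qmul (qadj x) y \<in> set (qball (Suc n))"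
proof -
  \<comment> \<open>The flip is undone by a second \<open>qS\<close>; as its square is -1, the
    element \<open>s\<close> is the inverse of -t.\<close>
  have *: "qmul (qadj x) y \<in> set (qball (Suc n))"
    if "qpar y = qmul (qmul y t) qS" "qmul (qmul (qmul (qmul y t) qS) qS) s = y" "s \<in> set qH" for t s
    using qball_S[OF assms(3) that(3)] that(1,2) by (simp only: qmul_assoc)
  consider "qpar y = qmul y qS" | "qpar y = qmul (qmul y qT) qS" | "qpar y = qmul (qmul y qT2) qS" | "qpar y = y"
    unfolding qpar_def by metis
  then show ?thesis
  proof cases
    case 1
    then show ?thesis by (intro *[of qone "(-1, 0, 0, -1)"]) (simp, cases y, simp_all add: qH_def)
  next
    case 2
    then show ?thesis by (intro *[of qT "(1, -1, 1, 0)"]) (simp, cases y, simp_all add: qH_def)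
  next
    case 3
    then show ?thesis by (intro *[of qT2 "(0, 1, -1, 1)"]) (simp, cases y, simp_all add: qH_def)
  next
    case 4
    then show ?thesis using assms(3) by simp
  qed
qed

text \<open>Each enlargement of the ball crosses one edge, which gives one direction. For the other,
  follow the path from x up to the common ancestor and down to y: every step costs one unit of
  radius, and the choice of element over a vertex is free because balls are stable under
  \<open>qH\<close>.\<close>

lemma qball_iff_tree_close:
  assumes x: "qdet x = 1" and y: "qdet y = 1"
  shows "qmul (qadj x) y \<in> set (qball d) \<longleftrightarrow> tree_close vpar d (vertex x) (vertex y)"
proof
  have "tree_close vpar d (vertex x) (vertex (qmul x b))" if "b \<in> set (qball d)" for b
    using that
  proof (induction d arbitrary: b)
    case 0
    then show ?case using vertex_H[OF x] tree_close_refl by simp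
  next
    case (Suc d)
    from Suc.prems consider "b \<in> set (qball d)" | c h where "c \<in> set (qball d)" "h \<in> set qH" "b = qmul (qmul c qS) h"
      unfolding qball_Suc by blast
    then show ?case
    proof cases
      case 1
      then show ?thesis using Suc.IH tree_close_mono by (metis le_SucI order_refl)
    next
      case 2
      define z where "z = qmul x c"
      have z: "qdet z = 1" using x qdet_qball[OF 2(1)] by (simp add: z_def)
      have "vertex (qmul x b) = vertex (qmul (qmul z qS) h)" by (simp only: 2 z_def qmul_assoc)
      also have "\<dots> = vertex (qmul z qS)" using z 2(2) by (intro vertex_H) simp_all
      finally have v: "vertex (qmul x b) = vertex (qmul z qS)" .
      have "tree_close vpar 1 (vertex z) (vertex (qmul z qS))"
        using vpar_edge[OF z] unfolding tree_close_def
      proof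
        assume "vpar (vertex z) = vertex (qmul z qS)"
        then show "\<exists>i j. i + j \<le> 1 \<and> (vpar ^^ i) (vertex z) = (vpar ^^ j) (vertex (qmul z qS))"
          by (intro exI[of _ 1] exI[of _ 0]) simp
      next
        assume "vpar (vertex (qmul z qS)) = vertex z"
        then show "\<exists>i j. i + j \<le> 1 \<and> (vpar ^^ i) (vertex z) = (vpar ^^ j) (vertex (qmul z qS))"
          by (intro exI[of _ 0] exI[of _ 1]) simp
      qed
      from tree_close_trans[OF Suc.IH[OF 2(1), folded z_def] this] show ?thesis by (simp add: v)
    qed
  qed
  from this[of "qmul (qadj x) y"] x
  show "qmul (qadj x) y \<in> set (qball d) \<Longrightarrow> tree_close vpar d (vertex x) (vertex y)" by simp
next
  assume "tree_close vpar d (vertex x) (vertex y)"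
  then obtain i j where ij: "i + j \<le> d" "(vpar ^^ i) (vertex x) = (vpar ^^ j) (vertex y)"
    by (auto simp: tree_close_def)
  have up: "\<exists>z. qdet z = 1 \<and> (vpar ^^ i) (vertex x) = vertex z \<and> qmul (qadj x) z \<in> set (qball i)" for i
  proof (induction i)
    case 0
    show ?case using x by (intro exI[of _ x]) (simp add: qH_def)
  next
    case (Suc i)
    then obtain z where z: "qdet z = 1" "(vpar ^^ i) (vertex x) = vertex z" "qmul (qadj x) z \<in> set (qball i)"
      by blast
    then show ?case
      using qball_vpar_up[OF x z(1,3)] by (intro exI[of _ "qpar z"]) (simp add: vpar_vertex del: qball.simps)
  qed
  have down: "qmul (qadj x) y \<in> set (qball (i + j))"
    if "qdet y = 1" "qdet z = 1" "(vpar ^^ j) (vertex y) = vertex z" "qmul (qadj x) z \<in> set (qball i)" for y z j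
    using that
  proof (induction j arbitrary: y)
    case 0
    then have "qmul (qadj z) y \<in> set qH" by (simp add: vertex_eq_iff[symmetric])
    from qball_H[OF 0(4) this] 0 show ?case by (simp add: qmul_assoc)
  next
    case (Suc j)
    then have "(vpar ^^ j) (vertex (qpar y)) = vertex z"
      by (simp add: vpar_vertex funpow_Suc_right del: funpow.simps)
    with Suc have "qmul (qadj x) (qpar y) \<in> set (qball (i + j))" by simp
    from qball_vpar_down[OF x Suc.prems(1) this] show ?case by simp
  qed
  obtain z where "qdet z = 1" "(vpar ^^ i) (vertex x) = vertex z" "qmul (qadj x) z \<in> set (qball i)"
    using up by blast
  then have "qmul (qadj x) y \<in> set (qball (i + j))" using down[of y z j] ij y by simp
  then show "qmul (qadj x) y \<in> set (qball d)" using qball_mono[OF ij(1)] by blast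
qed

lemma qball_covers: "qdet x = 1 \<Longrightarrow> \<exists>n. x \<in> set (qball n)"
proof -
  assume x: "qdet x = 1"
  obtain n where "(vpar ^^ n) (vertex x) = vertex qone" using vpar_reach[OF x] by blast
  then have "tree_close vpar n (vertex qone) (vertex x)"
    unfolding tree_close_def by (intro exI[of _ 0] exI[of _ n]) simp
  then show ?thesis using qball_iff_tree_close[of qone x] x by auto
qed

text \<open>All ancestors of a vertex are cosets of elements of determinant 1, so density of
  \<open>V\<close> in SL_2(Z) supplies the elements near ancestors that \<open>acyclic_tree\<close>
  asks for.\<close>

lemma acyclic_qball:
  fixes q :: "'a \<Rightarrow> quad"
  defines "E \<equiv> \<lambda>V d. {xs. set xs \<subseteq> V \<and> (\<forall>x\<in>set xs. \<forall>y\<in>set xs. qmul (qadj (q x)) (q y) \<in> set (qball d))}"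
  assumes det: "\<And>x. x \<in> V \<Longrightarrow> qdet (q x) = 1" and a: "a \<in> V" "q a = qone"
    and cover: "\<And>y. qdet y = 1 \<Longrightarrow> \<exists>x\<in>V. qmul (qadj (q x)) y \<in> set (qball D)"
    and d: "2 * D + 1 \<le> d"
    and c: "Poly_Mapping.keys c \<subseteq> {xs \<in> E V d. length xs = n}" "Bd c = 0"
  shows "\<exists>b. Poly_Mapping.keys b \<subseteq> {xs \<in> E V d. length xs = Suc n} \<and> Bd b = c"
proof -
  have E: "E V d = {xs. set xs \<subseteq> V \<and> (\<forall>x\<in>set xs. \<forall>y\<in>set xs. tree_close vpar d (vertex (q x)) (vertex (q y)))}"
  proof -
    have *: "qmul (qadj (q x)) (q y) \<in> set (qball d) \<longleftrightarrow> tree_close vpar d (vertex (q x)) (vertex (q y))"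
      if "x \<in> V" "y \<in> V" for x y
      by (rule qball_iff_tree_close) (simp_all add: det that)
    show ?thesis
      unfolding E_def by (intro Collect_cong conj_cong ball_cong refl) (use * in blast)
  qed
  have "\<exists>z. qdet z = 1 \<and> (vpar ^^ m) (vertex (q x)) = vertex z" if "x \<in> V" for x m
  proof (induction m)
    case 0
    show ?case using det[OF that] by (intro exI[of _ "q x"]) simp
  next
    case (Suc m)
    then obtain z where "qdet z = 1" "(vpar ^^ m) (vertex (q x)) = vertex z" by blast
    then show ?case by (intro exI[of _ "qpar z"]) (simp add: vpar_vertex)
  qed
  then have cover': "\<exists>y\<in>V. tree_close vpar D (vertex (q y)) ((vpar ^^ m) (vertex (q x)))" if "x \<in> V" for x m
    using cover det qball_iff_tree_close that by metis
  show ?thesis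
    unfolding E
  proof (rule acyclic_tree[of vpar "vertex qone" V "\<lambda>x. vertex (q x)" a D d c n])
    show "Poly_Mapping.keys c \<subseteq> {xs \<in> {xs. set xs \<subseteq> V \<and> (\<forall>x\<in>set xs. \<forall>y\<in>set xs.
      tree_close vpar d (vertex (q x)) (vertex (q y)))}. length xs = n}"
      using c(1) unfolding E .
  qed (use vpar_root vpar_reach det a cover' d c in auto)
qed

section \<open>Cohomology classes and the transfer\<close>

definition cls :: "('a, 'b) monoid_scheme \<Rightarrow> nat \<Rightarrow> ('a list \<Rightarrow> int) \<Rightarrow> ('a list \<Rightarrow> int) set" where
  "cls G m f = coboundaries G m #>\<^bsub>cochains G m\<^esub> f"

lemma mem_cls: "h \<in> cls G m f \<longleftrightarrow> (\<exists>b\<in>coboundaries G m. h = (\<lambda>xs. b xs + f xs))"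
  by (auto simp: cls_def r_coset_def)

lemma cochain_add:
  assumes "f \<in> carrier (cochains G m)" "h \<in> carrier (cochains G m)"
  shows "(\<lambda>xs. f xs + h xs) \<in> carrier (cochains G m)" "(\<lambda>xs. f xs - h xs) \<in> carrier (cochains G m)"
  using assms by (auto simp: carrier_cochains)

lemma cochain_zero: "(\<lambda>xs. 0) \<in> carrier (cochains G m)"
  by (auto simp: carrier_cochains)

lemma coboundary_add:
  "coboundary G m (\<lambda>xs. f xs + h xs) = (\<lambda>xs. coboundary G m f xs + coboundary G m h xs)"
  "coboundary G m (\<lambda>xs. f xs - h xs) = (\<lambda>xs. coboundary G m f xs - coboundary G m h xs)"
  by (auto simp: coboundary_eq_ev ev_add_fun ev_diff_fun)

lemma cocycle_iff_coboundary:
  "f \<in> cocycles G m \<longleftrightarrow> f \<in> carrier (cochains G m) \<and> coboundary G m f = (\<lambda>xs. 0)"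
  by (auto simp: cocycles_def kernel_def)

lemma cocycle_add:
  assumes "f \<in> cocycles G m" "h \<in> cocycles G m"
  shows "(\<lambda>xs. f xs + h xs) \<in> cocycles G m" "(\<lambda>xs. f xs - h xs) \<in> cocycles G m"
  using assms by (auto simp: cocycle_iff_coboundary cochain_add coboundary_add)

lemma cocycle_zero: "(\<lambda>xs. 0) \<in> cocycles G m"
  by (auto simp: cocycles_iff cochain_zero)

lemma cocycle_uminus: "f \<in> cocycles G m \<Longrightarrow> (\<lambda>xs. - f xs) \<in> cocycles G m"
  using cocycle_add(2)[OF cocycle_zero] by fastforce

lemma cocycle_cmul: "f \<in> cocycles G m \<Longrightarrow> (\<lambda>xs. k * f xs) \<in> cocycles G m"
  by (auto simp: cocycles_iff carrier_cochains ev_cmul_fun)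

lemma cocycle_sum: "(\<And>i. i \<in> I \<Longrightarrow> f i \<in> cocycles G m) \<Longrightarrow> (\<lambda>xs. \<Sum>i\<in>I. f i xs) \<in> cocycles G m"
  by (induction I rule: infinite_finite_induct) (auto simp: cocycle_zero intro: cocycle_add)

lemma coboundaries_add:
  assumes "b \<in> coboundaries G m" "c \<in> coboundaries G m"
  shows "(\<lambda>xs. b xs + c xs) \<in> coboundaries G m" "(\<lambda>xs. b xs - c xs) \<in> coboundaries G m"
proof -
  show "(\<lambda>xs. b xs + c xs) \<in> coboundaries G m"
  proof (cases m)
    case (Suc k)
    obtain u v where "b = coboundary G k u" "c = coboundary G k v"
      "u \<in> carrier (cochains G k)" "v \<in> carrier (cochains G k)" using assms Suc by auto
    then show ?thesis unfolding Suc coboundaries.simps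
      by (intro image_eqI[of _ _ "\<lambda>xs. u xs + v xs"]) (auto simp: coboundary_add intro: cochain_add)
  qed (use assms in auto)
  show "(\<lambda>xs. b xs - c xs) \<in> coboundaries G m"
  proof (cases m)
    case (Suc k)
    obtain u v where "b = coboundary G k u" "c = coboundary G k v"
      "u \<in> carrier (cochains G k)" "v \<in> carrier (cochains G k)" using assms Suc by auto
    then show ?thesis unfolding Suc coboundaries.simps
      by (intro image_eqI[of _ _ "\<lambda>xs. u xs - v xs"]) (auto simp: coboundary_add intro: cochain_add)
  qed (use assms in auto)
qed

lemma coboundaries_zero: "(\<lambda>xs. 0) \<in> coboundaries G m"
proof (cases m)
  case (Suc k)
  have "coboundary G k (\<lambda>xs. 0) = (\<lambda>xs. 0)" by (auto simp: coboundary_eq_ev)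
  then show ?thesis unfolding Suc coboundaries.simps by (metis cochain_zero image_eqI)
qed simp

lemma (in group) coboundaries_subset: "coboundaries G m \<subseteq> cocycles G m"
  using coboundary_closed by (cases m) (auto simp: cocycle_zero)

lemma cls_eq_iff: "cls G m f = cls G m h \<longleftrightarrow> (\<lambda>xs. f xs - h xs) \<in> coboundaries G m"
proof
  assume "cls G m f = cls G m h"
  moreover have "f \<in> cls G m f" using coboundaries_zero by (force simp: mem_cls)
  ultimately obtain b where "b \<in> coboundaries G m" "f = (\<lambda>xs. b xs + h xs)" by (auto simp: mem_cls)
  then show "(\<lambda>xs. f xs - h xs) \<in> coboundaries G m" by simp
next
  assume *: "(\<lambda>xs. f xs - h xs) \<in> coboundaries G m"
  show "cls G m f = cls G m h"
  proof (intro Set.set_eqI iffI)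
    fix k assume "k \<in> cls G m f"
    then obtain b where "b \<in> coboundaries G m" "k = (\<lambda>xs. b xs + f xs)" by (auto simp: mem_cls)
    then show "k \<in> cls G m h" using coboundaries_add(1)[OF _ *, of b] by (force simp: mem_cls)
  next
    fix k assume "k \<in> cls G m h"
    then obtain b where "b \<in> coboundaries G m" "k = (\<lambda>xs. b xs + h xs)" by (auto simp: mem_cls)
    then show "k \<in> cls G m f" using coboundaries_add(2)[OF _ *, of b] by (force simp: mem_cls)
  qed
qed

lemma carrier_cohomology: "carrier (cohomology G m) = cls G m ` cocycles G m"
  by (auto simp: cohomology_def FactGroup_def RCOSETS_def cls_def r_coset_def)

lemma mult_cohomology:
  "cls G m f \<otimes>\<^bsub>cohomology G m\<^esub> cls G m h = cls G m (\<lambda>xs. f xs + h xs)"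
proof (intro Set.set_eqI iffI)
  have mult: "x \<in> cls G m f \<otimes>\<^bsub>cohomology G m\<^esub> cls G m h \<longleftrightarrow>
      (\<exists>p\<in>cls G m f. \<exists>q\<in>cls G m h. x = (\<lambda>xs. p xs + q xs))" for x
    by (auto simp: cohomology_def FactGroup_def set_mult_def)
  fix x
  {
    assume "x \<in> cls G m f \<otimes>\<^bsub>cohomology G m\<^esub> cls G m h"
    then obtain b c where "b \<in> coboundaries G m" "c \<in> coboundaries G m"
      "x = (\<lambda>xs. (b xs + f xs) + (c xs + h xs))" by (auto simp: mult mem_cls)
    then show "x \<in> cls G m (\<lambda>xs. f xs + h xs)"
      using coboundaries_add(1) by (force simp: mem_cls algebra_simps)
  next
    assume "x \<in> cls G m (\<lambda>xs. f xs + h xs)"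
    then obtain b where "b \<in> coboundaries G m" "x = (\<lambda>xs. (b xs + f xs) + (0 + h xs))"
      by (auto simp: mem_cls algebra_simps)
    then show "x \<in> cls G m f \<otimes>\<^bsub>cohomology G m\<^esub> cls G m h"
      unfolding mult using coboundaries_zero
      by (intro bexI[of _ "\<lambda>xs. b xs + f xs"] bexI[of _ "\<lambda>xs. 0 + h xs"]) (force simp: mem_cls)+
  }
qed

lemma (in group) group_cohomology: "group (cohomology G m)"
proof -
  let ?Z = "(cochains G m)\<lparr>carrier := cocycles G m\<rparr>"
  have grp: "group ?Z"
  proof (rule groupI)
    fix x assume "x \<in> carrier ?Z"
    then show "\<exists>y\<in>carrier ?Z. y \<otimes>\<^bsub>?Z\<^esub> x = \<one>\<^bsub>?Z\<^esub>"
      using cocycle_uminus by (intro bexI[of _ "\<lambda>xs. - x xs"]) (auto simp: cochains_def)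
  qed (auto simp: cochains_def cocycle_zero cocycle_add add.assoc)
  have inv: "inv\<^bsub>?Z\<^esub> x = (\<lambda>xs. - x xs)" if "x \<in> cocycles G m" for x
    using that cocycle_uminus by (intro group.inv_equality[OF grp]) (auto simp: cochains_def)
  interpret Z: comm_group ?Z
    by (rule group.group_comm_groupI[OF grp]) (auto simp: cochains_def add.commute)
  have "subgroup (coboundaries G m) ?Z"
  proof (rule Z.subgroupI)
    show "coboundaries G m \<subseteq> carrier ?Z" using coboundaries_subset by simp
    show "coboundaries G m \<noteq> {}" using coboundaries_zero by blast
    fix b c assume b: "b \<in> coboundaries G m" and c: "c \<in> coboundaries G m"
    show "inv\<^bsub>?Z\<^esub> b \<in> coboundaries G m"
      using coboundaries_add(2)[OF coboundaries_zero b] coboundaries_subset b inv by fastforce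
    show "b \<otimes>\<^bsub>?Z\<^esub> c \<in> coboundaries G m" using coboundaries_add(1)[OF b c] by (simp add: cochains_def)
  qed
  then show ?thesis
    unfolding cohomology_def by (intro normal.factorgroup_is_group Z.subgroup_imp_normal)
qed

text \<open>\<open>\<Phi> k\<close> is the part of degree \<open>k\<close> of a map of cochain complexes.\<close>

lemma cochain_map_props:
  assumes add: "\<And>k f h. \<Phi> k (\<lambda>xs. f xs + h xs) = (\<lambda>xs. \<Phi> k f xs + \<Phi> k h xs)"
    and closed: "\<And>k f. f \<in> carrier (cochains K k) \<Longrightarrow> \<Phi> k f \<in> carrier (cochains G k)"
    and comm: "\<And>k f. f \<in> carrier (cochains K k) \<Longrightarrow> coboundary G k (\<Phi> k f) = \<Phi> (Suc k) (coboundary K k f)"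
  shows "f \<in> cocycles K m \<Longrightarrow> \<Phi> m f \<in> cocycles G m"
    and "f \<in> coboundaries K m \<Longrightarrow> \<Phi> m f \<in> coboundaries G m"
    and "induced_map G m (\<Phi> m) (cls K m f) = cls G m (\<Phi> m f)"
proof -
  have zero: "\<Phi> k (\<lambda>xs. 0) = (\<lambda>xs. 0)" for k
    using add[of k "\<lambda>xs. 0" "\<lambda>xs. 0"] by (simp add: fun_eq_iff)
  show "f \<in> cocycles K m \<Longrightarrow> \<Phi> m f \<in> cocycles G m"
    using closed comm zero by (auto simp: cocycle_iff_coboundary)
  have B: "\<Phi> m f \<in> coboundaries G m" if "f \<in> coboundaries K m" for f
  proof (cases m)
    case (Suc k)
    then obtain u where "u \<in> carrier (cochains K k)" "f = coboundary K k u"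
      using \<open>f \<in> coboundaries K m\<close> by auto
    then show ?thesis using comm[of u k] closed[of u k]
      unfolding Suc coboundaries.simps by (intro image_eqI[of _ _ "\<Phi> k u"]) simp_all
  qed (use that zero in auto)
  then show "f \<in> coboundaries K m \<Longrightarrow> \<Phi> m f \<in> coboundaries G m" .
  have "cls G m (\<Phi> m h) = cls G m (\<Phi> m f)" if h: "h \<in> cls K m f" for h
  proof -
    obtain b where b: "b \<in> coboundaries K m" "h = (\<lambda>xs. b xs + f xs)" using h by (auto simp: mem_cls)
    then show ?thesis using B[OF b(1)] by (simp add: cls_eq_iff add)
  qed
  moreover have "f \<in> cls K m f" using coboundaries_zero by (force simp: mem_cls)
  ultimately show "induced_map G m (\<Phi> m) (cls K m f) = cls G m (\<Phi> m f)"
    unfolding induced_map_def cls_def[symmetric] by blast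
qed

section \<open>Pullback and transfer on cochains\<close>

definition pull :: "('a, 'b) monoid_scheme \<Rightarrow> ('a \<Rightarrow> 'c) \<Rightarrow> nat \<Rightarrow> ('c list \<Rightarrow> int) \<Rightarrow> 'a list \<Rightarrow> int" where
  "pull G h m f = (\<lambda>xs. if xs \<in> tuples G (Suc m) then f (map h xs) else 0)"

lemma pull_props:
  assumes "group G" "h \<in> hom G K"
  shows "f \<in> cocycles K m \<Longrightarrow> pull G h m f \<in> cocycles G m"
    and "pullback G m h (cls K m f) = cls G m (pull G h m f)"
proof -
  have tup: "xs \<in> tuples G k \<Longrightarrow> map h xs \<in> tuples K k" for xs k
    using assms by (auto simp: tuples_def hom_def)
  have 1: "pull G h k f \<in> carrier (cochains G k)" if f: "f \<in> carrier (cochains K k)" for k f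
    unfolding carrier_cochains
  proof (intro conjI ballI allI impI)
    fix a xs assume a: "a \<in> carrier G" and xs: "xs \<in> tuples G (Suc k)"
    have "map h (map (\<lambda>x. a \<otimes>\<^bsub>G\<^esub> x) xs) = map (\<lambda>x. h a \<otimes>\<^bsub>K\<^esub> x) (map h xs)"
      using assms a xs by (auto simp: hom_def tuples_def)
    moreover have "f (map (\<lambda>x. h a \<otimes>\<^bsub>K\<^esub> x) (map h xs)) = f (map h xs)"
      using f tup[OF xs] assms a by (simp only: carrier_cochains hom_def) blast
    ultimately show "pull G h k f (map (\<lambda>x. a \<otimes>\<^bsub>G\<^esub> x) xs) = pull G h k f xs"
      using xs group.shift_tuples[OF assms(1) a xs] unfolding pull_def by (simp only: if_True)
  qed (auto simp: pull_def)
  have 2: "coboundary G k (pull G h k f) = pull G h (Suc k) (coboundary K k f)" for k f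
  proof
    fix xs show "coboundary G k (pull G h k f) xs = pull G h (Suc k) (coboundary K k f) xs"
    proof (cases "xs \<in> tuples G (Suc (Suc k))")
      case True
      have "ev (pull G h k f) (bd xs) = ev (\<lambda>ys. f (map h ys)) (bd xs)"
        by (rule ev_cong) (use keys_bd_tuples[OF True] in \<open>auto simp: pull_def\<close>)
      also have "\<dots> = ev f (bd (map h xs))"
        by (simp add: bd_map maps_def ev_frag_extend)
      finally show ?thesis using True tup[OF True] by (simp add: pull_def coboundary_eq_ev)
    qed (simp add: pull_def coboundary_eq_ev)
  qed
  have 3: "pull G h k (\<lambda>xs. f xs + e xs) = (\<lambda>xs. pull G h k f xs + pull G h k e xs)" for k f e
    by (auto simp: pull_def)
  note props = cochain_map_props[of "pull G h", OF 3 1 2]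
  show "f \<in> cocycles K m \<Longrightarrow> pull G h m f \<in> cocycles G m" by (rule props(1))
  show "pullback G m h (cls K m f) = cls G m (pull G h m f)"
    using props(3)[of m f] by (simp add: pullback_def pull_def[abs_def])
qed

text \<open>A choice of coset representatives in the form of the function that sends an element to
  the representative of its right coset; the finite image encodes finite index.\<close>

definition transversal :: "('a, 'b) monoid_scheme \<Rightarrow> 'a set \<Rightarrow> ('a \<Rightarrow> 'a) \<Rightarrow> bool" where
  "transversal G U \<rho> \<longleftrightarrow> finite (\<rho> ` carrier G) \<and> (\<forall>y\<in>carrier G. \<rho> y \<in> carrier G \<and>
     y \<otimes>\<^bsub>G\<^esub> inv\<^bsub>G\<^esub> \<rho> y \<in> U \<and> (\<forall>u\<in>U. \<rho> (u \<otimes>\<^bsub>G\<^esub> y) = \<rho> y))"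

text \<open>
  Transfer for a subgroup \<open>U\<close> composed with the pullback along \<open>h : U \<rightarrow> K\<close>, on cochains; the
  cosets of \<open>U\<close> are represented by the values of \<open>\<rho>\<close>.
\<close>

definition twisted_transfer ::
  "('a, 'b) monoid_scheme \<Rightarrow> ('a \<Rightarrow> 'c) \<Rightarrow> ('a \<Rightarrow> 'a) \<Rightarrow> nat \<Rightarrow> ('c list \<Rightarrow> int) \<Rightarrow> 'a list \<Rightarrow> int" where
  "twisted_transfer G h \<rho> m F = (\<lambda>xs. if xs \<in> tuples G (Suc m)
     then \<Sum>r\<in>\<rho> ` carrier G. F (map (\<lambda>x. h (r \<otimes>\<^bsub>G\<^esub> x \<otimes>\<^bsub>G\<^esub> inv\<^bsub>G\<^esub> \<rho> (r \<otimes>\<^bsub>G\<^esub> x))) xs) else 0)"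

locale subgroup_hom = group G + K: group K for G (structure) and K (structure) +
  fixes U h
  assumes U: "subgroup U G" and h: "h \<in> hom (G\<lparr>carrier := U\<rparr>) K"
begin

abbreviation key :: "('a \<Rightarrow> 'a) \<Rightarrow> 'a \<Rightarrow> 'a \<Rightarrow> 'c" where
  "key \<rho> r x \<equiv> h (r \<otimes> x \<otimes> inv \<rho> (r \<otimes> x))"

lemma h_closed: "u \<in> U \<Longrightarrow> h u \<in> carrier K"
  and h_mult: "u \<in> U \<Longrightarrow> v \<in> U \<Longrightarrow> h (u \<otimes> v) = h u \<otimes>\<^bsub>K\<^esub> h v"
  using h by (auto simp: hom_def)

context
  fixes \<rho> assumes tr: "transversal G U \<rho>"
begin

lemma rho: "y \<in> carrier G \<Longrightarrow> \<rho> y \<in> carrier G" "y \<in> carrier G \<Longrightarrow> y \<otimes> inv \<rho> y \<in> U"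
    "u \<in> U \<Longrightarrow> y \<in> carrier G \<Longrightarrow> \<rho> (u \<otimes> y) = \<rho> y" "finite (\<rho> ` carrier G)"
  using tr by (auto simp: transversal_def)

lemma rho_coset: "y \<in> carrier G \<Longrightarrow> z \<in> carrier G \<Longrightarrow> y \<otimes> inv z \<in> U \<Longrightarrow> \<rho> y = \<rho> z"
proof -
  assume *: "y \<in> carrier G" "z \<in> carrier G" "y \<otimes> inv z \<in> U"
  then have "y \<otimes> inv z \<otimes> z = y" by (simp add: m_assoc)
  then show "\<rho> y = \<rho> z" using rho(3)[OF *(3,2)] by simp
qed

lemma rho_rho: "y \<in> carrier G \<Longrightarrow> \<rho> (\<rho> y) = \<rho> y"
  using rho_coset[of y "\<rho> y"] rho by simp

lemma rho_rho_mult: "y \<in> carrier G \<Longrightarrow> x \<in> carrier G \<Longrightarrow> \<rho> (\<rho> y \<otimes> x) = \<rho> (y \<otimes> x)"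
proof -
  assume *: "y \<in> carrier G" "x \<in> carrier G"
  have "y \<otimes> x \<otimes> inv (\<rho> y \<otimes> x) = y \<otimes> (x \<otimes> inv x) \<otimes> inv \<rho> y"
    using * rho(1)[OF *(1)] by (simp only: inv_mult_group m_assoc m_closed inv_closed)
  also have "\<dots> \<in> U" using * rho(1,2)[OF *(1)] by simp
  finally have "y \<otimes> x \<otimes> inv (\<rho> y \<otimes> x) \<in> U" .
  then show ?thesis using rho_coset[of "y \<otimes> x" "\<rho> y \<otimes> x"] * rho(1) by simp
qed

text \<open>Right multiplication permutes the right cosets. This reindexes the sum whenever a
  transferred cochain is translated.\<close>

lemma bij_rho_shift:
  assumes a: "a \<in> carrier G"
  shows "bij_betw (\<lambda>r. \<rho> (r \<otimes> a)) (\<rho> ` carrier G) (\<rho> ` carrier G)"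
proof (rule bij_betwI[where g = "\<lambda>r. \<rho> (r \<otimes> inv a)"])
  show "\<rho> (\<rho> (r \<otimes> a) \<otimes> inv a) = r" if "r \<in> \<rho> ` carrier G" for r
    using that a rho(1) rho_rho by (auto simp: rho_rho_mult m_assoc)
  show "\<rho> (\<rho> (r \<otimes> inv a) \<otimes> a) = r" if "r \<in> \<rho> ` carrier G" for r
    using that a rho(1) rho_rho by (auto simp: rho_rho_mult m_assoc)
qed (use a rho(1) in auto)

lemma rho_image_carrier: "r \<in> \<rho> ` carrier G \<Longrightarrow> r \<in> carrier G"
  using rho(1) by auto

lemma key_closed: "r \<in> carrier G \<Longrightarrow> x \<in> carrier G \<Longrightarrow> key \<rho> r x \<in> carrier K"
  using rho(2) h_closed by simp

lemma map_key_tuples: "r \<in> carrier G \<Longrightarrow> xs \<in> tuples G k \<Longrightarrow> map (key \<rho> r) xs \<in> tuples K k"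
  using key_closed by (auto simp: tuples_def)

end

text \<open>The cocycle rule for the elements that enter the transfer formula. Translation by a
  carries the summand of r to that of the representative of r a, up to a left factor in
  \<open>K\<close>, which invariant cochains do not see. Two transversals are allowed since
  comparing them needs the mixed rule, in which the left factor does not depend on \<sigma>.\<close>

lemma key_shift:
  assumes "transversal G U \<rho>" "transversal G U \<sigma>" "r \<in> carrier G" "a \<in> carrier G" "x \<in> carrier G"
  shows "key \<sigma> r (a \<otimes> x) = key \<rho> r a \<otimes>\<^bsub>K\<^esub> key \<sigma> (\<rho> (r \<otimes> a)) x"
proof -
  note R = rho[OF assms(1)] and S = rho[OF assms(2)]
  have c: "\<rho> (r \<otimes> a) \<in> carrier G" using R(1) assms by simp
  have "r \<otimes> a \<otimes> x \<otimes> inv (\<rho> (r \<otimes> a) \<otimes> x) = r \<otimes> a \<otimes> (x \<otimes> inv x) \<otimes> inv \<rho> (r \<otimes> a)"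
    using assms c by (simp only: inv_mult_group m_assoc m_closed inv_closed)
  also have "\<dots> \<in> U" using assms c R(2)[of "r \<otimes> a"] by simp
  finally have e: "\<sigma> (r \<otimes> (a \<otimes> x)) = \<sigma> (\<rho> (r \<otimes> a) \<otimes> x)"
    using rho_coset[OF assms(2), of "r \<otimes> a \<otimes> x" "\<rho> (r \<otimes> a) \<otimes> x"] assms c by (simp add: m_assoc)
  define s where "s = \<sigma> (\<rho> (r \<otimes> a) \<otimes> x)"
  have s: "s \<in> carrier G" unfolding s_def using S(1) assms c by simp
  have "r \<otimes> (a \<otimes> x) \<otimes> inv s = (r \<otimes> a \<otimes> inv \<rho> (r \<otimes> a)) \<otimes> (\<rho> (r \<otimes> a) \<otimes> x \<otimes> inv s)"
  proof -
    have "(r \<otimes> a \<otimes> inv \<rho> (r \<otimes> a)) \<otimes> (\<rho> (r \<otimes> a) \<otimes> x \<otimes> inv s) =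
        r \<otimes> a \<otimes> (inv \<rho> (r \<otimes> a) \<otimes> \<rho> (r \<otimes> a)) \<otimes> x \<otimes> inv s"
      using assms c s by (simp only: m_assoc m_closed inv_closed)
    then show ?thesis using assms c s by (simp add: m_assoc)
  qed
  moreover have "\<rho> (r \<otimes> a) \<otimes> x \<otimes> inv s \<in> U" unfolding s_def using S(2) assms c by simp
  ultimately show ?thesis
    unfolding e s_def[symmetric] using R(2)[of "r \<otimes> a"] assms by (simp add: h_mult)
qed

lemma map_key_shift:
  assumes "transversal G U \<rho>" "transversal G U \<sigma>" "r \<in> carrier G" "a \<in> carrier G" "set xs \<subseteq> carrier G"
  shows "map (key \<sigma> r) (shift a xs) = K.shift (key \<rho> r a) (map (key \<sigma> (\<rho> (r \<otimes> a))) xs)"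
  using key_shift[OF assms(1-4)] assms(5) by auto

lemma twisted_transfer_cochain:
  assumes \<rho>: "transversal G U \<rho>" and F: "F \<in> carrier (cochains K m)"
  shows "twisted_transfer G h \<rho> m F \<in> carrier (cochains G m)"
  unfolding carrier_cochains
proof (intro conjI ballI allI impI)
  fix a xs assume a: "a \<in> carrier G" and xs: "xs \<in> tuples G (Suc m)"
  have "F (map (key \<rho> r) (shift a xs)) = F (map (key \<rho> (\<rho> (r \<otimes> a))) xs)" if r: "r \<in> carrier G" for r
  proof -
    have "F (map (key \<rho> r) (shift a xs)) = F (K.shift (key \<rho> r a) (map (key \<rho> (\<rho> (r \<otimes> a))) xs))"
      using map_key_shift[OF \<rho> \<rho> r a, of xs] xs by (simp add: tuples_def del: map_map)
    also have "\<dots> = F (map (key \<rho> (\<rho> (r \<otimes> a))) xs)"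
      using F key_closed[OF \<rho> r a] map_key_tuples[OF \<rho> _ xs, of "\<rho> (r \<otimes> a)"] rho(1)[OF \<rho>] r a
      by (simp add: carrier_cochains del: map_map)
    finally show ?thesis .
  qed
  then have "(\<Sum>r\<in>\<rho> ` carrier G. F (map (key \<rho> r) (shift a xs)))
      = (\<Sum>r\<in>\<rho> ` carrier G. F (map (key \<rho> (\<rho> (r \<otimes> a))) xs))"
    using rho_image_carrier[OF \<rho>] by (intro sum.cong) auto
  also have "\<dots> = (\<Sum>r\<in>\<rho> ` carrier G. F (map (key \<rho> r) xs))"
    by (rule sum.reindex_bij_betw[OF bij_rho_shift[OF \<rho> a]])
  finally show "twisted_transfer G h \<rho> m F (shift a xs) = twisted_transfer G h \<rho> m F xs"
    unfolding twisted_transfer_def using xs shift_tuples[OF a xs] by (simp only: if_True)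
qed (auto simp: twisted_transfer_def)

lemma twisted_transfer_coboundary:
  assumes \<rho>: "transversal G U \<rho>"
  shows "coboundary G m (twisted_transfer G h \<rho> m F) = twisted_transfer G h \<rho> (Suc m) (coboundary K m F)"
proof
  fix xs show "coboundary G m (twisted_transfer G h \<rho> m F) xs = twisted_transfer G h \<rho> (Suc m) (coboundary K m F) xs"
  proof (cases "xs \<in> tuples G (Suc (Suc m))")
    case True
    have "ev (twisted_transfer G h \<rho> m F) (bd xs)
        = ev (\<lambda>ys. \<Sum>r\<in>\<rho> ` carrier G. F (map (key \<rho> r) ys)) (bd xs)"
      by (rule ev_cong) (use keys_bd_tuples[OF True] in \<open>auto simp: twisted_transfer_def\<close>)
    also have "\<dots> = (\<Sum>r\<in>\<rho> ` carrier G. ev F (bd (map (key \<rho> r) xs)))"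
      by (simp add: ev_sum_fun bd_map maps_def ev_frag_extend)
    also have "\<dots> = (\<Sum>r\<in>\<rho> ` carrier G. coboundary K m F (map (key \<rho> r) xs))"
      using map_key_tuples[OF \<rho> rho_image_carrier[OF \<rho>] True] by (intro sum.cong) (auto simp: coboundary_eq_ev)
    finally show ?thesis using True by (simp add: twisted_transfer_def coboundary_eq_ev)
  qed (simp add: twisted_transfer_def coboundary_eq_ev)
qed

lemma twisted_transfer_add:
  "twisted_transfer G h \<rho> m (\<lambda>xs. F xs + F' xs) = (\<lambda>xs. twisted_transfer G h \<rho> m F xs + twisted_transfer G h \<rho> m F' xs)"
  by (auto simp: twisted_transfer_def sum.distrib)

lemma twisted_transfer_props:
  assumes "transversal G U \<rho>"
  shows "f \<in> cocycles K m \<Longrightarrow> twisted_transfer G h \<rho> m f \<in> cocycles G m"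
    and "f \<in> coboundaries K m \<Longrightarrow> twisted_transfer G h \<rho> m f \<in> coboundaries G m"
    and "induced_map G m (twisted_transfer G h \<rho> m) (cls K m f) = cls G m (twisted_transfer G h \<rho> m f)"
  using cochain_map_props[of "twisted_transfer G h \<rho>", OF twisted_transfer_add
      twisted_transfer_cochain[OF assms] twisted_transfer_coboundary[OF assms]]
  by blast+

text \<open>For each coset the two choices give two maps from \<open>G\<close> to \<open>K\<close>,
  and the prism operator is a homotopy between them. Summed over the cosets it is equivariant, so
  the two transfers differ by the coboundary of the cochain \<open>W\<close>.\<close>

lemma twisted_transfer_independent:
  assumes \<rho>: "transversal G U \<rho>" and \<sigma>: "transversal G U \<sigma>" and F: "F \<in> cocycles K m"
  shows "cls G m (twisted_transfer G h \<rho> m F) = cls G m (twisted_transfer G h \<sigma> m F)"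
proof -
  note R = rho[OF \<rho>] and S = rho[OF \<sigma>]
  have Finv: "F (K.shift k ys) = F ys" if "k \<in> carrier K" "ys \<in> tuples K (Suc m)" for k ys
    using F that by (simp add: cocycles_iff carrier_cochains)
  \<comment> \<open>Both sums are first taken over the same representatives. Replacing r by \<sigma>
    r changes all keys of its summand by one common left factor.\<close>
  have sum\<sigma>: "(\<Sum>s\<in>\<sigma> ` carrier G. F (map (key \<sigma> s) xs)) = (\<Sum>r\<in>\<rho> ` carrier G. F (map (key \<sigma> r) xs))"
    if xs: "xs \<in> tuples G (Suc m)" for xs
  proof -
    have bij: "bij_betw \<sigma> (\<rho> ` carrier G) (\<sigma> ` carrier G)"
    proof (rule bij_betwI[where g = \<rho>])
      have 1: "\<sigma> (\<rho> y) = \<sigma> y" if "y \<in> carrier G" for y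
        using rho_coset[OF \<sigma>, of y "\<rho> y"] that R(1,2) by simp
      have 2: "\<rho> (\<sigma> y) = \<rho> y" if "y \<in> carrier G" for y
        using rho_coset[OF \<rho>, of y "\<sigma> y"] that S(1,2) by simp
      show "\<rho> (\<sigma> r) = r" if "r \<in> \<rho> ` carrier G" for r
        using that 1 2 rho_rho[OF \<rho>] R(1) S(1) by auto
      show "\<sigma> (\<rho> r) = r" if "r \<in> \<sigma> ` carrier G" for r
        using that 1 2 rho_rho[OF \<sigma>] R(1) S(1) by auto
    qed (use R(1) S(1) in auto)
    have "F (map (key \<sigma> (\<sigma> r)) xs) = F (map (key \<sigma> r) xs)" if r: "r \<in> carrier G" for r
    proof -
      have "map (key \<sigma> r) xs = map (key \<sigma> r) (shift \<one> xs)"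
        using xs by (simp add: shift_one tuples_def)
      also have "\<dots> = K.shift (key \<sigma> r \<one>) (map (key \<sigma> (\<sigma> r)) xs)"
        using map_key_shift[OF \<sigma> \<sigma> r one_closed, of xs] xs r by (simp add: tuples_def del: map_map)
      finally have "F (map (key \<sigma> r) xs) = F (K.shift (key \<sigma> r \<one>) (map (key \<sigma> (\<sigma> r)) xs))" by (rule arg_cong)
      then show ?thesis
        using Finv[OF key_closed[OF \<sigma> r one_closed] map_key_tuples[OF \<sigma> S(1)[OF r] xs]] by simp
    qed
    then have "(\<Sum>r\<in>\<rho> ` carrier G. F (map (key \<sigma> r) xs)) = (\<Sum>r\<in>\<rho> ` carrier G. F (map (key \<sigma> (\<sigma> r)) xs))"
      using rho_image_carrier[OF \<rho>] by (intro sum.cong) auto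
    then show ?thesis by (simp add: sum.reindex_bij_betw[OF bij, of "\<lambda>s. F (map (key \<sigma> s) xs)"])
  qed
  define P where "P r = prism (key \<sigma> r) (key \<rho> r)" for r
  define W where "W = (\<lambda>xs. if xs \<in> tuples G m then \<Sum>r\<in>\<rho> ` carrier G. ev F (P r xs) else 0)"
  have Pkeys: "Poly_Mapping.keys (P r xs) \<subseteq> tuples K (Suc k)"
    if r: "r \<in> carrier G" and xs: "xs \<in> tuples G k" for r xs k
  proof -
    define A where "A = key \<sigma> r ` set xs \<union> key \<rho> r ` set xs"
    have A: "A \<subseteq> carrier K"
      using xs key_closed[OF \<rho> r] key_closed[OF \<sigma> r] by (auto simp: tuples_def A_def)
    have k: "length xs = k" using xs by (simp add: tuples_def)
    have "Poly_Mapping.keys (P r xs) \<subseteq> {ys. set ys \<subseteq> A \<and> length ys = Suc (length xs)}"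
      unfolding P_def A_def by (rule keys_prism)
    also have "\<dots> \<subseteq> tuples K (Suc k)"
    proof
      fix ys assume "ys \<in> {ys. set ys \<subseteq> A \<and> length ys = Suc (length xs)}"
      then have "set ys \<subseteq> A" "length ys = Suc k" using k by simp_all
      from order_trans[OF this(1) A] this(2) show "ys \<in> tuples K (Suc k)" by (simp add: tuples_def)
    qed
    finally show ?thesis .
  qed
  have diff: "twisted_transfer G h \<rho> m F xs - twisted_transfer G h \<sigma> m F xs = ev W (bd xs)"
    if xs: "xs \<in> tuples G (Suc m)" for xs
  proof -
    have "twisted_transfer G h \<rho> m F xs - twisted_transfer G h \<sigma> m F xs =
        (\<Sum>r\<in>\<rho> ` carrier G. F (map (key \<rho> r) xs) - F (map (key \<sigma> r) xs))"
      using xs sum\<sigma>[OF xs] by (simp add: twisted_transfer_def sum_subtractf)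
    also have "\<dots> = (\<Sum>r\<in>\<rho> ` carrier G. ev (\<lambda>ys. ev F (P r ys)) (bd xs))"
    proof (rule sum.cong)
      fix r assume "r \<in> \<rho> ` carrier G"
      then have r: "r \<in> carrier G" by (rule rho_image_carrier[OF \<rho>])
      have "frag_of (map (key \<rho> r) xs) - frag_of (map (key \<sigma> r) xs) = Bd (P r xs) + frag_extend (P r) (bd xs)"
        using Bd_prism[of "key \<sigma> r" "key \<rho> r" xs] by (simp add: P_def[abs_def])
      then have "ev F (frag_of (map (key \<rho> r) xs) - frag_of (map (key \<sigma> r) xs)) =
          ev F (Bd (P r xs)) + ev F (frag_extend (P r) (bd xs))" by (simp only: ev_add)
      moreover have "ev F (Bd (P r xs)) = ev (\<lambda>x. 0) (P r xs)"
        unfolding ev_frag_extend by (rule ev_cong) (use Pkeys[OF r xs] F in \<open>auto simp: cocycles_iff\<close>)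
      ultimately show "F (map (key \<rho> r) xs) - F (map (key \<sigma> r) xs) = ev (\<lambda>ys. ev F (P r ys)) (bd xs)"
        by (simp add: ev_diff ev_frag_extend)
    qed simp
    also have "\<dots> = ev (\<lambda>ys. \<Sum>r\<in>\<rho> ` carrier G. ev F (P r ys)) (bd xs)"
      by (rule ev_sum_fun[symmetric])
    also have "\<dots> = ev W (bd xs)"
      by (rule ev_cong) (use keys_bd_tuples[OF xs] in \<open>auto simp: W_def\<close>)
    finally show ?thesis .
  qed
  have W: "W \<in> carrier (cochains G k)" if m: "m = Suc k" for k
    unfolding carrier_cochains
  proof (intro conjI ballI allI impI)
    fix a xs assume a: "a \<in> carrier G" and xs: "xs \<in> tuples G (Suc k)"
    have "ev F (P r (shift a xs)) = ev F (P (\<rho> (r \<otimes> a)) xs)" if r: "r \<in> carrier G" for r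
    proof -
      let ?k = "key \<rho> r a" and ?r = "\<rho> (r \<otimes> a)"
      have r': "?r \<in> carrier G" using R(1) r a by simp
      have "P r (shift a xs) = prism (\<lambda>x. key \<sigma> r (a \<otimes> x)) (\<lambda>x. key \<rho> r (a \<otimes> x)) xs"
        by (simp add: P_def prism_map2)
      \<comment> \<open>Both ends of the prism acquire the same left factor \<open>?k\<close>, so
        the whole prism is translated.\<close>
      also have "\<dots> = prism (\<lambda>x. ?k \<otimes>\<^bsub>K\<^esub> key \<sigma> ?r x) (\<lambda>x. ?k \<otimes>\<^bsub>K\<^esub> key \<rho> ?r x) xs"
        by (rule prism_cong) (use xs key_shift[OF \<rho> \<sigma> r a] key_shift[OF \<rho> \<rho> r a] in \<open>auto simp: tuples_def\<close>)
      also have "\<dots> = maps (\<lambda>y. ?k \<otimes>\<^bsub>K\<^esub> y) (P ?r xs)"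
        unfolding P_def by (rule prism_map)
      finally have "ev F (P r (shift a xs)) = ev F (maps (\<lambda>y. ?k \<otimes>\<^bsub>K\<^esub> y) (P ?r xs))" by simp
      also have "\<dots> = ev F (P ?r xs)"
        by (rule K.ev_maps_shift) (use Finv key_closed[OF \<rho> r a] Pkeys[OF r' xs] m in blast)
      finally show ?thesis .
    qed
    then have "(\<Sum>r\<in>\<rho> ` carrier G. ev F (P r (shift a xs))) = (\<Sum>r\<in>\<rho> ` carrier G. ev F (P (\<rho> (r \<otimes> a)) xs))"
      using rho_image_carrier[OF \<rho>] by (intro sum.cong) auto
    also have "\<dots> = (\<Sum>r\<in>\<rho> ` carrier G. ev F (P r xs))"
      by (rule sum.reindex_bij_betw[OF bij_rho_shift[OF \<rho> a]])
    finally show "W (shift a xs) = W xs"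
      unfolding W_def m using xs shift_tuples[OF a xs] by (simp only: if_True)
  qed (auto simp: W_def m)
  have "(\<lambda>xs. twisted_transfer G h \<rho> m F xs - twisted_transfer G h \<sigma> m F xs) \<in> coboundaries G m"
  proof (cases m)
    case 0
    have "twisted_transfer G h \<rho> m F xs - twisted_transfer G h \<sigma> m F xs = 0" for xs
    proof (cases "xs \<in> tuples G (Suc m)")
      case True
      have "ev W (bd xs) = ev (\<lambda>x. 0) (bd xs)"
        by (rule ev_cong) (use keys_bd_tuples[OF True] 0 in \<open>auto simp: W_def P_def tuples_def\<close>)
      then show ?thesis using diff[OF True] by simp
    qed (simp add: twisted_transfer_def)
    then show ?thesis using 0 by simp
  next
    case (Suc k)
    have "twisted_transfer G h \<rho> m F xs - twisted_transfer G h \<sigma> m F xs = coboundary G k W xs" for xs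
      using diff[of xs] Suc by (cases "xs \<in> tuples G (Suc m)") (auto simp: coboundary_eq_ev twisted_transfer_def)
    then show ?thesis using W[OF Suc] Suc by auto
  qed
  then show ?thesis by (simp add: cls_eq_iff)
qed

end

section \<open>The Hecke operator as one twisted transfer\<close>

context group begin

lemma transversal_finite_rcosets:
  assumes "subgroup U G" "transversal G U \<rho>" shows "finite (rcosets U)"
proof -
  have "rcosets U \<subseteq> (\<lambda>r. U #> r) ` \<rho> ` carrier G"
  proof
    fix c assume "c \<in> rcosets U"
    then obtain y where y: "y \<in> carrier G" "c = U #> y" by (auto simp: RCOSETS_def)
    have r: "\<rho> y \<in> carrier G" "y \<otimes> inv \<rho> y \<in> U" using assms(2) y by (auto simp: transversal_def)
    have "y \<in> U #> \<rho> y"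
      using r y by (auto simp: r_coset_def m_assoc intro!: bexI[of _ "y \<otimes> inv \<rho> y"])
    then have "U #> \<rho> y = U #> y" using repr_independence[OF _ r(1) assms(1)] by blast
    then show "c \<in> (\<lambda>r. U #> r) ` \<rho> ` carrier G" using y by blast
  qed
  then show ?thesis using assms(2) finite_surj by (auto simp: transversal_def intro: finite_subset)
qed

lemma coset_rep_mem:
  assumes "subgroup U G" "y \<in> carrier G"
  shows "coset_rep (U #> y) \<in> U #> y" "coset_rep (U #> y) \<in> carrier G" "U #> coset_rep (U #> y) = U #> y"
proof -
  show 1: "coset_rep (U #> y) \<in> U #> y"
    unfolding coset_rep_def by (rule someI[of _ y]) (rule rcos_self[OF assms(2,1)])
  show "coset_rep (U #> y) \<in> carrier G"
    using 1 r_coset_subset_G[OF subgroup.subset[OF assms(1)] assms(2)] by blast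
  show "U #> coset_rep (U #> y) = U #> y"
    using repr_independence[OF 1 assms(2,1)] by simp
qed

lemma transversal_coset_rep:
  assumes U: "subgroup U G" and fin: "finite (rcosets U)"
  shows "transversal G U (\<lambda>y. coset_rep (U #> y))"
  unfolding transversal_def
proof (intro conjI ballI)
  have "(\<lambda>y. coset_rep (U #> y)) ` carrier G \<subseteq> coset_rep ` (rcosets U)"
    by (auto simp: RCOSETS_def)
  then show "finite ((\<lambda>y. coset_rep (U #> y)) ` carrier G)" using fin finite_surj by blast
  fix y assume y: "y \<in> carrier G"
  note c = coset_rep_mem[OF U y]
  show "coset_rep (U #> y) \<in> carrier G" by (rule c)
  obtain u where u: "u \<in> U" "coset_rep (U #> y) = u \<otimes> y" using c(1) by (auto simp: r_coset_def)
  have "u \<in> carrier G" using u(1) U by (rule subgroup.mem_carrier[rotated])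
  then have "y \<otimes> inv (u \<otimes> y) = inv u" using y by (simp add: inv_mult_group m_assoc[symmetric])
  then show "y \<otimes> inv coset_rep (U #> y) \<in> U" using u U by (simp add: subgroup.m_inv_closed)
  fix v assume v: "v \<in> U"
  have "U #> (v \<otimes> y) = U #> y"
    using repr_independence[OF _ y U, of "v \<otimes> y"] v by (auto simp: r_coset_def)
  then show "coset_rep (U #> (v \<otimes> y)) = coset_rep (U #> y)" by simp
qed

lemma transfer_cochain_eq:
  assumes U: "subgroup U G"
  shows "transfer_cochain G U m f = twisted_transfer G (\<lambda>x. x) (\<lambda>y. coset_rep (U #> y)) m f"
proof -
  have inj: "inj_on coset_rep (rcosets U)"
  proof (rule inj_onI)
    fix c d assume "c \<in> rcosets U" "d \<in> rcosets U" and e: "coset_rep c = coset_rep d"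
    then obtain y z where "y \<in> carrier G" "c = U #> y" "z \<in> carrier G" "d = U #> z"
      by (auto simp: RCOSETS_def)
    then show "c = d" using coset_rep_mem(3)[OF U] e by metis
  qed
  have im: "(\<lambda>y. coset_rep (U #> y)) ` carrier G = coset_rep ` (rcosets U)"
    by (auto simp: RCOSETS_def)
  show ?thesis
    unfolding transfer_cochain_def twisted_transfer_def im sum.reindex[OF inj] o_def
  proof (rule ext, rule if_cong[OF refl _ refl], rule sum.cong[OF refl], rule arg_cong[of _ _ f], rule map_cong[OF refl])
    fix xs c x assume "xs \<in> tuples G (Suc m)" "c \<in> rcosets U" "x \<in> set xs"
    then obtain y where y: "y \<in> carrier G" "c = U #> y" and x: "x \<in> carrier G"
      by (auto simp: RCOSETS_def tuples_def)
    have "U #> (coset_rep c \<otimes> x) = c #> x"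
      using coset_rep_mem[OF U y(1)] x coset_mult_assoc[OF subgroup.subset[OF U], of "coset_rep c" x] y(2) by simp
    then show "coset_rep c \<otimes> x \<otimes> inv coset_rep (c #> x) =
      coset_rep c \<otimes> x \<otimes> inv coset_rep (U #> (coset_rep c \<otimes> x))" by simp
  qed
qed

lemma subgroup_hecke:
  assumes \<Gamma>: "subgroup \<Gamma> G" and g: "g \<in> carrier G"
  defines "\<Gamma>' \<equiv> \<Gamma> \<inter> (\<lambda>x. g \<otimes> x \<otimes> inv g) ` \<Gamma>"
  shows "subgroup \<Gamma>' G" "x \<in> \<Gamma>' \<Longrightarrow> inv g \<otimes> x \<otimes> g \<in> \<Gamma>"
    "x \<in> carrier G \<Longrightarrow> x \<in> \<Gamma>' \<longleftrightarrow> x \<in> \<Gamma> \<and> inv g \<otimes> x \<otimes> g \<in> \<Gamma>"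
proof -
  note car = subgroup.mem_carrier[OF \<Gamma>]
  have can: "inv g \<otimes> (g \<otimes> x \<otimes> inv g) \<otimes> g = x" "g \<otimes> (inv g \<otimes> x \<otimes> g) \<otimes> inv g = x" if "x \<in> carrier G" for x
  proof -
    have "inv g \<otimes> (g \<otimes> x \<otimes> inv g) \<otimes> g = (inv g \<otimes> g) \<otimes> x \<otimes> (inv g \<otimes> g)"
      using g that by (simp only: m_assoc m_closed inv_closed)
    then show "inv g \<otimes> (g \<otimes> x \<otimes> inv g) \<otimes> g = x" using g that by simp
    have "g \<otimes> (inv g \<otimes> x \<otimes> g) \<otimes> inv g = (g \<otimes> inv g) \<otimes> x \<otimes> (g \<otimes> inv g)"
      using g that by (simp only: m_assoc m_closed inv_closed)
    then show "g \<otimes> (inv g \<otimes> x \<otimes> g) \<otimes> inv g = x" using g that by simp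
  qed
  show iff: "x \<in> \<Gamma>' \<longleftrightarrow> x \<in> \<Gamma> \<and> inv g \<otimes> x \<otimes> g \<in> \<Gamma>" if "x \<in> carrier G" for x
    using can that car unfolding \<Gamma>'_def by (auto intro!: image_eqI[of _ _ "inv g \<otimes> x \<otimes> g"])
  then show "x \<in> \<Gamma>' \<Longrightarrow> inv g \<otimes> x \<otimes> g \<in> \<Gamma>" for x
    using car unfolding \<Gamma>'_def by blast
  show "subgroup \<Gamma>' G"
  proof (rule subgroupI)
    show "\<Gamma>' \<subseteq> carrier G" using car by (auto simp: \<Gamma>'_def)
    have "\<one> \<in> \<Gamma>'" using iff[OF one_closed] subgroup.one_closed[OF \<Gamma>] g by simp
    then show "\<Gamma>' \<noteq> {}" by blast
    fix a b assume a: "a \<in> \<Gamma>'" and b: "b \<in> \<Gamma>'"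
    have ac: "a \<in> carrier G" "b \<in> carrier G" using a b car by (auto simp: \<Gamma>'_def)
    have "inv g \<otimes> inv a \<otimes> g = inv (inv g \<otimes> a \<otimes> g)"
      using ac g by (simp add: inv_mult_group m_assoc)
    then show "inv a \<in> \<Gamma>'"
      using a ac iff subgroup.m_inv_closed[OF \<Gamma>] by simp
    have "inv g \<otimes> (a \<otimes> b) \<otimes> g = inv g \<otimes> a \<otimes> (g \<otimes> inv g) \<otimes> b \<otimes> g"
      using ac g by (simp add: m_assoc)
    also have "\<dots> = (inv g \<otimes> a \<otimes> g) \<otimes> (inv g \<otimes> b \<otimes> g)"
      using ac g by (simp only: m_assoc m_closed inv_closed)
    finally show "a \<otimes> b \<in> \<Gamma>'"
      using a b ac iff subgroup.m_closed[OF \<Gamma>] by simp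
  qed
qed

text \<open>On cochains the two pullbacks merely substitute conjugated arguments, so the composite
  is the transfer twisted by \<open>cj\<close>. The definition of the transfer fixes arbitrary
  representatives; independence of the transversal replaces them by ones that a program can
  find.\<close>

lemma hecke_operator_cls:
  assumes \<Gamma>: "subgroup \<Gamma> G" and g: "g \<in> carrier G"
  defines "\<Gamma>' \<equiv> \<Gamma> \<inter> (\<lambda>x. g \<otimes> x \<otimes> inv g) ` \<Gamma>" and "H \<equiv> G\<lparr>carrier := \<Gamma>\<rparr>" and "cj \<equiv> \<lambda>x. inv g \<otimes> x \<otimes> g"
  assumes tr: "transversal H \<Gamma>' \<rho>" and F: "F \<in> cocycles H m"
  shows "hecke_operator G \<Gamma> g m (cls H m F) = cls H m (twisted_transfer H cj \<rho> m F)"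
    and "twisted_transfer H cj \<rho> m F \<in> cocycles H m"
proof -
  note sub = subgroup_hecke[OF \<Gamma> g, folded \<Gamma>'_def cj_def]
  let ?H' = "G\<lparr>carrier := \<Gamma>'\<rparr>" and ?H'' = "G\<lparr>carrier := cj ` \<Gamma>'\<rparr>"
  have H: "group H" unfolding H_def by (rule subgroup.subgroup_is_group[OF \<Gamma> is_group])
  have H': "group ?H'" by (rule subgroup.subgroup_is_group[OF sub(1) is_group])
  have cj_mult: "cj (x \<otimes> y) = cj x \<otimes> cj y" if "x \<in> carrier G" "y \<in> carrier G" for x y
  proof -
    have "cj (x \<otimes> y) = inv g \<otimes> x \<otimes> (g \<otimes> inv g) \<otimes> y \<otimes> g"
      using that g by (simp add: cj_def m_assoc)
    also have "\<dots> = cj x \<otimes> cj y"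
      using that g unfolding cj_def by (simp only: m_assoc m_closed inv_closed)
    finally show ?thesis .
  qed
  have \<Gamma>'_car: "x \<in> carrier G" if "x \<in> \<Gamma>'" for x using that subgroup.mem_carrier[OF sub(1)] by blast
  have chom: "cj \<in> hom ?H' G"
    using \<Gamma>'_car cj_mult g by (auto simp: hom_def cj_def)
  have H'': "group ?H''"
  proof -
    interpret c: group_hom ?H' G cj
      using chom H' is_group by (simp add: group_hom_def group_hom_axioms_def)
    show ?thesis using c.img_is_subgroup subgroup.subgroup_is_group[OF _ is_group] by simp
  qed
  have sub': "subgroup \<Gamma>' H"
    unfolding H_def by (rule subgroup_incl[OF sub(1) \<Gamma>]) (auto simp: \<Gamma>'_def)
  have H'_eq: "H\<lparr>carrier := \<Gamma>'\<rparr> = ?H'" by (simp add: H_def)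
  have homs: "(\<lambda>x. x) \<in> hom ?H'' H" "cj \<in> hom ?H' ?H''" "(\<lambda>x. x) \<in> hom ?H' ?H'" "cj \<in> hom ?H' H"
  proof -
    have "cj x \<in> \<Gamma>" if "x \<in> \<Gamma>'" for x using sub(2)[OF that] by (simp add: cj_def)
    then show "(\<lambda>x. x) \<in> hom ?H'' H" "cj \<in> hom ?H' ?H''" "(\<lambda>x. x) \<in> hom ?H' ?H'" "cj \<in> hom ?H' H"
      using \<Gamma>'_car cj_mult by (auto simp: hom_def H_def)
  qed
  define r0 where "r0 y = coset_rep (\<Gamma>' #>\<^bsub>H\<^esub> y)" for y
  have tr0: "transversal H \<Gamma>' r0"
    unfolding r0_def[abs_def] by (rule group.transversal_coset_rep[OF H sub']) (rule group.transversal_finite_rcosets[OF H sub' tr])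
  interpret T1: subgroup_hom H ?H' \<Gamma>' "\<lambda>x. x"
    using H H' sub' homs(3) by (auto simp: subgroup_hom_def subgroup_hom_axioms_def H'_eq)
  interpret T2: subgroup_hom H H \<Gamma>' cj
    using H sub' homs(4) by (auto simp: subgroup_hom_def subgroup_hom_axioms_def H'_eq)
  define F1 where "F1 = pull ?H'' (\<lambda>x. x) m F"
  define F2 where "F2 = pull ?H' cj m F1"
  have "hecke_operator G \<Gamma> g m (cls H m F) = transfer H \<Gamma>' m (pullback ?H' m cj (pullback ?H'' m (\<lambda>x. x) (cls H m F)))"
    by (simp add: hecke_operator_def Let_def \<Gamma>'_def cj_def H_def)
  also have "pullback ?H'' m (\<lambda>x. x) (cls H m F) = cls ?H'' m F1"
    unfolding F1_def by (rule pull_props(2)[OF H'' homs(1)])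
  also have "pullback ?H' m cj \<dots> = cls ?H' m F2"
    unfolding F2_def by (rule pull_props(2)[OF H' homs(2)])
  also have "transfer H \<Gamma>' m \<dots> = cls H m (twisted_transfer H (\<lambda>x. x) r0 m F2)"
  proof -
    have "transfer_cochain H \<Gamma>' m = twisted_transfer H (\<lambda>x. x) r0 m"
      by (rule ext) (simp add: group.transfer_cochain_eq[OF H sub'] r0_def[abs_def])
    then show ?thesis
      unfolding transfer_def using T1.twisted_transfer_props(3)[OF tr0, of m F2] by simp
  qed
  also have "twisted_transfer H (\<lambda>x. x) r0 m F2 = twisted_transfer H cj r0 m F"
  proof
    fix xs
    have "F2 (map (T1.key r0 r) xs) = F (map (T2.key r0 r) xs)" if "r \<in> carrier H" "xs \<in> tuples H (Suc m)" for r
    proof -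
      have 1: "map (T1.key r0 r) xs \<in> tuples ?H' (Suc m)" using T1.map_key_tuples[OF tr0 that] .
      then have 2: "map cj (map (T1.key r0 r) xs) \<in> tuples ?H'' (Suc m)" by (auto simp: tuples_def)
      show ?thesis using 1 2 by (simp add: F2_def F1_def pull_def o_def)
    qed
    then show "twisted_transfer H (\<lambda>x. x) r0 m F2 xs = twisted_transfer H cj r0 m F xs"
      unfolding twisted_transfer_def using T1.rho_image_carrier[OF tr0]
      by (intro if_cong sum.cong refl) blast
  qed
  also have "cls H m \<dots> = cls H m (twisted_transfer H cj \<rho> m F)"
    by (rule T2.twisted_transfer_independent[OF tr0 tr F])
  finally show "hecke_operator G \<Gamma> g m (cls H m F) = cls H m (twisted_transfer H cj \<rho> m F)" .
  show "twisted_transfer H cj \<rho> m F \<in> cocycles H m"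
    by (rule T2.twisted_transfer_props(1)[OF tr F])
qed

end

section \<open>Certificates\<close>

text \<open>
  \<open>z\<close> is a basis of the kernel of the matrix \<open>\<delta>\<close>: \<open>w\<close> is a dual family, and the identity involving
  \<open>L\<close> shows that \<open>z\<close> generates, since \<open>L\<close> vanishes after \<open>\<delta>\<close>.
\<close>

definition kernel_data :: "'x set \<Rightarrow> 'y set \<Rightarrow> ('y \<Rightarrow> 'x \<Rightarrow> int) \<Rightarrow> 'i set \<Rightarrow> ('i \<Rightarrow> 'x \<Rightarrow> int) \<Rightarrow>
    ('i \<Rightarrow> 'x \<Rightarrow> int) \<Rightarrow> ('x \<Rightarrow> 'y \<Rightarrow> int) \<Rightarrow> int \<Rightarrow> bool" where
  "kernel_data X Y \<delta> I z w L c \<longleftrightarrow> c \<noteq> 0 \<and>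
     (\<forall>i\<in>I. \<forall>j\<in>I. (\<Sum>a\<in>X. w i a * z j a) = (if i = j then 1 else 0)) \<and>
     (\<forall>j\<in>I. \<forall>y\<in>Y. (\<Sum>a\<in>X. \<delta> y a * z j a) = 0) \<and>
     (\<forall>a\<in>X. \<forall>b\<in>X. c * ((if a = b then 1 else 0) - (\<Sum>i\<in>I. z i a * w i b)) = (\<Sum>y\<in>Y. L a y * \<delta> y b))"

lemma kernel_dataD:
  assumes "kernel_data X Y \<delta> I z w L c"
  shows "c \<noteq> 0"
    and "i \<in> I \<Longrightarrow> j \<in> I \<Longrightarrow> (\<Sum>a\<in>X. w i a * z j a) = (if i = j then 1 else 0)"
    and "j \<in> I \<Longrightarrow> y \<in> Y \<Longrightarrow> (\<Sum>a\<in>X. \<delta> y a * z j a) = 0"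
    and "a \<in> X \<Longrightarrow> b \<in> X \<Longrightarrow>
      c * ((if a = b then 1 else 0) - (\<Sum>i\<in>I. z i a * w i b)) = (\<Sum>y\<in>Y. L a y * \<delta> y b)"
  using assms unfolding kernel_data_def by blast+

text \<open>Applied to \<open>f\<close>, the right side of the identity vanishes, leaving
  \<open>f\<close> as the combination with coefficients paired off by \<open>w\<close>. The factor
  \<open>c\<close> is present because the identity need only be solvable over the rationals; it
  cancels as integers have no torsion.\<close>

lemma kernel_data_generates:
  assumes "kernel_data X Y \<delta> I z w L c" "finite X"
    and f: "\<And>y. y \<in> Y \<Longrightarrow> (\<Sum>b\<in>X. \<delta> y b * f b) = 0" and a: "a \<in> X"
  shows "f a = (\<Sum>i\<in>I. (\<Sum>b\<in>X. w i b * f b) * z i a)"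
proof -
  have c: "c \<noteq> 0" and id: "\<And>b. b \<in> X \<Longrightarrow>
      c * ((if a = b then 1 else 0) - (\<Sum>i\<in>I. z i a * w i b)) = (\<Sum>y\<in>Y. L a y * \<delta> y b)"
    using assms(1) a by (auto simp: kernel_data_def)
  have "c * (f a - (\<Sum>i\<in>I. (\<Sum>b\<in>X. w i b * f b) * z i a))
      = (\<Sum>b\<in>X. c * ((if a = b then 1 else 0) - (\<Sum>i\<in>I. z i a * w i b)) * f b)"
  proof -
    have "(\<Sum>b\<in>X. (if a = b then 1 else 0) * f b) = f a"
      using a assms(2) by (simp add: if_distrib[of "\<lambda>u. u * _"] cong: if_cong)
    moreover have "(\<Sum>b\<in>X. (\<Sum>i\<in>I. z i a * w i b) * f b) = (\<Sum>i\<in>I. (\<Sum>b\<in>X. w i b * f b) * z i a)"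
      unfolding sum_distrib_right by (subst sum.swap) (simp add: algebra_simps)
    ultimately have "f a - (\<Sum>i\<in>I. (\<Sum>b\<in>X. w i b * f b) * z i a) =
       (\<Sum>b\<in>X. ((if a = b then 1 else 0) - (\<Sum>i\<in>I. z i a * w i b)) * f b)"
      by (simp add: left_diff_distrib sum_subtractf)
    then show ?thesis by (simp add: sum_distrib_left mult.assoc)
  qed
  also have "\<dots> = (\<Sum>b\<in>X. (\<Sum>y\<in>Y. L a y * \<delta> y b) * f b)"
    by (rule sum.cong) (auto simp only: id)
  also have "\<dots> = (\<Sum>y\<in>Y. L a y * (\<Sum>b\<in>X. \<delta> y b * f b))"
    unfolding sum_distrib_right sum_distrib_left by (subst sum.swap) (simp add: mult.assoc)
  also have "\<dots> = 0" using f by simp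
  finally show ?thesis using c by simp
qed

text \<open>A new row is a linear form on the old kernel, with values \<alpha> i on the basis.
  Euclid's algorithm on these values, performed as a change of basis, leaves at most one of them
  nonzero, and the kernel of the form is spanned by the remaining basis vectors.\<close>

lemma kernel_data_extend:
  fixes I :: "'i set"
  assumes "finite X" "finite Y" "y0 \<notin> Y" "finite I" "kernel_data X Y \<delta> I z w L c"
  shows "\<exists>(J :: 'i set) z' w' L' c'. finite J \<and> kernel_data X (insert y0 Y) \<delta> J z' w' L' c'"
  using assms(4,5)
proof (induction "\<Sum>i\<in>I. nat \<bar>\<Sum>a\<in>X. \<delta> y0 a * z i a\<bar>" arbitrary: z w rule: less_induct)
  case less
  note fin = assms(1,2) less.prems(1)
  define \<alpha> where "\<alpha> i = (\<Sum>a\<in>X. \<delta> y0 a * z i a)" for i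
  note c = kernel_dataD(1)[OF less.prems(2)] and dual = kernel_dataD(2)[OF less.prems(2)]
    and ker = kernel_dataD(3)[OF less.prems(2)] and id = kernel_dataD(4)[OF less.prems(2)]
  consider "\<forall>i\<in>I. \<alpha> i = 0" | p where "p \<in> I" "\<alpha> p \<noteq> 0" "\<forall>i\<in>I. i \<noteq> p \<longrightarrow> \<alpha> i = 0"
    | i j where "i \<in> I" "j \<in> I" "i \<noteq> j" "\<alpha> i \<noteq> 0" "\<alpha> j \<noteq> 0" "\<bar>\<alpha> j\<bar> \<le> \<bar>\<alpha> i\<bar>"
  proof (cases "\<forall>i\<in>I. \<alpha> i = 0")
    case False
    then obtain p where p: "p \<in> I" "\<alpha> p \<noteq> 0" by blast
    show ?thesis
    proof (cases "\<forall>i\<in>I. i \<noteq> p \<longrightarrow> \<alpha> i = 0")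
      case False
      then obtain q where q: "q \<in> I" "\<alpha> q \<noteq> 0" "q \<noteq> p" "p \<noteq> q" by blast
      show ?thesis
      proof (cases "\<bar>\<alpha> q\<bar> \<le> \<bar>\<alpha> p\<bar>")
        case True
        then show ?thesis by (rule that(3)[OF p(1) q(1,4) p(2) q(2)])
      next
        case False
        then show ?thesis by (intro that(3)[OF q(1) p(1) q(3) q(2) p(2)]) linarith
      qed
    qed (use p that(2) in blast)
  qed (use that(1) in blast)
  then show ?case
  proof cases
    case 1
    define L' where "L' a y = (if y = y0 then 0 else L a y)" for a y
    have "(\<Sum>y\<in>insert y0 Y. L' a y * \<delta> y b) = (\<Sum>y\<in>Y. L a y * \<delta> y b)" for a b
    proof -
      have "(\<Sum>y\<in>Y. L' a y * \<delta> y b) = (\<Sum>y\<in>Y. L a y * \<delta> y b)"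
        by (rule sum.cong) (use assms(3) in \<open>auto simp: L'_def\<close>)
      then show ?thesis using assms(3) fin(2) by (simp add: L'_def)
    qed
    then have "kernel_data X (insert y0 Y) \<delta> I z w L' c"
      using less.prems(2) 1 unfolding kernel_data_def \<alpha>_def by simp
    with fin(3) show ?thesis by blast
  next
    case 2
    \<comment> \<open>Contracting the old identity with the new row expresses c times \<alpha> p
      times \<open>w p\<close> through rows of the matrix, all other \<alpha> i being 0. This moves
      the term of the dropped basis vector into \<open>L'\<close>, at the price of the factor
      \<alpha> p in \<open>c\<close>.\<close>
    define M where "M y = (\<Sum>a\<in>X. \<delta> y0 a * L a y)" for y
    define L' where "L' a y = (if y = y0 then c * z p a else \<alpha> p * L a y - z p a * M y)" for a y
    have w_p: "c * \<alpha> p * w p b = c * \<delta> y0 b - (\<Sum>y\<in>Y. M y * \<delta> y b)" if b: "b \<in> X" for b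
    proof -
      have "(\<Sum>y\<in>Y. M y * \<delta> y b) = (\<Sum>a\<in>X. \<delta> y0 a * (\<Sum>y\<in>Y. L a y * \<delta> y b))"
        unfolding M_def sum_distrib_right sum_distrib_left by (subst sum.swap) (simp add: mult.assoc)
      also have "\<dots> = (\<Sum>a\<in>X. \<delta> y0 a * (c * ((if a = b then 1 else 0) - (\<Sum>i\<in>I. z i a * w i b))))"
        by (rule sum.cong) (simp_all add: id b)
      also have "\<dots> = c * ((\<Sum>a\<in>X. \<delta> y0 a * (if a = b then 1 else 0)) - (\<Sum>a\<in>X. \<delta> y0 a * (\<Sum>i\<in>I. z i a * w i b)))"
        by (simp add: sum_distrib_left right_diff_distrib sum_subtractf algebra_simps)
      also have "(\<Sum>a\<in>X. \<delta> y0 a * (if a = b then 1 else 0)) = \<delta> y0 b"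
        using b fin by (simp add: if_distrib[of "\<lambda>u. _ * u"] cong: if_cong)
      also have "(\<Sum>a\<in>X. \<delta> y0 a * (\<Sum>i\<in>I. z i a * w i b)) = (\<Sum>i\<in>I. \<alpha> i * w i b)"
        unfolding \<alpha>_def sum_distrib_right sum_distrib_left by (subst sum.swap) (simp add: mult.assoc)
      also have "\<dots> = \<alpha> p * w p b"
        using 2 fin by (subst sum.remove[of _ p]) auto
      finally show ?thesis by (simp add: algebra_simps)
    qed
    have "kernel_data X (insert y0 Y) \<delta> (I - {p}) z w L' (c * \<alpha> p)"
      unfolding kernel_data_def
    proof (intro conjI ballI)
      fix a b assume ab: "a \<in> X" "b \<in> X"
      have "(\<Sum>y\<in>insert y0 Y. L' a y * \<delta> y b) = c * z p a * \<delta> y0 b + (\<Sum>y\<in>Y. L' a y * \<delta> y b)"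
        using assms(3) fin by (simp add: L'_def)
      also have "(\<Sum>y\<in>Y. L' a y * \<delta> y b) = (\<Sum>y\<in>Y. \<alpha> p * (L a y * \<delta> y b) - z p a * (M y * \<delta> y b))"
        using assms(3) by (intro sum.cong) (auto simp: L'_def algebra_simps)
      also have "\<dots> = \<alpha> p * (\<Sum>y\<in>Y. L a y * \<delta> y b) - z p a * (\<Sum>y\<in>Y. M y * \<delta> y b)"
        by (simp add: sum_subtractf sum_distrib_left)
      also have "c * z p a * \<delta> y0 b + \<dots> = \<alpha> p * (\<Sum>y\<in>Y. L a y * \<delta> y b) + z p a * (c * \<alpha> p * w p b)"
        unfolding w_p[OF ab(2)] by (simp add: algebra_simps)
      also have "(\<Sum>y\<in>Y. L a y * \<delta> y b) = c * ((if a = b then 1 else 0) - (\<Sum>i\<in>I. z i a * w i b))"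
        by (rule id[OF ab, symmetric])
      also have "(\<Sum>i\<in>I. z i a * w i b) = z p a * w p b + (\<Sum>i\<in>I - {p}. z i a * w i b)"
        using 2 fin by (simp add: sum.remove)
      finally show "c * \<alpha> p * ((if a = b then 1 else 0) - (\<Sum>i\<in>I - {p}. z i a * w i b)) =
          (\<Sum>y\<in>insert y0 Y. L' a y * \<delta> y b)"
        by (simp add: algebra_simps)
    qed (use c 2 dual ker in \<open>auto simp: \<alpha>_def\<close>)
    moreover have "finite (I - {p})" using fin(3) by simp
    ultimately show ?thesis by blast
  next
    case 3
    \<comment> \<open>With this sign \<alpha> i loses the absolute value of \<alpha> j. The change
      of \<open>w\<close> is the dual one, which preserves the pairing as well as the sum of the
      products of \<open>z\<close> and \<open>w\<close>.\<close>
    define k where "k = sgn (\<alpha> i) * sgn (\<alpha> j)"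
    define z' where "z' = z(i := \<lambda>a. z i a - k * z j a)"
    define w' where "w' = w(j := \<lambda>a. w j a + k * w i a)"
    have "kernel_data X Y \<delta> I z' w' L c"
      unfolding kernel_data_def
    proof (intro conjI ballI)
      fix s t assume st: "s \<in> I" "t \<in> I"
      have *: "(\<Sum>a\<in>X. w s a * z' t a) = (\<Sum>a\<in>X. w s a * z t a) - (if t = i then k * (\<Sum>a\<in>X. w s a * z j a) else 0)" for s
        by (auto simp: z'_def sum_subtractf sum_distrib_left algebra_simps)
      have "(\<Sum>a\<in>X. w' s a * z' t a) = (\<Sum>a\<in>X. w s a * z' t a) + (if s = j then k * (\<Sum>a\<in>X. w i a * z' t a) else 0)"
        by (auto simp: w'_def sum.distrib sum_distrib_left algebra_simps)
      then show "(\<Sum>a\<in>X. w' s a * z' t a) = (if s = t then 1 else 0)"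
        using st 3(1-3) unfolding * by (simp add: dual split: if_splits)
    next
      fix s y assume "s \<in> I" "y \<in> Y"
      then show "(\<Sum>a\<in>X. \<delta> y a * z' s a) = 0"
        using ker[of s y] ker[of j y] 3
        by (auto simp: z'_def right_diff_distrib sum_subtractf mult.left_commute[of _ k] simp flip: sum_distrib_left)
    next
      fix a b assume ab: "a \<in> X" "b \<in> X"
      have split: "(\<Sum>s\<in>I. f s) = f i + f j + (\<Sum>s\<in>I - {i} - {j}. f s)" for f :: "_ \<Rightarrow> int"
        using 3 fin by (subst sum.remove[of _ i], simp, simp, subst sum.remove[of _ j]) auto
      have "(\<Sum>s\<in>I - {i} - {j}. z' s a * w' s b) = (\<Sum>s\<in>I - {i} - {j}. z s a * w s b)"
        by (rule sum.cong) (auto simp: z'_def w'_def)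
      then have "(\<Sum>s\<in>I. z' s a * w' s b) = (\<Sum>s\<in>I. z s a * w s b)"
        using 3(3) unfolding split by (simp add: z'_def w'_def algebra_simps)
      then show "c * ((if a = b then 1 else 0) - (\<Sum>i\<in>I. z' i a * w' i b)) = (\<Sum>y\<in>Y. L a y * \<delta> y b)"
        using id[OF ab] by simp
    qed (rule c)
    moreover have "(\<Sum>s\<in>I. nat \<bar>\<Sum>a\<in>X. \<delta> y0 a * z' s a\<bar>) < (\<Sum>s\<in>I. nat \<bar>\<Sum>a\<in>X. \<delta> y0 a * z s a\<bar>)"
    proof -
      have new: "(\<Sum>a\<in>X. \<delta> y0 a * z' s a) = (if s = i then \<alpha> i - k * \<alpha> j else \<alpha> s)" for s
        by (auto simp: z'_def \<alpha>_def right_diff_distrib sum_subtractf sum_distrib_left mult.left_commute)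
      have "\<bar>\<alpha> i - k * \<alpha> j\<bar> < \<bar>\<alpha> i\<bar>"
        using 3(4-6) by (auto simp: k_def sgn_if abs_if split: if_splits)
      then show ?thesis
        unfolding new \<alpha>_def[symmetric] using 3(1) fin by (intro sum_strict_mono_ex1) auto
    qed
    ultimately show ?thesis using less.hyps fin(3) by blast
  qed
qed


text \<open>With no rows the kernel is everything and the standard basis is dual to itself; rows are
  then imposed one at a time.\<close>

lemma kernel_data_exists:
  fixes X :: "'x set"
  assumes "finite X" "finite Y"
  shows "\<exists>(I :: 'x set) z w L c. finite I \<and> kernel_data X Y \<delta> I z w L c"
  using assms(2)
proof (induction Y rule: finite_induct)
  case empty
  have "kernel_data X {} \<delta> X (\<lambda>i a. if i = a then 1 else 0) (\<lambda>i a. if i = a then 1 else 0) (\<lambda>a y. 0) 1"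
    using assms(1) by (auto simp: kernel_data_def if_distrib[of "\<lambda>u. u * _"] cong: if_cong)
  then show ?case using assms(1) by blast
next
  case (insert y Y)
  then show ?case using kernel_data_extend[OF assms(1) insert.hyps(1,2)] by blast
qed

lemma kernel_data_reindex:
  assumes "bij_betw e J I" "kernel_data X Y \<delta> I z w L c"
  shows "kernel_data X Y \<delta> J (\<lambda>i. z (e i)) (\<lambda>i. w (e i)) L c"
proof -
  have e: "i \<in> J \<Longrightarrow> e i \<in> I" and inj: "i \<in> J \<Longrightarrow> j \<in> J \<Longrightarrow> e i = e j \<longleftrightarrow> i = j" for i j
    using assms(1) by (auto simp: bij_betw_def inj_on_def)
  have "(\<Sum>i\<in>J. z (e i) a * w (e i) b) = (\<Sum>i\<in>I. z i a * w i b)" for a b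
    by (rule sum.reindex_bij_betw[OF assms(1)])
  then show ?thesis
    using kernel_dataD[OF assms(2)] e inj unfolding kernel_data_def by simp
qed

lemma kernel_data_exists_nat:
  assumes "finite X" "finite Y"
  shows "\<exists>(n::nat) z w L c. kernel_data X Y \<delta> {..<n} z w L c"
proof -
  obtain I :: "'a set" and z w L c where I: "finite I" "kernel_data X Y \<delta> I z w L c"
    using kernel_data_exists[OF assms, of \<delta>] by blast
  obtain e where "bij_betw e {..<card I} I"
    using ex_bij_betw_nat_finite[OF I(1)] by (auto simp: atLeast0LessThan)
  from kernel_data_reindex[OF this I(2)] show ?thesis by blast
qed

section \<open>The Hecke operator in terms of quadruples\<close>

definition qconj :: "quad \<Rightarrow> quad \<Rightarrow> quad" where
  "qconj M y = (let n = qmul (qmul (qadj M) y) M; e = qdet M in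
     (fst n div e, fst (snd n) div e, fst (snd (snd n)) div e, snd (snd (snd n)) div e))"

text \<open>Membership in \<open>\<Gamma> \<inter> g \<Gamma> g\<^sup>-\<^sup>1\<close>; the equation says that the divisions in \<open>qconj\<close> are exact.\<close>

definition hmem :: "(quad \<Rightarrow> bool) \<Rightarrow> quad \<Rightarrow> quad \<Rightarrow> bool" where
  "hmem P M y \<longleftrightarrow> P y \<and> P (qconj M y) \<and> qmul M (qconj M y) = qmul y M"

text \<open>The first element of the ball in the coset of \<open>y\<close> under \<Gamma> \<inter> g
  \<Gamma> g^{-1}. The filter does not change when \<open>y\<close> moves inside its coset, so
  neither does the result.\<close>

definition hrep :: "(quad \<Rightarrow> bool) \<Rightarrow> quad \<Rightarrow> nat \<Rightarrow> quad \<Rightarrow> quad" where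
  "hrep P M D y = lhd (filter (\<lambda>u. P u \<and> hmem P M (qmul y (qadj u))) (qball D))"

text \<open>The values of \<open>hrep\<close> are its fixed points, and these can be listed by
  inspecting the ball.\<close>

definition hreps :: "(quad \<Rightarrow> bool) \<Rightarrow> quad \<Rightarrow> nat \<Rightarrow> quad list" where
  "hreps P M D = remdups (filter (\<lambda>u. P u \<and> hrep P M D u = u) (qball D))"

definition hact :: "(quad \<Rightarrow> bool) \<Rightarrow> quad \<Rightarrow> nat \<Rightarrow> quad \<Rightarrow> quad \<Rightarrow> quad" where
  "hact P M D r x = qconj M (qmul (qmul r x) (qadj (hrep P M D (qmul r x))))"

text \<open>
  Tuples with first entry \<open>1\<close> represent the orbits of \<open>\<Gamma>\<close>; a cochain is stored as an association
  list on such tuples and evaluated elsewhere by means of \<open>qnorm\<close>.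
\<close>

definition tupl :: "(quad \<Rightarrow> bool) \<Rightarrow> nat \<Rightarrow> nat \<Rightarrow> quad list list" where
  "tupl P d k = filter (\<lambda>xs. \<forall>x\<in>set xs. \<forall>y\<in>set xs. qmul (qadj x) y \<in> set (qball d))
     (map (\<lambda>ys. qone # ys) (List.n_lists k (remdups (filter P (qball d)))))"

definition qnorm :: "quad list \<Rightarrow> quad list" where
  "qnorm xs = map (qmul (qadj (lhd xs))) xs"

text \<open>Repeated keys add up and missing keys count 0, so every list denotes a cochain and
  certificates need no condition of well-formedness.\<close>

definition val :: "('k \<times> int) list \<Rightarrow> 'k \<Rightarrow> int" where
  "val l k = sum_list (map (\<lambda>p. if fst p = k then snd p else 0) l)"

definition cob :: "(quad list \<times> int) list \<Rightarrow> quad list \<Rightarrow> int" where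
  "cob z y = sum_list (map (\<lambda>j. (if even j then 1 else - 1) * val z (qnorm (take j y @ drop (Suc j) y))) [0..<length y])"

definition heckev :: "(quad \<Rightarrow> bool) \<Rightarrow> quad \<Rightarrow> nat \<Rightarrow> (quad list \<times> int) list \<Rightarrow> quad list \<Rightarrow> int" where
  "heckev P M D z xs = sum_list (map (\<lambda>r. val z (qnorm (map (hact P M D r) xs))) (hreps P M D))"

lemma sum_list_sum: "sum_list (map f xs) = sum f (set xs)" if "distinct xs" for f :: "_ \<Rightarrow> int"
  using that by (simp add: sum_list_distinct_conv_sum_set)

lemma val_zip: "val (map (\<lambda>a. (a, f a)) xs) k = (if k \<in> set xs then f k else 0)" if "distinct xs"
  using that by (induction xs) (auto simp: val_def)

lemma val_single [simp]: "val [(b, c)] k = (if b = k then c else 0)"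
  by (simp add: val_def)

lemma set_tupl: "xs \<in> set (tupl P d k) \<longleftrightarrow> length xs = Suc k \<and> hd xs = qone \<and>
    (\<forall>x\<in>set (tl xs). P x \<and> x \<in> set (qball d)) \<and> (\<forall>x\<in>set xs. \<forall>y\<in>set xs. qmul (qadj x) y \<in> set (qball d))"
proof (cases xs)
  case (Cons a ys)
  show ?thesis unfolding tupl_def Cons by (auto simp: set_n_lists)
qed (auto simp: tupl_def)

lemma distinct_tupl: "distinct (tupl P d k)"
  unfolding tupl_def by (intro distinct_filter) (simp add: distinct_map inj_on_def distinct_n_lists)

lemma tupl_mono: "d \<le> e \<Longrightarrow> set (tupl P d k) \<subseteq> set (tupl P e k)"
  using qball_mono[of d e] unfolding subset_iff set_tupl by blast

text \<open>
  Abstracts from matrices: \<open>A\<close> is \<open>GL\<^sub>2(\<rat>)\<close>, \<open>mt\<close> maps a quadruple to its matrix, and \<open>M\<close> is an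
  integral multiple of \<open>g\<close>, which induces the same conjugation.
\<close>

locale coded = group A for A (structure) +
  fixes \<Gamma> g P M mt
  assumes sub: "subgroup \<Gamma> A" and g: "g \<in> carrier A"
    and P_det: "P x \<Longrightarrow> qdet x = 1"
    and mt_inj: "mt x = mt y \<longleftrightarrow> x = y"
    and mt_mult: "mt (qmul x y) = mt x \<otimes> mt y" and mt_one: "mt qone = \<one>"
    and mt_carrier: "qdet x = 1 \<Longrightarrow> mt x \<in> carrier A"
    and P_iff: "qdet x = 1 \<Longrightarrow> P x \<longleftrightarrow> mt x \<in> \<Gamma>"
    and mt_surj: "a \<in> \<Gamma> \<Longrightarrow> \<exists>x. qdet x = 1 \<and> a = mt x"
    and hmem_iff: "qdet x = 1 \<Longrightarrow> hmem P M x \<longleftrightarrow> mt x \<in> \<Gamma> \<inter> (\<lambda>x. g \<otimes> x \<otimes> inv g) ` \<Gamma>"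
    and mt_qconj: "hmem P M x \<Longrightarrow> mt (qconj M x) = inv g \<otimes> mt x \<otimes> g"
begin

abbreviation \<Gamma>' where "\<Gamma>' \<equiv> \<Gamma> \<inter> (\<lambda>x. g \<otimes> x \<otimes> inv g) ` \<Gamma>"
abbreviation H where "H \<equiv> A\<lparr>carrier := \<Gamma>\<rparr>"
abbreviation cj where "cj \<equiv> \<lambda>x. inv g \<otimes> x \<otimes> g"

lemma group_H: "group H"
  by (rule subgroup.subgroup_is_group[OF sub is_group])

sublocale H: group H by (rule group_H)

lemma P_mt: "P x \<Longrightarrow> mt x \<in> \<Gamma>" using P_iff P_det by blast

lemma mt_inv: "qdet x = 1 \<Longrightarrow> inv (mt x) = mt (qadj x)"
  by (rule inv_equality) (simp_all add: mt_carrier mt_one flip: mt_mult)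

lemma inv_H: "x \<in> \<Gamma> \<Longrightarrow> inv\<^bsub>H\<^esub> x = inv x"
  by (rule m_inv_consistent[OF sub])

lemma P_one: "P qone"
  using P_iff[of qone] subgroup.one_closed[OF sub] by (simp add: mt_one)

lemma P_qmul: "P x \<Longrightarrow> P y \<Longrightarrow> P (qmul x y)"
  using P_iff[of "qmul x y"] P_mt[of x] P_mt[of y] P_det[of x] P_det[of y] subgroup.m_closed[OF sub]
  by (simp add: mt_mult)

lemma P_qadj: "P x \<Longrightarrow> P (qadj x)"
  using P_iff[of "qadj x"] P_mt[of x] P_det[of x] subgroup.m_inv_closed[OF sub]
  by (simp flip: mt_inv)

definition qo where "qo y = (THE x. mt x = y)"

lemma qo_mt [simp]: "qo (mt x) = x"
  unfolding qo_def by (rule the_equality) (auto simp: mt_inj)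

lemma \<Gamma>E: assumes "y \<in> \<Gamma>" obtains x where "P x" "y = mt x"
  using mt_surj[OF assms] P_iff assms by metis

lemma \<Gamma>E_list: assumes "set ys \<subseteq> \<Gamma>" obtains xs where "ys = map mt xs" "\<forall>x\<in>set xs. P x"
proof (rule that[of "map qo ys"])
  show "ys = map mt (map qo ys)"
    by (rule nth_equalityI) (use assms in \<open>auto elim!: \<Gamma>E simp: subset_iff dest!: nth_mem\<close>)
  show "\<forall>x\<in>set (map qo ys). P x" using assms by (auto elim!: \<Gamma>E)
qed

definition fam :: "nat \<Rightarrow> 'a list set" where
  "fam d = {xs. set xs \<subseteq> \<Gamma> \<and> (\<forall>x\<in>set xs. \<forall>y\<in>set xs. qmul (qadj (qo x)) (qo y) \<in> set (qball d))}"

text \<open>Required for \<Gamma>' rather than \<Gamma>, so that one radius serves two purposes: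
  \<Gamma> comes within distance \<open>D\<close> of every element, and the ball contains
  representatives of all cosets of \<Gamma>' in \<Gamma>.\<close>

definition covers :: "nat \<Rightarrow> bool" where
  "covers D \<longleftrightarrow> (\<forall>y. qdet y = 1 \<longrightarrow> (\<exists>u\<in>set (qball D). hmem P M (qmul y (qadj u))))"

lemma fam_map_mt: "map mt xs \<in> fam d \<longleftrightarrow> (\<forall>x\<in>set xs. mt x \<in> \<Gamma>) \<and> (\<forall>x\<in>set xs. \<forall>y\<in>set xs. qmul (qadj x) y \<in> set (qball d))"
  by (auto simp: fam_def)

lemma shift_map_mt: "map ((\<otimes>) (mt a)) (map mt xs) = map mt (map (qmul a) xs)"
  by (simp add: mt_mult)

lemma qmul_qadj_cancel: "qdet a = 1 \<Longrightarrow> qmul (qadj (qmul a x)) (qmul a y) = qmul (qadj x) y"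
  by (simp add: qadj_qmul qmul_assoc)

lemma acyclic_fam:
  assumes "covers D" "2 * D + 1 \<le> d" shows "acyclic_family H (fam d)"
proof
  fix xs ys a assume xs: "xs \<in> fam d"
  then show "set xs \<subseteq> carrier H" by (simp add: fam_def)
  show "set ys \<subseteq> set xs \<Longrightarrow> ys \<in> fam d" using xs by (auto simp: fam_def subset_iff)
  assume "a \<in> carrier H"
  then obtain b where b: "P b" "a = mt b" by (auto elim: \<Gamma>E)
  obtain zs where zs: "xs = map mt zs" "\<forall>x\<in>set zs. P x" using xs by (auto simp: fam_def elim: \<Gamma>E_list)
  have *: "map ((\<otimes>\<^bsub>H\<^esub>) a) xs = map mt (map (qmul b) zs)" by (simp add: zs b mt_mult)
  have "map mt (map (qmul b) zs) \<in> fam d"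
    unfolding fam_map_mt
  proof (intro conjI ballI)
    fix x assume "x \<in> set (map (qmul b) zs)"
    then have "x \<in> qmul b ` set zs" by simp
    then show "mt x \<in> \<Gamma>" using P_qmul[OF b(1)] P_mt zs(2) by blast
  next
    fix x y assume "x \<in> set (map (qmul b) zs)" "y \<in> set (map (qmul b) zs)"
    then have "x \<in> qmul b ` set zs" "y \<in> qmul b ` set zs" by simp_all
    then obtain x' y' where "x' \<in> set zs" "x = qmul b x'" "y' \<in> set zs" "y = qmul b y'" by blast
    then show "qmul (qadj x) y \<in> set (qball d)"
      using xs unfolding zs(1) fam_map_mt by (simp add: qmul_qadj_cancel P_det[OF b(1)])
  qed
  then show "map ((\<otimes>\<^bsub>H\<^esub>) a) xs \<in> fam d" by (simp only: *)
next
  show "[] \<in> fam d" by (simp add: fam_def)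
next
  fix c n assume c: "Poly_Mapping.keys c \<subseteq> {xs \<in> fam d. length xs = n}" "Bd c = 0"
  have "\<exists>b. Poly_Mapping.keys b \<subseteq> {xs \<in> {xs. set xs \<subseteq> \<Gamma> \<and> (\<forall>x\<in>set xs. \<forall>y\<in>set xs. qmul (qadj (qo x)) (qo y) \<in> set (qball d))}. length xs = Suc n} \<and> Bd b = c"
  proof (rule acyclic_qball[of \<Gamma> qo \<one> D d c n])
    show "\<one> \<in> \<Gamma>" using subgroup.one_closed[OF sub] .
    show "qo \<one> = qone" using qo_mt[of qone] by (simp only: mt_one)
    show "qdet (qo x) = 1" if "x \<in> \<Gamma>" for x using that P_det by (auto elim!: \<Gamma>E)
    fix y :: quad assume y: "qdet y = 1"
    obtain u where u: "u \<in> set (qball D)" "hmem P M (qmul y (qadj u))"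
      using assms(1) y unfolding covers_def by blast
    have "P (qmul y (qadj u))" using u(2) by (simp add: hmem_def)
    moreover have "qmul (qadj (qmul y (qadj u))) y = u"
      using y qdet_qball[OF u(1)] by (simp add: qadj_qmul qmul_assoc)
    ultimately show "\<exists>x\<in>\<Gamma>. qmul (qadj (qo x)) y \<in> set (qball D)"
      using u(1) P_mt by (intro bexI[of _ "mt (qmul y (qadj u))"]) simp_all
  qed (use assms(2) c in \<open>auto simp: fam_def\<close>)
  then show "\<exists>b. Poly_Mapping.keys b \<subseteq> {xs \<in> fam d. length xs = Suc n} \<and> Bd b = c"
    by (simp only: fam_def)
qed

lemma tupl_P: "xs \<in> set (tupl P d k) \<Longrightarrow> x \<in> set xs \<Longrightarrow> P x"
  unfolding set_tupl using P_one by (cases xs) auto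

lemma tupl_fam: "xs \<in> set (tupl P d k) \<Longrightarrow> map mt xs \<in> fam d"
  using tupl_P[of xs d k] P_mt unfolding fam_map_mt set_tupl by blast

lemma tupl_tuples: "xs \<in> set (tupl P d k) \<Longrightarrow> map mt xs \<in> tuples H (Suc k)"
  using tupl_P[of xs d k] P_mt by (auto simp: tuples_def set_tupl)

lemma qnorm_tupl:
  assumes "xs \<noteq> []" "\<forall>x\<in>set xs. P x" "\<forall>x\<in>set xs. \<forall>y\<in>set xs. qmul (qadj x) y \<in> set (qball d)"
  shows "qnorm xs \<in> set (tupl P d (length xs - 1))"
proof -
  obtain a ys where xs: "xs = a # ys" using assms(1) by (cases xs) auto
  have a: "P a" "qdet a = 1" using assms(2) P_det by (auto simp: xs)
  have q: "qnorm xs = qone # map (qmul (qadj a)) ys" using a by (simp add: qnorm_def xs)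
  show ?thesis unfolding set_tupl
  proof (intro conjI ballI)
    fix x assume "x \<in> set (tl (qnorm xs))"
    then have "x \<in> qmul (qadj a) ` set ys" by (simp add: q)
    then obtain y where y: "y \<in> set ys" "x = qmul (qadj a) y" by blast
    then have "P y" using assms(2) by (simp add: xs)
    then show "P x" unfolding y(2) by (rule P_qmul[OF P_qadj[OF a(1)]])
    show "x \<in> set (qball d)" using assms(3) y by (simp add: xs)
  next
    fix x y assume "x \<in> set (qnorm xs)" "y \<in> set (qnorm xs)"
    then have "x \<in> qmul (qadj a) ` set xs" "y \<in> qmul (qadj a) ` set xs" by (simp_all add: qnorm_def xs)
    then obtain x' y' where "x' \<in> set xs" "x = qmul (qadj a) x'" "y' \<in> set xs" "y = qmul (qadj a) y'"
      by blast
    then show "qmul (qadj x) y \<in> set (qball d)" using a assms(3) by (simp add: qmul_qadj_cancel)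
  qed (simp_all add: q, simp add: xs)
qed

lemma qnorm_shift: "qdet a = 1 \<Longrightarrow> qnorm (map (qmul a) xs) = qnorm xs"
  unfolding qnorm_def by (cases xs) (auto simp: qmul_qadj_cancel)

lemma qnorm_id: "xs \<in> set (tupl P d k) \<Longrightarrow> qnorm xs = xs"
  unfolding set_tupl qnorm_def by (cases xs) (auto simp: intro: map_idI)

lemma map_qnorm: "xs \<noteq> [] \<Longrightarrow> \<forall>x\<in>set xs. P x \<Longrightarrow> map (qmul (lhd xs)) (qnorm xs) = xs"
  unfolding qnorm_def by (cases xs) (simp_all add: P_det o_def)

lemma cochain_qnorm:
  assumes "F \<in> carrier (cochains H k)" "length xs = Suc k" "\<forall>x\<in>set xs. P x"
  shows "F (map mt (qnorm xs)) = F (map mt xs)"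
proof -
  have ne: "xs \<noteq> []" using assms(2) by auto
  then have P: "P (lhd xs)" using assms(3) by (cases xs) auto
  have "\<forall>x\<in>set (qnorm xs). P x" using assms(3) P P_qadj P_qmul by (auto simp: qnorm_def)
  then have "\<forall>x\<in>set (qnorm xs). mt x \<in> \<Gamma>" using P_mt by blast
  moreover have "length (qnorm xs) = Suc k" using assms(2) by (simp add: qnorm_def)
  ultimately have "map mt (qnorm xs) \<in> tuples H (Suc k)" by (simp add: tuples_def image_subset_iff)
  then have "F (map ((\<otimes>\<^bsub>H\<^esub>) (mt (lhd xs))) (map mt (qnorm xs))) = F (map mt (qnorm xs))"
    using assms(1) P_mt[OF P] by (simp add: carrier_cochains del: map_map)
  moreover have "map ((\<otimes>\<^bsub>H\<^esub>) (mt (lhd xs))) (map mt (qnorm xs)) = map mt xs"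
    using shift_map_mt[of "lhd xs" "qnorm xs"] map_qnorm[OF ne assms(3)] by simp
  ultimately show ?thesis by (simp del: map_map)
qed

lemma face_tupl:
  assumes "y \<in> set (tupl P d (Suc k))" "j < length y"
  shows "qnorm (take j y @ drop (Suc j) y) \<in> set (tupl P d k)"
proof -
  let ?f = "take j y @ drop (Suc j) y"
  have y: "length y = Suc (Suc k)" "\<forall>x\<in>set y. P x" "\<forall>x\<in>set y. \<forall>x'\<in>set y. qmul (qadj x) x' \<in> set (qball d)"
    using assms(1) tupl_P by (auto simp: set_tupl)
  have len: "length ?f = Suc k" using y(1) assms(2) by auto
  have "set ?f \<subseteq> set y" using set_take_subset[of j y] set_drop_subset[of "Suc j" y] by auto
  then have "\<forall>x\<in>set ?f. P x" "\<forall>x\<in>set ?f. \<forall>x'\<in>set ?f. qmul (qadj x) x' \<in> set (qball d)"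
    using y(2,3) by blast+
  moreover have "?f \<noteq> []" using len by force
  ultimately have "qnorm ?f \<in> set (tupl P d (length ?f - 1))" by (intro qnorm_tupl)
  then show ?thesis by (simp only: len diff_Suc_1)
qed

text \<open>The coboundary is linear in \<open>z\<close>, so its matrix entries are its values on
  indicators. Several faces of \<open>y\<close> may have the same normal form, and their signs then
  add up in one entry.\<close>

lemma cob_matrix:
  assumes y: "y \<in> set (tupl P d (Suc k))"
  shows "cob z y = (\<Sum>b\<in>set (tupl P d k). cob [(b, 1)] y * val z b)"
proof -
  have "(\<Sum>b\<in>set (tupl P d k). cob [(b, 1)] y * val z b) =
    (\<Sum>j<length y. (if even j then 1 else - 1) * (\<Sum>b\<in>set (tupl P d k).
       (if b = qnorm (take j y @ drop (Suc j) y) then val z b else 0)))"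
    unfolding cob_def interv_sum_list_conv_sum_set_nat atLeast0LessThan sum_distrib_right sum_distrib_left set_upt
    by (subst sum.swap) (intro sum.cong refl, auto)
  also have "\<dots> = (\<Sum>j<length y. (if even j then 1 else - 1) * val z (qnorm (take j y @ drop (Suc j) y)))"
    using face_tupl[OF y] by (intro sum.cong refl) (simp add: sum.delta)
  finally show ?thesis by (simp add: cob_def interv_sum_list_conv_sum_set_nat atLeast0LessThan)
qed

lemma ev_bd_tupl:
  assumes F: "F \<in> carrier (cochains H k)" and y: "y \<in> set (tupl P d (Suc k))"
  shows "ev F (bd (map mt y)) = (\<Sum>b\<in>set (tupl P d k). cob [(b, 1)] y * F (map mt b))"
proof -
  have face: "F (map mt (take j y @ drop (Suc j) y)) = F (map mt (qnorm (take j y @ drop (Suc j) y)))"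
    if "j < length y" for j
  proof (rule cochain_qnorm[OF F, symmetric])
    show "length (take j y @ drop (Suc j) y) = Suc k" using y that by (auto simp: set_tupl)
    show "\<forall>x\<in>set (take j y @ drop (Suc j) y). P x"
      using tupl_P[OF y] set_take_subset[of j y] set_drop_subset[of "Suc j" y] by auto
  qed
  have "(\<Sum>b\<in>set (tupl P d k). cob [(b, 1)] y * F (map mt b)) =
    (\<Sum>j<length y. (if even j then 1 else - 1) * (\<Sum>b\<in>set (tupl P d k).
       (if b = qnorm (take j y @ drop (Suc j) y) then F (map mt b) else 0)))"
    unfolding cob_def interv_sum_list_conv_sum_set_nat atLeast0LessThan sum_distrib_right sum_distrib_left set_upt
    by (subst sum.swap) (intro sum.cong refl, auto)
  also have "\<dots> = (\<Sum>j<length y. (if even j then 1 else - 1) * F (map mt (take j y @ drop (Suc j) y)))"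
    using face_tupl[OF y] face by (intro sum.cong refl) (simp add: sum.delta)
  also have "\<dots> = ev F (bd (map mt y))"
    unfolding ev_bd by (intro sum.cong) (auto simp: take_map drop_map)
  finally show ?thesis by simp
qed

lemma fam_tupl:
  assumes "ys \<in> fam d" "length ys = Suc k"
  obtains xs where "ys = map mt xs" "\<forall>x\<in>set xs. P x" "length xs = Suc k" "qnorm xs \<in> set (tupl P d k)"
proof -
  obtain xs where xs: "ys = map mt xs" "\<forall>x\<in>set xs. P x" using assms by (auto simp: fam_def elim: \<Gamma>E_list)
  moreover have "length xs = Suc k" using xs assms(2) by simp
  moreover have "qnorm xs \<in> set (tupl P d (length xs - 1))"
    using assms(1) xs calculation(3) unfolding xs(1) fam_map_mt by (intro qnorm_tupl) auto
  ultimately show ?thesis using that by simp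
qed

lemma vanish:
  assumes "covers D" "2 * D + 1 \<le> d" and F: "F \<in> cocycles H m"
    and 0: "\<And>b. b \<in> set (tupl P d m) \<Longrightarrow> F (map mt b) = 0"
  shows "F \<in> coboundaries H m"
proof -
  interpret acyclic_family H "fam d" by (rule acyclic_fam[OF assms(1,2)])
  show ?thesis
  proof (rule cocycle_vanishing_on_E[OF F])
    fix ys assume "ys \<in> fam d" "length ys = Suc m"
    then obtain xs where xs: "ys = map mt xs" "\<forall>x\<in>set xs. P x" "length xs = Suc m" "qnorm xs \<in> set (tupl P d m)"
      by (rule fam_tupl)
    then show "F ys = 0" using 0[OF xs(4)] cochain_qnorm[of F m xs] F by (simp add: cocycles_iff)
  qed
qed

text \<open>Spread along orbits by \<open>qnorm\<close>, the list becomes an invariant function on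
  the whole family. Normalizing commutes with taking faces up to translation, so the cocycle
  condition on all tuples reduces to the finitely many representatives.\<close>

lemma extend:
  assumes "covers D" "2 * D + 1 \<le> d" and z: "\<And>y. y \<in> set (tupl P d (Suc m)) \<Longrightarrow> cob z y = 0"
  shows "\<exists>F\<in>cocycles H m. \<forall>b\<in>set (tupl P d m). F (map mt b) = val z b"
proof -
  interpret acyclic_family H "fam d" by (rule acyclic_fam[OF assms(1,2)])
  define f where "f ys = val z (qnorm (map qo ys))" for ys
  have f: "f (map mt xs) = val z (qnorm xs)" for xs by (simp add: f_def o_def)
  have "\<exists>F\<in>cocycles H m. \<forall>xs\<in>fam d. length xs = Suc m \<longrightarrow> F xs = f xs"
  proof (rule extend_cocycle)
    fix a ys assume "a \<in> carrier H" "ys \<in> fam d" "length ys = Suc m"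
    then obtain b xs where "P b" "a = mt b" "ys = map mt xs" by (auto elim!: \<Gamma>E fam_tupl)
    moreover from this have "map ((\<otimes>\<^bsub>H\<^esub>) a) ys = map mt (map (qmul b) xs)" by (simp add: mt_mult)
    ultimately show "f (map ((\<otimes>\<^bsub>H\<^esub>) a) ys) = f ys" by (simp only: f qnorm_shift P_det)
  next
    fix ys assume "ys \<in> fam d" "length ys = Suc (Suc m)"
    then obtain xs where xs: "ys = map mt xs" "\<forall>x\<in>set xs. P x" "length xs = Suc (Suc m)" "qnorm xs \<in> set (tupl P d (Suc m))"
      by (rule fam_tupl)
    have "xs \<noteq> []" using xs(3) by auto
    then have "P (lhd xs)" using xs(2) by (cases xs) auto
    then have det: "qdet (qadj (lhd xs)) = 1" using P_det by simp
    have "ev f (bd ys) = (\<Sum>j<length xs. (- 1) ^ j * val z (qnorm (take j xs @ drop (Suc j) xs)))"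
      unfolding ev_bd xs(1) by (simp add: f take_map drop_map flip: map_append)
    also have "\<dots> = (\<Sum>j<length xs. (- 1) ^ j * val z (qnorm (take j (qnorm xs) @ drop (Suc j) (qnorm xs))))"
      using qnorm_shift[OF det] by (simp add: qnorm_def[of xs] take_map drop_map flip: map_append)
    also have "\<dots> = cob z (qnorm xs)"
      unfolding cob_def interv_sum_list_conv_sum_set_nat atLeast0LessThan set_upt
      by (rule sum.cong) (auto simp: qnorm_def[of xs])
    finally show "ev f (bd ys) = 0" using z[OF xs(4)] by simp
  qed
  then obtain F where F: "F \<in> cocycles H m" "\<And>xs. xs \<in> fam d \<Longrightarrow> length xs = Suc m \<Longrightarrow> F xs = f xs" by blast
  have "F (map mt b) = val z b" if b: "b \<in> set (tupl P d m)" for b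
    using F(2)[OF tupl_fam[OF b]] b qnorm_id[OF b] by (simp add: f set_tupl)
  then show ?thesis using F(1) by blast
qed

end

section \<open>Presented abelian groups\<close>

lemma keys_row_vector: "Poly_Mapping.keys (row_vector r) \<subseteq> {..<length r}"
  unfolding row_vector_def using keys_sum[of "\<lambda>i. frag_cmul (r ! i) (frag_of i)" "{..<length r}"]
  by (fastforce simp: subset_iff)

lemma lookup_row_vector: "Poly_Mapping.lookup (row_vector r) i = (if i < length r then r ! i else 0)"
  by (simp add: row_vector_def lookup_sum_frag lookup_single if_distrib[of "\<lambda>u. _ * u"] cong: if_cong)

lemma subgroup_relation_subgroup:
  assumes "integer_matrix n rels" shows "subgroup (relation_subgroup n rels) (free_Abelian_group {..<n})"
  unfolding relation_subgroup_def
proof (rule group.generate_is_subgroup[OF group_free_Abelian_group])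
  show "row_vector ` set rels \<subseteq> carrier (free_Abelian_group {..<n})"
    using assms keys_row_vector unfolding integer_matrix_def by fastforce
qed

lemma row_combination_in_relation_subgroup:
  assumes "integer_matrix n rels" "\<And>k. k \<in> K \<Longrightarrow> k < length rels"
  shows "(\<Sum>k\<in>K. frag_cmul (u k) (row_vector (rels ! k))) \<in> relation_subgroup n rels"
  using assms(2)
proof (induction K rule: infinite_finite_induct)
  case (insert k K)
  let ?F = "free_Abelian_group {..<n}"
  have r: "rels ! k \<in> set rels" using insert by simp
  then have "Poly_Mapping.keys (row_vector (rels ! k)) \<subseteq> {..<n}"
    using assms(1) keys_row_vector unfolding integer_matrix_def by fastforce
  moreover have "row_vector (rels ! k) \<in> relation_subgroup n rels"
    unfolding relation_subgroup_def using r by (intro generate.incl) simp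
  ultimately have "frag_cmul (u k) (row_vector (rels ! k)) \<in> relation_subgroup n rels"
    using group.int_pow_closed[OF subgroup.subgroup_is_group[OF subgroup_relation_subgroup[OF assms(1)] group_free_Abelian_group], of "row_vector (rels ! k)" "u k"]
      group.subgroup_int_pow_closed[OF group_free_Abelian_group subgroup_relation_subgroup[OF assms(1)], of "row_vector (rels ! k)" "u k"]
    by simp
  then show ?case
    using insert subgroup.m_closed[OF subgroup_relation_subgroup[OF assms(1)]] by simp
qed (use subgroup.one_closed[OF subgroup_relation_subgroup[OF assms(1)]] in simp_all)

text \<open>The isomorphism theorem applied to \<open>h\<close>; \<tau> is \<open>T\<close> carried
  over by the resulting isomorphism, and \<open>Th\<close> identifies its matrix.\<close>

lemma presentation_of_endomorphism:
  assumes C: "group C" and rels: "integer_matrix n rels"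
    and B: "integer_matrix n B" "length B = n"
    and h: "h \<in> hom (free_Abelian_group {..<n}) C" "h ` carrier (free_Abelian_group {..<n}) = carrier C"
    and ker: "\<And>v. Poly_Mapping.keys v \<subseteq> {..<n} \<Longrightarrow> h v = \<one>\<^bsub>C\<^esub> \<longleftrightarrow> v \<in> relation_subgroup n rels"
    and T: "T \<in> hom C C"
    and Th: "\<And>v. Poly_Mapping.keys v \<subseteq> {..<n} \<Longrightarrow> T (h v) = h (frag_extend (\<lambda>i. row_vector (B ! i)) v)"
  shows "\<exists>\<tau>. describes_endomorphism n rels B \<tau> \<and>
         (\<exists>\<phi> \<in> iso (presented_group n rels) C. \<forall>x\<in>carrier (presented_group n rels). \<phi> (\<tau> x) = T (\<phi> x))"
proof -
  let ?F = "free_Abelian_group {..<n}" and ?R = "relation_subgroup n rels"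
  interpret h: group_hom ?F C h
    using C h(1) by (simp add: group_hom_def group_hom_axioms_def)
  note R = subgroup_relation_subgroup[OF rels]
  have "v \<in> ?R \<Longrightarrow> v \<in> carrier ?F" for v using subgroup.subset[OF R] by blast
  then have kernel: "kernel ?F C h = ?R"
    using ker unfolding kernel_def carrier_free_Abelian_group_iff by blast
  define \<phi> where "\<phi> X = the_elem (h ` X)" for X
  have iso: "\<phi> \<in> iso (presented_group n rels) C"
    using h.FactGroup_iso_set[OF h(2)] unfolding presented_group_def kernel \<phi>_def[abs_def] .
  have coset: "\<phi> (?R #>\<^bsub>?F\<^esub> v) = h v" if "v \<in> carrier ?F" for v
  proof -
    have "h ` (?R #>\<^bsub>?F\<^esub> v) = {h v}"
    proof
      show "h ` (?R #>\<^bsub>?F\<^esub> v) \<subseteq> {h v}"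
      proof
        fix x assume "x \<in> h ` (?R #>\<^bsub>?F\<^esub> v)"
        then obtain r where r: "r \<in> ?R" "x = h (r \<otimes>\<^bsub>?F\<^esub> v)" by (auto simp: r_coset_def)
        have "r \<in> carrier ?F" using r(1) subgroup.subset[OF R] by blast
        then have "x = h r \<otimes>\<^bsub>C\<^esub> h v" using r(2) h.hom_mult that by blast
        moreover have "h r = \<one>\<^bsub>C\<^esub>" using ker[of r] r(1) \<open>r \<in> carrier ?F\<close> by simp
        ultimately show "x \<in> {h v}" using h.hom_closed[OF that] by simp
      qed
      have "v \<in> ?R #>\<^bsub>?F\<^esub> v"
        using group.rcos_self[OF group_free_Abelian_group that R] .
      then show "{h v} \<subseteq> h ` (?R #>\<^bsub>?F\<^esub> v)" by blast
    qed
    then show ?thesis by (simp add: \<phi>_def)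
  qed
  have cosetE: "\<exists>v\<in>carrier ?F. X = ?R #>\<^bsub>?F\<^esub> v" if "X \<in> carrier (presented_group n rels)" for X
    using that by (auto simp: presented_group_def FactGroup_def RCOSETS_def)
  have coset_mem: "?R #>\<^bsub>?F\<^esub> v \<in> carrier (presented_group n rels)" if "v \<in> carrier ?F" for v
    using that unfolding presented_group_def FactGroup_def RCOSETS_def partial_object.simps by blast
  have bij: "bij_betw \<phi> (carrier (presented_group n rels)) (carrier C)"
    and hom: "\<phi> \<in> hom (presented_group n rels) C"
    using iso by (auto simp: iso_def)
  have grp: "group (presented_group n rels)"
    unfolding presented_group_def
    by (rule normal.factorgroup_is_group[OF comm_group.subgroup_imp_normal[OF abelian_free_Abelian_group R]])
  define \<psi> where "\<psi> = inv_into (carrier (presented_group n rels)) \<phi>"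
  have \<psi>: "\<psi> \<in> iso C (presented_group n rels)"
    unfolding \<psi>_def using group.iso_set_sym[OF grp iso] .
  have \<psi>\<phi>: "\<psi> (\<phi> X) = X" if "X \<in> carrier (presented_group n rels)" for X
    using bij_betw_inv_into_left[OF bij that] by (simp add: \<psi>_def)
  have \<phi>\<psi>: "\<phi> (\<psi> y) = y" if "y \<in> carrier C" for y
    using bij_betw_inv_into_right[OF bij that] by (simp add: \<psi>_def)
  define \<tau> where "\<tau> X = \<psi> (T (\<phi> X))" for X
  have "\<tau> \<in> hom (presented_group n rels) (presented_group n rels)"
    using hom_compose[OF hom_compose[OF hom T], of \<psi> "presented_group n rels"] \<psi>
    by (simp add: iso_def o_def \<tau>_def[abs_def])
  moreover have "\<tau> (?R #>\<^bsub>?F\<^esub> v) = ?R #>\<^bsub>?F\<^esub> frag_extend (\<lambda>i. row_vector (B ! i)) v" if v: "v \<in> carrier ?F" for v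
  proof -
    have "Poly_Mapping.keys (frag_extend (\<lambda>i. row_vector (B ! i)) v) \<subseteq> {..<n}"
    proof (rule keys_frag_extend_subset)
      fix i assume "i \<in> Poly_Mapping.keys v"
      then have "i < n" using v by auto
      then have "length (B ! i) = n" using B by (simp add: integer_matrix_def)
      then show "Poly_Mapping.keys (row_vector (B ! i)) \<subseteq> {..<n}" using keys_row_vector[of "B ! i"] by simp
    qed
    then have Bv: "frag_extend (\<lambda>i. row_vector (B ! i)) v \<in> carrier ?F" by simp
    have "\<tau> (?R #>\<^bsub>?F\<^esub> v) = \<psi> (\<phi> (?R #>\<^bsub>?F\<^esub> frag_extend (\<lambda>i. row_vector (B ! i)) v))"
      unfolding \<tau>_def coset[OF v] coset[OF Bv] using Th v by simp
    then show ?thesis using \<psi>\<phi>[OF coset_mem[OF Bv]] by simp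
  qed
  ultimately have "describes_endomorphism n rels B \<tau>"
    using B by (simp add: describes_endomorphism_def)
  moreover have "\<phi> (\<tau> x) = T (\<phi> x)" if "x \<in> carrier (presented_group n rels)" for x
    unfolding \<tau>_def using that hom T by (intro \<phi>\<psi>) (auto simp: hom_def)
  ultimately show ?thesis using iso by blast
qed

text \<open>The tuples whose indicators give the relators. In degree 0 the list is empty, since only
  the zero cochain is a coboundary there; \<open>m - 1\<close> alone would not tell degrees 0 and 1
  apart.\<close>

definition prev :: "(quad \<Rightarrow> bool) \<Rightarrow> nat \<Rightarrow> nat \<Rightarrow> quad list list" where
  "prev P d m = (if m = 0 then [] else tupl P d (m - 1))"

type_synonym cochain_list = "(quad list \<times> int) list"

text \<open>
  The first condition makes \<open>ball D\<close> contain a full set of coset representatives, by induction on the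
  radius. The cochains \<open>zs\<close>, \<open>ws\<close>, \<open>L\<close>, \<open>c\<close> form a \<open>kernel_data\<close> for the cocycles on tuples of size \<open>d\<close>.
  The relators express coboundaries of indicators in the basis \<open>zs\<close>. The Hecke operator is
  compared only on tuples of size \<open>2 D + 1\<close>, which suffices to determine a class; \<open>d\<close> has to be
  large enough for the images of these tuples.
\<close>

definition cert :: "(quad \<Rightarrow> bool) \<Rightarrow> quad \<Rightarrow> nat \<Rightarrow> nat \<Rightarrow> int list list \<Rightarrow> int list list \<Rightarrow> nat \<Rightarrow> nat \<Rightarrow>
    cochain_list list \<Rightarrow> cochain_list list \<Rightarrow> ((quad list \<times> quad list) \<times> int) list \<Rightarrow> int \<Rightarrow> bool" where
  "cert P M m n rels B D d zs ws L c \<longleftrightarrow>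
     (\<forall>s\<in>set (qball (Suc D)). \<exists>u\<in>set (qball D). hmem P M (qmul s (qadj u))) \<and>
     2 * D + 1 \<le> d \<and> length zs = n \<and> length ws = n \<and> c \<noteq> 0 \<and>
     (\<forall>i\<in>set [0..<n]. \<forall>j\<in>set [0..<n].
       sum_list (map (\<lambda>a. val (lnth ws i) a * val (lnth zs j) a) (tupl P d m)) = (if i = j then 1 else 0)) \<and>
     (\<forall>j\<in>set [0..<n]. \<forall>y\<in>set (tupl P d (Suc m)). cob (lnth zs j) y = 0) \<and>
     (\<forall>a\<in>set (tupl P d m). \<forall>b\<in>set (tupl P d m).
       c * ((if a = b then 1 else 0) - sum_list (map (\<lambda>i. val (lnth zs i) a * val (lnth ws i) b) [0..<n]))
         = sum_list (map (\<lambda>y. val L (a, y) * cob [(b, 1)] y) (tupl P d (Suc m)))) \<and>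
     length rels = length (prev P d m) \<and> (\<forall>r\<in>set rels. length r = n) \<and>
     (\<forall>k\<in>set [0..<length rels]. \<forall>a\<in>set (tupl P d m).
       sum_list (map (\<lambda>i. lnth (lnth rels k) i * val (lnth zs i) a) [0..<n]) = cob [(lnth (prev P d m) k, 1)] a) \<and>
     length B = n \<and> (\<forall>r\<in>set B. length r = n) \<and>
     (\<forall>xs\<in>set (tupl P (2 * D + 1) m). \<forall>r\<in>set (hreps P M D).
       qnorm (map (hact P M D r) xs) \<in> set (tupl P d m)) \<and>
     (\<forall>i\<in>set [0..<n]. \<forall>xs\<in>set (tupl P (2 * D + 1) m).
       heckev P M D (lnth zs i) xs = sum_list (map (\<lambda>j. lnth (lnth B i) j * val (lnth zs j) xs) [0..<n]))"

section \<open>Coset representatives inside a ball\<close>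

context coded begin

lemma sub_\<Gamma>': "subgroup \<Gamma>' A" by (rule subgroup_hecke(1)[OF sub g])

lemma hmem_P: "hmem P M x \<Longrightarrow> P x" by (simp add: hmem_def)

lemma hmem_mult: "hmem P M x \<Longrightarrow> hmem P M y \<Longrightarrow> hmem P M (qmul x y)"
  using hmem_iff[of "qmul x y"] hmem_iff[of x] hmem_iff[of y] hmem_P[THEN P_det] subgroup.m_closed[OF sub_\<Gamma>']
  by (simp add: mt_mult)

lemma hmem_qadj: "hmem P M x \<Longrightarrow> hmem P M (qadj x)"
  using hmem_iff[of "qadj x"] hmem_iff[of x] hmem_P[THEN P_det] subgroup.m_inv_closed[OF sub_\<Gamma>']
  by (simp flip: mt_inv)

lemma hmem_one: "hmem P M qone"
  using hmem_iff[of qone] subgroup.one_closed[OF sub_\<Gamma>'] by (simp add: mt_one)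

text \<open>A finite check that entails an infinite statement. If y arises from b by crossing one
  edge and b is u up to a factor in \<Gamma>', with u in the ball, then y is, up to that factor, one
  edge beyond u, hence in the ball of radius D + 1 that the check covers.\<close>

lemma covers_step:
  assumes "\<forall>s\<in>set (qball (Suc D)). \<exists>u\<in>set (qball D). hmem P M (qmul s (qadj u))"
  shows "covers D"
proof -
  have "\<exists>u\<in>set (qball D). hmem P M (qmul y (qadj u))" if "y \<in> set (qball n)" for y n
    using that
  proof (induction n arbitrary: y)
    case 0
    then have "y \<in> set (qball D)" using qball_mono[of 0 D] by auto
    then show ?case using qdet_qball[OF 0] hmem_one by (intro bexI[of _ y]) simp_all
  next
    case (Suc n)
    from Suc.prems consider "y \<in> set (qball n)"
      | b h where "b \<in> set (qball n)" "h \<in> set qH" "y = qmul (qmul b qS) h"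
      unfolding qball_Suc by blast
    then show ?case
    proof cases
      case 2
      from Suc.IH[OF 2(1)] obtain u where u: "u \<in> set (qball D)" "hmem P M (qmul b (qadj u))" by blast
      from qball_S[OF u(1) 2(2)] assms obtain v where
        v: "v \<in> set (qball D)" "hmem P M (qmul (qmul u (qmul qS h)) (qadj v))" by blast
      have "qmul y (qadj v) = qmul (qmul b (qadj u)) (qmul (qmul u (qmul qS h)) (qadj v))"
        using qdet_qball[OF u(1)] by (simp add: 2(3) qmul_assoc)
      then show ?thesis using hmem_mult[OF u(2) v(2)] v(1) by (intro bexI[of _ v]) simp_all
    qed (rule Suc.IH)
  qed
  then show ?thesis unfolding covers_def using qball_covers by blast
qed

context
  fixes D assumes D: "covers D"
begin

lemma hrep:
  assumes x: "P x"
  shows "P (hrep P M D x)" "hmem P M (qmul x (qadj (hrep P M D x)))" "hrep P M D x \<in> set (qball D)"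
proof -
  let ?f = "filter (\<lambda>u. P u \<and> hmem P M (qmul x (qadj u))) (qball D)"
  obtain u where u: "u \<in> set (qball D)" "hmem P M (qmul x (qadj u))"
    using D P_det[OF x] unfolding covers_def by blast
  have "qmul (qadj (qmul x (qadj u))) x = u"
    using P_det[OF x] qdet_qball[OF u(1)] by (simp add: qadj_qmul qmul_assoc)
  then have "P u" using P_qmul[OF P_qadj[OF hmem_P[OF u(2)]] x] by simp
  then have "u \<in> set ?f" using u by simp
  then have "?f \<noteq> []" by (metis empty_iff empty_set)
  then have "lhd ?f \<in> set ?f" unfolding lhd_eq_hd[OF \<open>?f \<noteq> []\<close>] by (rule hd_in_set)
  then show "P (hrep P M D x)" "hmem P M (qmul x (qadj (hrep P M D x)))" "hrep P M D x \<in> set (qball D)"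
    unfolding hrep_def by simp_all
qed

lemma hrep_hmem: assumes "hmem P M v" shows "hrep P M D (qmul v x) = hrep P M D x"
proof -
  have "hmem P M (qmul (qmul v x) (qadj u)) \<longleftrightarrow> hmem P M (qmul x (qadj u))" for u
    using hmem_mult[OF assms, of "qmul x (qadj u)"] hmem_mult[OF hmem_qadj[OF assms], of "qmul (qmul v x) (qadj u)"]
      P_det[OF hmem_P[OF assms]]
    by (auto simp: qmul_assoc)
  then show ?thesis by (simp add: hrep_def)
qed

lemma hrep_hrep: assumes "P x" shows "hrep P M D (hrep P M D x) = hrep P M D x"
proof -
  have "qmul (qmul x (qadj (hrep P M D x))) (hrep P M D x) = x"
    using P_det[OF hrep(1)[OF assms]] by (simp add: qmul_assoc)
  then show ?thesis using hrep_hmem[OF hrep(2)[OF assms], of "hrep P M D x"] by simp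
qed

lemma set_hreps: "set (hreps P M D) = hrep P M D ` Collect P"
proof
  show "set (hreps P M D) \<subseteq> hrep P M D ` Collect P"
  proof
    fix u assume "u \<in> set (hreps P M D)"
    then have "P u" "hrep P M D u = u" by (simp_all add: hreps_def)
    then show "u \<in> hrep P M D ` Collect P" by (metis imageI mem_Collect_eq)
  qed
  show "hrep P M D ` Collect P \<subseteq> set (hreps P M D)"
  proof
    fix u assume "u \<in> hrep P M D ` Collect P"
    then obtain x where "P x" "u = hrep P M D x" by blast
    then show "u \<in> set (hreps P M D)" using hrep hrep_hrep by (simp add: hreps_def)
  qed
qed

definition \<rho> where "\<rho> y = mt (hrep P M D (qo y))"

lemma rho_image: "\<rho> ` carrier H = mt ` set (hreps P M D)"
proof -
  have "\<Gamma> = mt ` Collect P" using P_mt by (auto elim!: \<Gamma>E)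
  then show ?thesis unfolding set_hreps by (simp add: \<rho>_def image_image)
qed

lemma transversal_rho: "transversal H \<Gamma>' \<rho>"
  unfolding transversal_def
proof (intro conjI ballI)
  show "finite (\<rho> ` carrier H)" unfolding rho_image by simp
  fix y assume "y \<in> carrier H"
  then obtain x where x: "P x" "y = mt x" by (auto elim: \<Gamma>E)
  show r: "\<rho> y \<in> carrier H" using P_mt[OF hrep(1)[OF x(1)]] by (simp add: \<rho>_def x)
  have "inv\<^bsub>H\<^esub> \<rho> y = mt (qadj (hrep P M D x))"
    using r mt_inv[OF P_det[OF hrep(1)[OF x(1)]]] inv_H[of "\<rho> y"] by (simp add: \<rho>_def x)
  then have "y \<otimes>\<^bsub>H\<^esub> inv\<^bsub>H\<^esub> \<rho> y = mt (qmul x (qadj (hrep P M D x)))" by (simp add: x mt_mult)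
  then show "y \<otimes>\<^bsub>H\<^esub> inv\<^bsub>H\<^esub> \<rho> y \<in> \<Gamma>'"
    using hrep(2)[OF x(1)] hmem_iff hmem_P[THEN P_det] by metis
  fix u assume u: "u \<in> \<Gamma>'"
  then obtain v where v: "P v" "u = mt v" by (auto elim: \<Gamma>E)
  then have "hmem P M v" using u hmem_iff[OF P_det[OF v(1)]] by simp
  then show "\<rho> (u \<otimes>\<^bsub>H\<^esub> y) = \<rho> y" by (simp add: \<rho>_def x v hrep_hmem flip: mt_mult)
qed

lemma key_mt:
  assumes "P r" "P x"
  shows "cj (mt r \<otimes>\<^bsub>H\<^esub> mt x \<otimes>\<^bsub>H\<^esub> inv\<^bsub>H\<^esub> \<rho> (mt r \<otimes>\<^bsub>H\<^esub> mt x)) = mt (hact P M D r x)" and "P (hact P M D r x)"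
proof -
  let ?y = "qmul r x" and ?h = "hrep P M D (qmul r x)"
  have y: "P ?y" using assms by (rule P_qmul)
  have "\<rho> (mt r \<otimes>\<^bsub>H\<^esub> mt x) = mt ?h" by (simp add: \<rho>_def flip: mt_mult)
  then have "mt r \<otimes>\<^bsub>H\<^esub> mt x \<otimes>\<^bsub>H\<^esub> inv\<^bsub>H\<^esub> \<rho> (mt r \<otimes>\<^bsub>H\<^esub> mt x) = mt (qmul ?y (qadj ?h))"
    using inv_H[OF P_mt[OF hrep(1)[OF y]]] mt_inv[OF P_det[OF hrep(1)[OF y]]] by (simp add: mt_mult)
  then show "cj (mt r \<otimes>\<^bsub>H\<^esub> mt x \<otimes>\<^bsub>H\<^esub> inv\<^bsub>H\<^esub> \<rho> (mt r \<otimes>\<^bsub>H\<^esub> mt x)) = mt (hact P M D r x)"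
    using mt_qconj[OF hrep(2)[OF y]] by (simp add: hact_def)
  show "P (hact P M D r x)" using hrep(2)[OF y] by (simp add: hact_def hmem_def)
qed

text \<open>A stored cochain knows \<open>F\<close> only at scale \<open>d\<close>, whence the
  condition that every summand of the transfer stays within that scale.\<close>

lemma transfer_eval:
  assumes F: "F \<in> carrier (cochains H m)" and z: "\<And>b. b \<in> set (tupl P d m) \<Longrightarrow> F (map mt b) = val z b"
    and xs: "xs \<in> set (tupl P e m)"
    and r: "\<And>r. r \<in> set (hreps P M D) \<Longrightarrow> qnorm (map (hact P M D r) xs) \<in> set (tupl P d m)"
  shows "twisted_transfer H cj \<rho> m F (map mt xs) = heckev P M D z xs"
proof -
  have inj: "inj_on mt (set (hreps P M D))" by (simp add: inj_on_def mt_inj)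
  have "twisted_transfer H cj \<rho> m F (map mt xs) =
     (\<Sum>r\<in>set (hreps P M D). F (map (\<lambda>x. cj (mt r \<otimes>\<^bsub>H\<^esub> x \<otimes>\<^bsub>H\<^esub> inv\<^bsub>H\<^esub> \<rho> (mt r \<otimes>\<^bsub>H\<^esub> x))) (map mt xs)))"
    unfolding twisted_transfer_def rho_image sum.reindex[OF inj] o_def using tupl_tuples[OF xs] by (simp only: if_True)
  also have "\<dots> = (\<Sum>r\<in>set (hreps P M D). val z (qnorm (map (hact P M D r) xs)))"
  proof (rule sum.cong)
    fix r assume rr: "r \<in> set (hreps P M D)"
    then have Pr: "P r" by (simp add: hreps_def)
    have Px: "P x" if "x \<in> set xs" for x using tupl_P[OF xs that] .
    have "map (\<lambda>x. cj (mt r \<otimes>\<^bsub>H\<^esub> x \<otimes>\<^bsub>H\<^esub> inv\<^bsub>H\<^esub> \<rho> (mt r \<otimes>\<^bsub>H\<^esub> x))) (map mt xs) = map mt (map (hact P M D r) xs)"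
      unfolding map_map o_def by (rule map_cong[OF refl]) (rule key_mt(1)[OF Pr Px])
    moreover have "F (map mt (map (hact P M D r) xs)) = F (map mt (qnorm (map (hact P M D r) xs)))"
    proof (rule cochain_qnorm[OF F, symmetric])
      show "length (map (hact P M D r) xs) = Suc m" using xs by (simp add: set_tupl)
      show "\<forall>x\<in>set (map (hact P M D r) xs). P x" using key_mt(2)[OF Pr Px] by simp
    qed
    ultimately show "F (map (\<lambda>x. cj (mt r \<otimes>\<^bsub>H\<^esub> x \<otimes>\<^bsub>H\<^esub> inv\<^bsub>H\<^esub> \<rho> (mt r \<otimes>\<^bsub>H\<^esub> x))) (map mt xs)) =
        val z (qnorm (map (hact P M D r) xs))"
      using z[OF r[OF rr]] by (simp only:)
  qed simp
  also have "\<dots> = heckev P M D z xs"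
    unfolding heckev_def by (subst sum_list_sum) (simp_all add: hreps_def)
  finally show ?thesis .
qed

end

end

section \<open>Soundness of certificates\<close>

context coded begin

definition delta :: "quad list \<Rightarrow> quad list \<Rightarrow> int" where
  "delta y b = cob [(b, 1)] y"

lemma ev_bd_delta:
  "F \<in> carrier (cochains H k) \<Longrightarrow> y \<in> set (tupl P d (Suc k)) \<Longrightarrow>
    ev F (bd (map mt y)) = (\<Sum>b\<in>set (tupl P d k). delta y b * F (map mt b))"
  unfolding delta_def by (rule ev_bd_tupl)

lemma cob_delta:
  "y \<in> set (tupl P d (Suc k)) \<Longrightarrow> cob z y = (\<Sum>b\<in>set (tupl P d k). delta y b * val z b)"
  unfolding delta_def by (rule cob_matrix)

lemma cocycle_delta:
  assumes "F \<in> cocycles H m" "y \<in> set (tupl P d (Suc m))"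
  shows "(\<Sum>b\<in>set (tupl P d m). delta y b * F (map mt b)) = 0"
proof -
  have "ev F (bd (map mt y)) = 0"
    using assms(1) tupl_tuples[OF assms(2)] by (simp add: cocycles_iff)
  then show ?thesis using ev_bd_delta[OF _ assms(2), of F] assms(1) by (simp add: cocycles_iff)
qed

text \<open>The indicator of an orbit is an invariant cochain on all tuples, because
  \<open>qnorm\<close> is constant on orbits. Its coboundary therefore exists globally and not only
  on the family.\<close>

lemma indicator_coboundary:
  assumes b: "b \<in> set (tupl P d k)"
  shows "\<exists>F\<in>coboundaries H (Suc k). \<forall>a\<in>set (tupl P d (Suc k)). F (map mt a) = delta a b"
proof -
  define u where "u ys = (if ys \<in> tuples H (Suc k) \<and> qnorm (map qo ys) = b then 1 else 0 :: int)" for ys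
  have u: "u \<in> carrier (cochains H k)"
    unfolding carrier_cochains
  proof (intro conjI ballI allI impI)
    fix a ys assume a: "a \<in> carrier H" and ys: "ys \<in> tuples H (Suc k)"
    obtain a' where a': "P a'" "a = mt a'" using a by (auto elim: \<Gamma>E)
    obtain xs where xs: "ys = map mt xs" using ys by (auto simp: tuples_def elim: \<Gamma>E_list)
    have *: "map ((\<otimes>\<^bsub>H\<^esub>) a) ys = map mt (map (qmul a') xs)" by (simp add: a' xs mt_mult)
    have "map ((\<otimes>\<^bsub>H\<^esub>) a) ys \<in> tuples H (Suc k)" using H.shift_tuples[OF a ys] .
    moreover have "qnorm (map qo (map ((\<otimes>\<^bsub>H\<^esub>) a) ys)) = qnorm (map qo ys)"
      unfolding * using qnorm_shift[OF P_det[OF a'(1)], of xs] by (simp add: xs o_def)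
    ultimately show "u (map ((\<otimes>\<^bsub>H\<^esub>) a) ys) = u ys" using ys by (simp only: u_def simp_thms)
  qed (simp add: u_def)
  have uv: "u (map mt b') = (if b' = b then 1 else 0)" if "b' \<in> set (tupl P d k)" for b'
    using tupl_tuples[OF that] qnorm_id[OF that] by (simp add: u_def o_def)
  have "coboundary H k u (map mt a) = delta a b" if a: "a \<in> set (tupl P d (Suc k))" for a
  proof -
    have "coboundary H k u (map mt a) = (\<Sum>b'\<in>set (tupl P d k). delta a b' * u (map mt b'))"
      using tupl_tuples[OF a] ev_bd_delta[OF u a] by (simp add: coboundary_eq_ev)
    also have "\<dots> = (\<Sum>b'\<in>set (tupl P d k). if b' = b then delta a b else 0)"
      by (intro sum.cong refl) (simp add: uv)
    also have "\<dots> = delta a b" using b by simp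
    finally show ?thesis .
  qed
  then show ?thesis using u by (intro bexI[of _ "coboundary H k u"]) auto
qed

text \<open>The generators go to the classes of cocycles \<open>F i\<close> that extend the basis
  \<open>z i\<close>. Surjectivity holds because each cocycle is an integral combination of the
  basis on the finite set \<open>?X\<close> and is determined by its values there up to a
  coboundary. The kernel is found by comparing combinations on \<open>?X\<close>, where the dual
  family makes coefficients unique.\<close>

lemma cert_correct:
  assumes cert: "cert P M m n rels B D d zs ws L c"
  shows "integer_matrix n rels \<and> (\<exists>\<tau>. describes_endomorphism n rels B \<tau> \<and>
      (\<exists>\<phi> \<in> iso (presented_group n rels) (cohomology H m).
        \<forall>x\<in>carrier (presented_group n rels). \<phi> (\<tau> x) = hecke_operator A \<Gamma> g m (\<phi> x)))"
proof -
  let ?X = "set (tupl P d m)" and ?Y = "set (tupl P d (Suc m))"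
  define z where "z i = val (zs ! i)" for i
  define w where "w i = val (ws ! i)" for i
  have D: "covers D" and d: "2 * D + 1 \<le> d" and len: "length zs = n" "length ws = n"
    using cert covers_step unfolding cert_def by blast+
  have nth: "lnth zs i = zs ! i" "lnth ws i = ws ! i" if "i < n" for i using that len by auto
  have rels: "length rels = length (prev P d m)" "\<forall>r\<in>set rels. length r = n"
    and Bm: "length B = n" "\<forall>r\<in>set B. length r = n"
    using cert unfolding cert_def by blast+
  have kd: "kernel_data ?X ?Y delta {..<n} z w (\<lambda>a y. val L (a, y)) c"
  proof -
    have "c \<noteq> 0" using cert unfolding cert_def by blast
    moreover have "(\<Sum>a\<in>?X. w i a * z j a) = (if i = j then 1 else 0)" if "i < n" "j < n" for i j
    proof -
      have "sum_list (map (\<lambda>a. val (lnth ws i) a * val (lnth zs j) a) (tupl P d m)) = (if i = j then 1 else 0)"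
        using cert that unfolding cert_def atLeast0LessThan set_upt by blast
      then show ?thesis using that by (simp add: sum_list_sum distinct_tupl nth z_def w_def)
    qed
    moreover have "(\<Sum>a\<in>?X. delta y a * z j a) = 0" if "j < n" "y \<in> ?Y" for j y
    proof -
      have "cob (lnth zs j) y = 0" using cert that unfolding cert_def atLeast0LessThan set_upt by blast
      then show ?thesis using that cob_delta[OF that(2)] by (simp add: nth z_def)
    qed
    moreover have "c * ((if a = b then 1 else 0) - (\<Sum>i<n. z i a * w i b)) = (\<Sum>y\<in>?Y. val L (a, y) * delta y b)"
      if "a \<in> ?X" "b \<in> ?X" for a b
    proof -
      have "c * ((if a = b then 1 else 0) - sum_list (map (\<lambda>i. val (lnth zs i) a * val (lnth ws i) b) [0..<n]))
         = sum_list (map (\<lambda>y. val L (a, y) * cob [(b, 1)] y) (tupl P d (Suc m)))"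
        using cert that unfolding cert_def by blast
      moreover have "sum_list (map (\<lambda>i. val (lnth zs i) a * val (lnth ws i) b) [0..<n]) = (\<Sum>i<n. z i a * w i b)"
        unfolding interv_sum_list_conv_sum_set_nat set_upt atLeast0LessThan
        by (rule sum.cong) (auto simp: nth z_def w_def)
      ultimately show ?thesis by (simp add: sum_list_sum distinct_tupl delta_def)
    qed
    ultimately show ?thesis unfolding kernel_data_def by simp
  qed
  have relation: "(\<Sum>i<n. rels ! k ! i * z i a) = delta a (prev P d m ! k)"
    if k: "k < length rels" and a: "a \<in> ?X" for k a
  proof -
    have "sum_list (map (\<lambda>i. lnth (lnth rels k) i * val (lnth zs i) a) [0..<n]) = cob [(lnth (prev P d m) k, 1)] a"
      using cert that unfolding cert_def atLeast0LessThan set_upt by blast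
    moreover have "sum_list (map (\<lambda>i. lnth (lnth rels k) i * val (lnth zs i) a) [0..<n]) = (\<Sum>i<n. rels ! k ! i * z i a)"
      unfolding interv_sum_list_conv_sum_set_nat set_upt atLeast0LessThan
      by (rule sum.cong) (use k rels nth_mem[OF k] in \<open>auto simp: nth z_def\<close>)
    ultimately show ?thesis using k rels(1) by (simp add: delta_def)
  qed
  have small: "qnorm (map (hact P M D r) xs) \<in> ?X" if "xs \<in> set (tupl P (2 * D + 1) m)" "r \<in> set (hreps P M D)" for r xs
    using cert that unfolding cert_def by blast
  have hecke: "heckev P M D (zs ! i) xs = (\<Sum>j<n. B ! i ! j * z j xs)" if i: "i < n" and xs: "xs \<in> set (tupl P (2 * D + 1) m)" for i xs
  proof -
    have "heckev P M D (lnth zs i) xs = sum_list (map (\<lambda>j. lnth (lnth B i) j * val (lnth zs j) xs) [0..<n])"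
      using cert that unfolding cert_def atLeast0LessThan set_upt by blast
    moreover have "sum_list (map (\<lambda>j. lnth (lnth B i) j * val (lnth zs j) xs) [0..<n]) = (\<Sum>j<n. B ! i ! j * z j xs)"
      unfolding interv_sum_list_conv_sum_set_nat set_upt atLeast0LessThan
      by (rule sum.cong) (use i Bm nth_mem[of i B] in \<open>auto simp: nth z_def\<close>)
    ultimately show ?thesis using i by (simp add: nth)
  qed
  have "\<exists>F\<in>cocycles H m. \<forall>b\<in>?X. F (map mt b) = z i b" if "i < n" for i
    unfolding z_def
  proof (rule extend[OF D d])
    fix y assume "y \<in> ?Y"
    then show "cob (zs ! i) y = 0" using cob_delta kernel_dataD(3)[OF kd, of i y] that by (simp add: z_def)
  qed
  then obtain F where F: "\<And>i. i < n \<Longrightarrow> F i \<in> cocycles H m" "\<And>i b. i < n \<Longrightarrow> b \<in> ?X \<Longrightarrow> F i (map mt b) = z i b"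
    by metis
  define S where "S v = (\<lambda>xs. \<Sum>i<n. Poly_Mapping.lookup v i * F i xs)" for v :: "nat \<Rightarrow>\<^sub>0 int"
  define h where "h v = cls H m (S v)" for v
  have S_coc: "S v \<in> cocycles H m" for v
    unfolding S_def by (rule cocycle_sum) (simp add: cocycle_cmul F)
  have S_X: "S v (map mt b) = (\<Sum>i<n. Poly_Mapping.lookup v i * z i b)" if "b \<in> ?X" for v b
    unfolding S_def by (rule sum.cong) (simp_all add: F that)
  have S_add: "S (v + v') = (\<lambda>xs. S v xs + S v' xs)" for v v'
    by (simp add: S_def lookup_add sum.distrib distrib_right)
  have S_cob: "S v \<in> coboundaries H m" if "\<And>b. b \<in> ?X \<Longrightarrow> (\<Sum>i<n. Poly_Mapping.lookup v i * z i b) = 0" for v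
    by (rule vanish[OF D d S_coc]) (simp add: S_X that)
  \<comment> \<open>Pairing with \<open>w i\<close> reads off the coefficient of
    \<open>z i\<close>.\<close>
  have indep: "Poly_Mapping.lookup v i = u i" if i: "i < n" and eq: "\<And>b. b \<in> ?X \<Longrightarrow>
      (\<Sum>j<n. Poly_Mapping.lookup v j * z j b) = (\<Sum>j<n. u j * z j b)" for v u i
  proof -
    have *: "(\<Sum>a\<in>?X. w i a * (\<Sum>j<n. x j * z j a)) = x i" for x
    proof -
      have "(\<Sum>a\<in>?X. w i a * (\<Sum>j<n. x j * z j a)) = (\<Sum>j<n. x j * (\<Sum>a\<in>?X. w i a * z j a))"
        unfolding sum_distrib_left by (subst sum.swap) (simp add: mult.left_commute)
      also have "\<dots> = (\<Sum>j<n. if j = i then x i else 0)"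
        by (rule sum.cong) (use kernel_dataD(2)[OF kd, of i] i in auto)
      finally show ?thesis using i by simp
    qed
    have "(\<Sum>a\<in>?X. w i a * (\<Sum>j<n. Poly_Mapping.lookup v j * z j a)) = (\<Sum>a\<in>?X. w i a * (\<Sum>j<n. u j * z j a))"
      by (rule sum.cong) (simp_all add: eq)
    then show ?thesis by (simp only: *)
  qed
  have im: "integer_matrix n rels" "integer_matrix n B" using rels Bm by (simp_all add: integer_matrix_def)
  have "\<exists>\<tau>. describes_endomorphism n rels B \<tau> \<and> (\<exists>\<phi> \<in> iso (presented_group n rels) (cohomology H m).
        \<forall>x\<in>carrier (presented_group n rels). \<phi> (\<tau> x) = hecke_operator A \<Gamma> g m (\<phi> x))"
  proof (rule presentation_of_endomorphism[OF H.group_cohomology im Bm(1)])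
    show "h \<in> hom (free_Abelian_group {..<n}) (cohomology H m)"
      using S_coc by (auto simp: hom_def carrier_cohomology mult_cohomology h_def S_add)
    show "h ` carrier (free_Abelian_group {..<n}) = carrier (cohomology H m)"
    proof
      show "h ` carrier (free_Abelian_group {..<n}) \<subseteq> carrier (cohomology H m)"
        using S_coc by (auto simp: carrier_cohomology h_def)
      show "carrier (cohomology H m) \<subseteq> h ` carrier (free_Abelian_group {..<n})"
      proof
        fix C assume "C \<in> carrier (cohomology H m)"
        then obtain f where f: "f \<in> cocycles H m" "C = cls H m f" by (auto simp: carrier_cohomology)
        \<comment> \<open>The coordinates of \<open>f\<close> in the basis, obtained from the dual
          family.\<close>
        define u where "u i = (\<Sum>b\<in>?X. w i b * f (map mt b))" for i
        define v where "v = row_vector (map u [0..<n])"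
        have v: "Poly_Mapping.keys v \<subseteq> {..<n}" "\<And>i. i < n \<Longrightarrow> Poly_Mapping.lookup v i = u i"
          using keys_row_vector[of "map u [0..<n]"] by (simp_all add: v_def lookup_row_vector)
        have "f (map mt a) = (\<Sum>i<n. u i * z i a)" if "a \<in> ?X" for a
          unfolding u_def by (rule kernel_data_generates[OF kd _ _ that]) (simp_all add: cocycle_delta[OF f(1)])
        then have "S v (map mt b) - f (map mt b) = 0" if "b \<in> ?X" for b
          using that by (simp add: S_X v)
        then have "(\<lambda>xs. S v xs - f xs) \<in> coboundaries H m"
          by (intro vanish[OF D d cocycle_add(2)[OF S_coc f(1)]])
        then have "C = h v" by (simp add: f(2) h_def cls_eq_iff[of H m "S v" f, symmetric])
        then show "C \<in> h ` carrier (free_Abelian_group {..<n})" using v(1) by auto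
      qed
    qed
  next
    fix v :: "nat \<Rightarrow>\<^sub>0 int" assume v: "Poly_Mapping.keys v \<subseteq> {..<n}"
    have "\<one>\<^bsub>cohomology H m\<^esub> = cls H m (\<lambda>xs. 0)"
      by (simp add: cohomology_def FactGroup_def cls_def r_coset_def)
    then have h1: "h v = \<one>\<^bsub>cohomology H m\<^esub> \<longleftrightarrow> S v \<in> coboundaries H m"
      by (simp add: h_def cls_eq_iff)
    show "h v = \<one>\<^bsub>cohomology H m\<^esub> \<longleftrightarrow> v \<in> relation_subgroup n rels"
      unfolding h1
    proof
      assume "S v \<in> coboundaries H m"
      \<comment> \<open>On \<open>?X\<close> a coboundary combines the columns of the preceding
        coboundary matrix, with the values of a primitive on representatives as coefficients. The
        relators are these columns in the basis. In degree 0 both sides are zero.\<close>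
      have "\<exists>u. \<forall>a\<in>?X. S v (map mt a) = (\<Sum>k<length rels. u k * delta a (prev P d m ! k))"
      proof (cases m)
        case 0
        then show ?thesis using \<open>S v \<in> coboundaries H m\<close> rels(1) by (simp add: prev_def)
      next
        case (Suc l)
        then obtain u where u: "u \<in> carrier (cochains H l)" "S v = coboundary H l u"
          using \<open>S v \<in> coboundaries H m\<close> by auto
        have "S v (map mt a) = (\<Sum>k<length rels. u (map mt (prev P d m ! k)) * delta a (prev P d m ! k))"
          if a: "a \<in> ?X" for a
        proof -
          have "S v (map mt a) = (\<Sum>b\<in>set (tupl P d l). delta a b * u (map mt b))"
            using tupl_tuples[OF a] ev_bd_delta[OF u(1), of a d] a Suc by (simp add: u(2) coboundary_eq_ev)
          also have "\<dots> = (\<Sum>k<length (tupl P d l). delta a (tupl P d l ! k) * u (map mt (tupl P d l ! k)))"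
            using bij_betw_nth[OF distinct_tupl refl refl, of P d l]
            by (rule sum.reindex_bij_betw[symmetric])
          finally show ?thesis using rels(1) Suc by (simp add: prev_def mult.commute)
        qed
        then show ?thesis by (intro exI[of _ "\<lambda>k. u (map mt (prev P d m ! k))"] ballI)
      qed
      then obtain u where u: "\<And>a. a \<in> ?X \<Longrightarrow> S v (map mt a) = (\<Sum>k<length rels. u k * delta a (prev P d m ! k))"
        by blast
      have "Poly_Mapping.lookup v i = (\<Sum>k<length rels. u k * rels ! k ! i)" if "i < n" for i
      proof (rule indep[OF that])
        fix b assume b: "b \<in> ?X"
        have "(\<Sum>j<n. Poly_Mapping.lookup v j * z j b) = (\<Sum>k<length rels. u k * (\<Sum>j<n. rels ! k ! j * z j b))"
          using u[OF b] S_X[OF b] relation b by simp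
        also have "\<dots> = (\<Sum>j<n. (\<Sum>k<length rels. u k * rels ! k ! j) * z j b)"
          unfolding sum_distrib_left sum_distrib_right by (subst sum.swap) (simp add: mult.assoc)
        finally show "(\<Sum>j<n. Poly_Mapping.lookup v j * z j b) = (\<Sum>j<n. (\<Sum>k<length rels. u k * rels ! k ! j) * z j b)" .
      qed
      moreover have "Poly_Mapping.lookup v i = 0" if "\<not> i < n" for i
        using v that by (metis in_keys_iff lessThan_iff subsetD)
      ultimately have "Poly_Mapping.lookup v i =
          Poly_Mapping.lookup (\<Sum>k<length rels. frag_cmul (u k) (row_vector (rels ! k))) i" for i
        using rels(2) by (cases "i < n") (simp_all add: lookup_sum_frag lookup_row_vector)
      then have "v = (\<Sum>k<length rels. frag_cmul (u k) (row_vector (rels ! k)))"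
        by (rule poly_mapping_eqI)
      then show "v \<in> relation_subgroup n rels"
        using row_combination_in_relation_subgroup[OF im(1), of "{..<length rels}" u] by simp
    next
      have row: "S (row_vector r) \<in> coboundaries H m" if "r \<in> set rels" for r
      proof -
        obtain k where k: "k < length rels" "r = rels ! k" using \<open>r \<in> set rels\<close> by (auto simp: in_set_conv_nth)
        have len_r: "length r = n" using rels(2) \<open>r \<in> set rels\<close> by blast
        show ?thesis
        proof (cases m)
          case 0
          then show ?thesis using k rels(1) by (simp add: prev_def)
        next
          case (Suc l)
          then have b: "prev P d m ! k \<in> set (tupl P d l)" using k rels(1) by (simp add: prev_def)
          obtain e where e: "e \<in> coboundaries H m" "\<And>a. a \<in> ?X \<Longrightarrow> e (map mt a) = delta a (prev P d m ! k)"
            using indicator_coboundary[OF b] Suc by auto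
          have ec: "e \<in> cocycles H m" using e(1) H.coboundaries_subset by blast
          \<comment> \<open>The relator and the genuine coboundary \<open>e\<close> are known to
            agree on \<open>?X\<close> alone; \<open>vanish\<close> makes their difference a
            coboundary.\<close>
          have "(\<lambda>xs. S (row_vector r) xs - e xs) \<in> coboundaries H m"
          proof (rule vanish[OF D d cocycle_add(2)[OF S_coc ec]])
            fix a assume a: "a \<in> ?X"
            have "S (row_vector r) (map mt a) = (\<Sum>i<n. rels ! k ! i * z i a)"
              unfolding S_X[OF a] by (rule sum.cong) (auto simp: lookup_row_vector len_r k(2)[symmetric])
            then show "S (row_vector r) (map mt a) - e (map mt a) = 0"
              using relation[OF k(1) a] e(2)[OF a] by simp
          qed
          from coboundaries_add(1)[OF this e(1)] show ?thesis by simp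
        qed
      qed
      have S_minus: "S (- v) = (\<lambda>xs. 0 - S v xs)" for v by (simp add: S_def sum_negf)
      have S_zero: "S 0 = (\<lambda>xs. 0)" by (simp add: S_def)
      assume "v \<in> relation_subgroup n rels"
      then show "S v \<in> coboundaries H m"
        unfolding relation_subgroup_def
      proof (induction rule: generate.induct)
        case one
        then show ?case by (simp add: S_zero coboundaries_zero)
      next
        case (incl v)
        then show ?case using row by auto
      next
        case (inv v)
        then obtain r where r: "r \<in> set rels" "v = row_vector r" by blast
        then have "Poly_Mapping.keys v \<subseteq> {..<n}" using keys_row_vector[of r] rels(2) by simp
        then show ?case using coboundaries_add(2)[OF coboundaries_zero row[OF r(1)]] r(2) by (simp add: S_minus)
      next
        case (eng v v')
        then show ?case using coboundaries_add(1) by (simp add: S_add)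
      qed
    qed
  next
    note T = hecke_operator_cls[OF sub g transversal_rho[OF D]]
    let ?T = "twisted_transfer H cj (\<rho> D) m"
    show "hecke_operator A \<Gamma> g m \<in> hom (cohomology H m) (cohomology H m)"
    proof (rule homI)
      fix x assume "x \<in> carrier (cohomology H m)"
      then show "hecke_operator A \<Gamma> g m x \<in> carrier (cohomology H m)"
        using T by (auto simp: carrier_cohomology)
    next
      fix x y assume "x \<in> carrier (cohomology H m)" "y \<in> carrier (cohomology H m)"
      then obtain f f' where f: "f \<in> cocycles H m" "x = cls H m f" "f' \<in> cocycles H m" "y = cls H m f'"
        by (auto simp: carrier_cohomology)
      have "?T (\<lambda>xs. f xs + f' xs) = (\<lambda>xs. ?T f xs + ?T f' xs)"
        by (auto simp: twisted_transfer_def sum.distrib)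
      then show "hecke_operator A \<Gamma> g m (x \<otimes>\<^bsub>cohomology H m\<^esub> y) =
          hecke_operator A \<Gamma> g m x \<otimes>\<^bsub>cohomology H m\<^esub> hecke_operator A \<Gamma> g m y"
        using f cocycle_add(1)[OF f(1,3)] by (simp add: mult_cohomology T(1))
    qed
    fix v :: "nat \<Rightarrow>\<^sub>0 int" assume v: "Poly_Mapping.keys v \<subseteq> {..<n}"
    let ?Bv = "frag_extend (\<lambda>i. row_vector (B ! i)) v"
    have Tv: "?T (S v) (map mt xs) = (\<Sum>i<n. Poly_Mapping.lookup v i * ?T (F i) (map mt xs))" for xs
      unfolding S_def twisted_transfer_def
      by (simp add: sum_distrib_left) (subst sum.swap, simp)
    have lk: "Poly_Mapping.lookup ?Bv j = (\<Sum>i<n. Poly_Mapping.lookup v i * B ! i ! j)" if j: "j < n" for j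
    proof -
      have "Poly_Mapping.lookup ?Bv j = (\<Sum>i\<in>Poly_Mapping.keys v. Poly_Mapping.lookup v i * Poly_Mapping.lookup (row_vector (B ! i)) j)"
        by (simp add: frag_extend_def lookup_sum_frag)
      also have "\<dots> = (\<Sum>i<n. Poly_Mapping.lookup v i * Poly_Mapping.lookup (row_vector (B ! i)) j)"
        by (rule sum.mono_neutral_left) (use v in \<open>auto simp: in_keys_iff\<close>)
      also have "\<dots> = (\<Sum>i<n. Poly_Mapping.lookup v i * B ! i ! j)"
        by (rule sum.cong) (use Bm j in \<open>auto simp: lookup_row_vector\<close>)
      finally show ?thesis .
    qed
    \<comment> \<open>Tested at scale 2 D + 1 and not at \<open>d\<close>: the smaller scale already
      determines a class, and only from there do all images of tuples land at scale
      \<open>d\<close>, where \<open>S v\<close> is known.\<close>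
    have "(\<lambda>xs. ?T (S v) xs - S ?Bv xs) \<in> coboundaries H m"
    proof (rule vanish[OF D order_refl cocycle_add(2)[OF T(2)[OF S_coc] S_coc]])
      fix xs assume xs: "xs \<in> set (tupl P (2 * D + 1) m)"
      then have xs': "xs \<in> ?X" using tupl_mono[OF d, of P m] by blast
      have "?T (F i) (map mt xs) = (\<Sum>j<n. B ! i ! j * z j xs)" if i: "i < n" for i
      proof -
        have "?T (F i) (map mt xs) = heckev P M D (zs ! i) xs"
        proof (rule transfer_eval[OF D _ _ xs small[OF xs]])
          show "F i \<in> carrier (cochains H m)" using F(1)[OF i] by (simp add: cocycles_iff)
          show "F i (map mt b) = val (zs ! i) b" if "b \<in> ?X" for b using F(2)[OF i that] by (simp add: z_def)
        qed
        then show ?thesis using hecke[OF i xs] by simp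
      qed
      then have "?T (S v) (map mt xs) = (\<Sum>i<n. Poly_Mapping.lookup v i * (\<Sum>j<n. B ! i ! j * z j xs))"
        unfolding Tv by (intro sum.cong) auto
      also have "\<dots> = (\<Sum>j<n. (\<Sum>i<n. Poly_Mapping.lookup v i * B ! i ! j) * z j xs)"
        unfolding sum_distrib_left sum_distrib_right by (subst sum.swap) (simp add: mult.assoc)
      also have "\<dots> = S ?Bv (map mt xs)"
        unfolding S_X[OF xs'] by (rule sum.cong) (simp_all add: lk)
      finally show "?T (S v) (map mt xs) - S ?Bv (map mt xs) = 0" by simp
    qed
    then show "hecke_operator A \<Gamma> g m (h v) = h ?Bv"
      unfolding h_def T(1)[OF S_coc] cls_eq_iff .
  qed
  then show ?thesis using im(1) by blast
qed

end

section \<open>Existence of certificates\<close>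

lemma finite_uniform_bound:
  fixes Q :: "'a \<Rightarrow> nat \<Rightarrow> bool"
  assumes "finite S" "\<And>p. p \<in> S \<Longrightarrow> \<exists>d. Q p d" "\<And>p d e. Q p d \<Longrightarrow> d \<le> e \<Longrightarrow> Q p e"
  shows "\<exists>d\<ge>d0. \<forall>p\<in>S. Q p d"
  using assms(1,2)
proof (induction S rule: finite_induct)
  case (insert p S)
  then obtain d e where "d \<ge> d0" "\<forall>p\<in>S. Q p d" "Q p e" by blast
  then show ?case using assms(3) by (intro exI[of _ "max d e"]) (auto simp: le_max_iff_disj intro: assms(3))
qed auto

context coded begin

lemma coefficients_exist:
  assumes kd: "kernel_data (set (tupl P d m)) (set (tupl P d (Suc m))) delta {..<n} z w L c" and F: "F \<in> cocycles H m"
  shows "\<exists>u. length u = n \<and> (\<forall>a\<in>set (tupl P d m). (\<Sum>i<n. u ! i * z i a) = F (map mt a))"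
proof -
  define u where "u i = (\<Sum>b\<in>set (tupl P d m). w i b * F (map mt b))" for i
  have "F (map mt a) = (\<Sum>i<n. u i * z i a)" if "a \<in> set (tupl P d m)" for a
    unfolding u_def by (rule kernel_data_generates[OF kd _ _ that]) (simp_all add: cocycle_delta[OF F])
  then show ?thesis by (intro exI[of _ "map u [0..<n]"]) simp
qed

text \<open>The scale \<open>d\<close> comes first, large enough for the finitely many tuples met by
  the Hecke operator, and then a basis at that scale. Relators and matrix exist because each row
  asks for the coordinates of the restriction of a genuine cocycle, and such restrictions are
  integral combinations of the basis.\<close>

lemma cert_exists:
  assumes D: "covers D"
  shows "\<exists>n rels B d zs ws L c. cert P M m n rels B D d zs ws L c"
proof -
  \<comment> \<open>Balls exhaust SL_2(Z), so any given tuple has finite diameter.\<close>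
  have bound1: "\<exists>d. qnorm ys \<in> set (tupl P d m)" if ys: "length ys = Suc m" "\<forall>x\<in>set ys. P x" for ys
  proof -
    have "\<exists>d\<ge>0. \<forall>p\<in>set ys \<times> set ys. qmul (qadj (fst p)) (snd p) \<in> set (qball d)"
    proof (rule finite_uniform_bound)
      fix p assume "p \<in> set ys \<times> set ys"
      then have "fst p \<in> set ys" "snd p \<in> set ys" by (simp_all add: mem_Times_iff)
      then have "qdet (qmul (qadj (fst p)) (snd p)) = 1" using ys(2) by (simp add: P_det)
      then show "\<exists>d. qmul (qadj (fst p)) (snd p) \<in> set (qball d)" by (rule qball_covers)
    qed (use qball_mono in blast)+
    then obtain d where d: "\<forall>p\<in>set ys \<times> set ys. qmul (qadj (fst p)) (snd p) \<in> set (qball d)" by blast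
    have "\<forall>x\<in>set ys. \<forall>y\<in>set ys. qmul (qadj x) y \<in> set (qball d)"
    proof (intro ballI)
      fix x y assume "x \<in> set ys" "y \<in> set ys"
      then show "qmul (qadj x) y \<in> set (qball d)" using bspec[OF d, of "(x, y)"] by simp
    qed
    moreover have "ys \<noteq> []" using ys(1) by force
    ultimately have "qnorm ys \<in> set (tupl P d (length ys - 1))" using ys(2) by (intro qnorm_tupl)
    then show ?thesis using ys(1) by auto
  qed
  have "\<exists>d\<ge>2 * D + 1. \<forall>p\<in>set (tupl P (2 * D + 1) m) \<times> set (hreps P M D).
      qnorm (map (hact P M D (snd p)) (fst p)) \<in> set (tupl P d m)"
  proof (rule finite_uniform_bound)
    fix p assume "p \<in> set (tupl P (2 * D + 1) m) \<times> set (hreps P M D)"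
    then have p: "fst p \<in> set (tupl P (2 * D + 1) m)" "snd p \<in> set (hreps P M D)"
      by (simp_all add: mem_Times_iff)
    have "P (snd p)" using p(2) by (simp add: hreps_def)
    then have "\<forall>x\<in>set (map (hact P M D (snd p)) (fst p)). P x"
      using key_mt(2)[OF D] tupl_P[OF p(1)] by simp
    moreover have "length (map (hact P M D (snd p)) (fst p)) = Suc m" using p(1) by (simp add: set_tupl)
    ultimately show "\<exists>d. qnorm (map (hact P M D (snd p)) (fst p)) \<in> set (tupl P d m)" by (rule bound1[rotated])
  qed (use tupl_mono in blast)+
  then obtain d where d: "2 * D + 1 \<le> d" and small: "\<And>xs r. xs \<in> set (tupl P (2 * D + 1) m) \<Longrightarrow>
      r \<in> set (hreps P M D) \<Longrightarrow> qnorm (map (hact P M D r) xs) \<in> set (tupl P d m)"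
    by fastforce
  let ?X = "set (tupl P d m)" and ?Y = "set (tupl P d (Suc m))"
  obtain n :: nat and z w L c where kd: "kernel_data ?X ?Y delta {..<n} z w L c"
    using kernel_data_exists_nat[of ?X ?Y delta] by blast
  define zs where "zs = map (\<lambda>i. map (\<lambda>a. (a, z i a)) (tupl P d m)) [0..<n]"
  define ws where "ws = map (\<lambda>i. map (\<lambda>a. (a, w i a)) (tupl P d m)) [0..<n]"
  define Ls where "Ls = map (\<lambda>p. (p, L (fst p) (snd p))) (List.product (tupl P d m) (tupl P d (Suc m)))"
  have zv: "val (lnth zs i) a = z i a" if "i < n" "a \<in> ?X" for i a
    using that val_zip[OF distinct_tupl, of "z i"] by (simp add: zs_def)
  have wv: "val (lnth ws i) a = w i a" if "i < n" "a \<in> ?X" for i a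
    using that val_zip[OF distinct_tupl, of "w i"] by (simp add: ws_def)
  have Lv: "val Ls (a, y) = L a y" if "a \<in> ?X" "y \<in> ?Y" for a y
  proof -
    have "distinct (List.product (tupl P d m) (tupl P d (Suc m)))"
      by (intro distinct_product distinct_tupl)
    from val_zip[OF this, of "\<lambda>p. L (fst p) (snd p)"] that show ?thesis by (simp add: Ls_def)
  qed
  have "\<exists>u. length u = n \<and> (\<forall>a\<in>?X. (\<Sum>i<n. u ! i * z i a) = delta a (prev P d m ! k))" if k: "k < length (prev P d m)" for k
  proof (cases m)
    case 0
    then show ?thesis using that by (simp add: prev_def)
  next
    case (Suc l)
    then have "prev P d m ! k \<in> set (tupl P d l)" using k by (simp add: prev_def)
    from indicator_coboundary[OF this] Suc obtain F where
      F: "F \<in> coboundaries H m" "\<And>a. a \<in> ?X \<Longrightarrow> F (map mt a) = delta a (prev P d m ! k)" by auto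
    have "F \<in> cocycles H m" using F(1) H.coboundaries_subset by blast
    from coefficients_exist[OF kd this] show ?thesis using F(2) by auto
  qed
  then have "\<forall>k. \<exists>u. k < length (prev P d m) \<longrightarrow> length u = n \<and>
      (\<forall>a\<in>?X. (\<Sum>i<n. u ! i * z i a) = delta a (prev P d m ! k))" by blast
  then obtain u where "\<forall>k. k < length (prev P d m) \<longrightarrow> length (u k) = n \<and>
      (\<forall>a\<in>?X. (\<Sum>i<n. u k ! i * z i a) = delta a (prev P d m ! k))"
    by (rule choice[THEN exE])
  then have u: "\<And>k. k < length (prev P d m) \<Longrightarrow> length (u k) = n"
    "\<And>k a. k < length (prev P d m) \<Longrightarrow> a \<in> ?X \<Longrightarrow> (\<Sum>i<n. u k ! i * z i a) = delta a (prev P d m ! k)"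
    by blast+
  define rels where "rels = map u [0..<length (prev P d m)]"
  have "\<exists>u. length u = n \<and> (\<forall>xs\<in>set (tupl P (2 * D + 1) m). (\<Sum>j<n. u ! j * z j xs) = heckev P M D (lnth zs i) xs)"
    if i: "i < n" for i
  proof -
    \<comment> \<open>The basis cochain is extended to all of \<Gamma> so that its transfer is a
      cocycle, whose coordinates form the row of \<open>B\<close>.\<close>
    have "\<exists>F\<in>cocycles H m. \<forall>b\<in>?X. F (map mt b) = val (lnth zs i) b"
    proof (rule extend[OF D d])
      fix y assume "y \<in> ?Y"
      then show "cob (lnth zs i) y = 0"
        using cob_delta[of y d m "lnth zs i"] kernel_dataD(3)[OF kd, of i y] i zv[OF i] by (simp cong: sum.cong)
    qed
    then obtain F where F: "F \<in> cocycles H m" "\<And>b. b \<in> ?X \<Longrightarrow> F (map mt b) = val (lnth zs i) b" by blast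
    have FT: "twisted_transfer H cj (\<rho> D) m F \<in> cocycles H m"
      by (rule hecke_operator_cls(2)[OF sub g transversal_rho[OF D] F(1)])
    obtain v where v: "length v = n"
      "\<And>a. a \<in> ?X \<Longrightarrow> (\<Sum>j<n. v ! j * z j a) = twisted_transfer H cj (\<rho> D) m F (map mt a)"
      using coefficients_exist[OF kd FT] by blast
    have "(\<Sum>j<n. v ! j * z j xs) = heckev P M D (lnth zs i) xs" if xs: "xs \<in> set (tupl P (2 * D + 1) m)" for xs
    proof -
      have "F \<in> carrier (cochains H m)" using F(1) by (simp add: cocycles_iff)
      from transfer_eval[OF D this F(2) xs small[OF xs]] v(2)[of xs] show ?thesis
        using xs tupl_mono[OF d, of P m] by auto
    qed
    then show ?thesis using v(1) by blast
  qed
  then have "\<forall>i. \<exists>v. i < n \<longrightarrow> length v = n \<and>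
      (\<forall>xs\<in>set (tupl P (2 * D + 1) m). (\<Sum>j<n. v ! j * z j xs) = heckev P M D (lnth zs i) xs)" by blast
  then obtain v where "\<forall>i. i < n \<longrightarrow> length (v i) = n \<and>
      (\<forall>xs\<in>set (tupl P (2 * D + 1) m). (\<Sum>j<n. v i ! j * z j xs) = heckev P M D (lnth zs i) xs)"
    by (rule choice[THEN exE])
  then have v: "\<And>i. i < n \<Longrightarrow> length (v i) = n"
    "\<And>i xs. i < n \<Longrightarrow> xs \<in> set (tupl P (2 * D + 1) m) \<Longrightarrow> (\<Sum>j<n. v i ! j * z j xs) = heckev P M D (lnth zs i) xs"
    by blast+
  define B where "B = map v [0..<n]"
  have "cert P M m n rels B D d zs ws Ls c"
    unfolding cert_def
  proof (intro conjI ballI)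
    fix s assume "s \<in> set (qball (Suc D))"
    then show "\<exists>u\<in>set (qball D). hmem P M (qmul s (qadj u))"
      using D qdet_qball unfolding covers_def by blast
  next
    fix i j assume "i \<in> set [0..<n]" "j \<in> set [0..<n]"
    then show "sum_list (map (\<lambda>a. val (lnth ws i) a * val (lnth zs j) a) (tupl P d m)) = (if i = j then 1 else 0)"
      using kernel_dataD(2)[OF kd, of i j] zv wv by (simp add: sum_list_sum distinct_tupl cong: sum.cong)
  next
    fix j y assume "j \<in> set [0..<n]" "y \<in> ?Y"
    then show "cob (lnth zs j) y = 0"
      using cob_delta[of y d m "lnth zs j"] kernel_dataD(3)[OF kd, of j y] zv by (simp cong: sum.cong)
  next
    fix a b assume ab: "a \<in> ?X" "b \<in> ?X"
    have S1: "sum_list (map (\<lambda>i. val (lnth zs i) a * val (lnth ws i) b) [0..<n]) = (\<Sum>i<n. z i a * w i b)"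
      unfolding interv_sum_list_conv_sum_set_nat set_upt atLeast0LessThan
      by (rule sum.cong) (simp_all add: zv wv ab)
    have S2: "sum_list (map (\<lambda>y. val Ls (a, y) * cob [(b, 1)] y) (tupl P d (Suc m))) = (\<Sum>y\<in>?Y. L a y * delta y b)"
      unfolding sum_list_sum[OF distinct_tupl] by (rule sum.cong) (simp_all add: Lv ab delta_def)
    show "c * ((if a = b then 1 else 0) - sum_list (map (\<lambda>i. val (lnth zs i) a * val (lnth ws i) b) [0..<n]))
         = sum_list (map (\<lambda>y. val Ls (a, y) * cob [(b, 1)] y) (tupl P d (Suc m)))"
      unfolding S1 S2 by (rule kernel_dataD(4)[OF kd ab])
  next
    fix r assume "r \<in> set rels"
    then show "length r = n" using u(1) by (auto simp: rels_def)
  next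
    fix k a assume k: "k \<in> set [0..<length rels]" and a: "a \<in> ?X"
    then have k': "k < length (prev P d m)" by (simp add: rels_def)
    have "sum_list (map (\<lambda>i. lnth (lnth rels k) i * val (lnth zs i) a) [0..<n]) = (\<Sum>i<n. u k ! i * z i a)"
      unfolding interv_sum_list_conv_sum_set_nat set_upt atLeast0LessThan
      by (rule sum.cong) (simp_all add: zv a rels_def k' u(1))
    then show "sum_list (map (\<lambda>i. lnth (lnth rels k) i * val (lnth zs i) a) [0..<n]) = cob [(lnth (prev P d m) k, 1)] a"
      using u(2)[OF k' a] k' by (simp add: delta_def)
  next
    fix r assume "r \<in> set B"
    then show "length r = n" using v(1) by (auto simp: B_def)
  next
    fix i xs assume "i \<in> set [0..<n]" and xs: "xs \<in> set (tupl P (2 * D + 1) m)"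
    then have i': "i < n" by simp
    have xs': "xs \<in> ?X" using xs tupl_mono[OF d, of P m] by blast
    have "sum_list (map (\<lambda>j. lnth (lnth B i) j * val (lnth zs j) xs) [0..<n]) = (\<Sum>j<n. v i ! j * z j xs)"
      unfolding interv_sum_list_conv_sum_set_nat set_upt atLeast0LessThan
      by (rule sum.cong) (simp_all add: zv xs' B_def i' v(1))
    then show "heckev P M D (lnth zs i) xs = sum_list (map (\<lambda>j. lnth (lnth B i) j * val (lnth zs j) xs) [0..<n])"
      using v(2)[OF i' xs] by simp
  qed (use d small kernel_dataD(1)[OF kd] in \<open>simp_all add: zs_def ws_def rels_def B_def\<close>)
  then show ?thesis by blast
qed

end

section \<open>Matrices and the search program\<close>

definition mat_of :: "quad \<Rightarrow> rat^2^2" where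
  "mat_of q = vector [vector [of_int (fst q), of_int (fst (snd q))],
     vector [of_int (fst (snd (snd q))), of_int (snd (snd (snd q)))]]"

lemma mat_of_nth [simp]:
  "mat_of (a, b, c, d) $ 1 $ 1 = of_int a" "mat_of (a, b, c, d) $ 1 $ 2 = of_int b"
  "mat_of (a, b, c, d) $ 2 $ 1 = of_int c" "mat_of (a, b, c, d) $ 2 $ 2 = of_int d"
  by (simp_all add: mat_of_def vector_2)

lemma mat2_eq_iff: "A = B \<longleftrightarrow> A $ 1 $ 1 = B $ 1 $ 1 \<and> A $ 1 $ 2 = B $ 1 $ 2 \<and> A $ 2 $ 1 = B $ 2 $ 1 \<and> A $ 2 $ 2 = B $ 2 $ 2"
  for A B :: "'a^2^2"
  by (auto simp: vec_eq_iff forall_2)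

lemma mat2_mult_nth: "(A ** B) $ i $ j = A $ i $ 1 * B $ 1 $ j + A $ i $ 2 * B $ 2 $ j"
  for A B :: "rat^2^2"
  by (simp add: matrix_matrix_mult_def sum_2)

lemma mat_of_inj: "mat_of x = mat_of y \<longleftrightarrow> x = y"
  by (cases x; cases y) (simp add: mat2_eq_iff)

lemma mat_of_qmul: "mat_of (qmul x y) = mat_of x ** mat_of y"
  by (cases x; cases y) (simp add: mat2_eq_iff mat2_mult_nth)

lemma mat_of_one: "mat_of qone = mat 1"
  by (simp add: mat2_eq_iff mat_def)

lemma det_mat_of: "det (mat_of q) = of_int (qdet q)"
  by (cases q) (simp add: det_2)

lemma group_GL2Q: "group GL2Q"
proof (rule groupI)
  show "\<exists>y\<in>carrier GL2Q. y \<otimes>\<^bsub>GL2Q\<^esub> x = \<one>\<^bsub>GL2Q\<^esub>" if "x \<in> carrier GL2Q" for x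
    using that by (auto simp: GL2Q_def invertible_def intro!: bexI)
qed (auto simp: GL2Q_def invertible_mult matrix_mul_assoc invertible_def[of "mat 1"])

lemma GL2Q_mult [simp]: "x \<otimes>\<^bsub>GL2Q\<^esub> y = x ** y" and GL2Q_one [simp]: "\<one>\<^bsub>GL2Q\<^esub> = mat 1"
  by (simp_all add: GL2Q_def)

lemma carrier_GL2Q_iff: "A \<in> carrier GL2Q \<longleftrightarrow> det A \<noteq> 0"
  by (simp add: GL2Q_def invertible_det_nz)

lemma carrier_SL2Z: "A \<in> carrier SL2Z \<longleftrightarrow> (\<exists>q. qdet q = 1 \<and> A = mat_of q)"
proof
  assume A: "A \<in> carrier SL2Z"
  then have "A $ 1 $ 1 \<in> \<int>" "A $ 1 $ 2 \<in> \<int>" "A $ 2 $ 1 \<in> \<int>" "A $ 2 $ 2 \<in> \<int>" by (auto simp: SL2Z_def)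
  then obtain a b c d where "A $ 1 $ 1 = of_int a" "A $ 1 $ 2 = of_int b" "A $ 2 $ 1 = of_int c" "A $ 2 $ 2 = of_int d"
    by (auto elim!: Ints_cases)
  then have "A = mat_of (a, b, c, d)" by (simp add: mat2_eq_iff)
  moreover have "det A = 1" using A by (simp add: SL2Z_def)
  ultimately show "\<exists>q. qdet q = 1 \<and> A = mat_of q"
    by (intro exI[of _ "(a, b, c, d)"]) (simp only: det_mat_of of_int_eq_1_iff simp_thms)
next
  assume "\<exists>q. qdet q = 1 \<and> A = mat_of q"
  then obtain a b c d where q: "qdet (a, b, c, d) = 1" "A = mat_of (a, b, c, d)" by (metis prod_cases4)
  then have "det A = 1" using det_mat_of by simp
  then show "A \<in> carrier SL2Z" by (auto simp: SL2Z_def q forall_2)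
qed

lemma GL2Q_inv_mat_of: "qdet q = 1 \<Longrightarrow> inv\<^bsub>GL2Q\<^esub> (mat_of q) = mat_of (qadj q)"
  by (rule group.inv_equality[OF group_GL2Q]) (simp_all add: carrier_GL2Q_iff det_mat_of mat_of_one flip: mat_of_qmul)

lemma subgroup_SL2Z: "subgroup (carrier SL2Z) GL2Q"
proof (rule group.subgroupI[OF group_GL2Q])
  show "carrier SL2Z \<subseteq> carrier GL2Q" by (auto simp: carrier_SL2Z carrier_GL2Q_iff det_mat_of)
  have "mat_of qone \<in> carrier SL2Z" unfolding carrier_SL2Z by (intro exI[of _ qone]) simp
  then show "carrier SL2Z \<noteq> {}" by blast
  show "inv\<^bsub>GL2Q\<^esub> a \<in> carrier SL2Z" if a: "a \<in> carrier SL2Z" for a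
  proof -
    obtain q where q: "qdet q = 1" "a = mat_of q" using a by (auto simp: carrier_SL2Z)
    then show ?thesis unfolding carrier_SL2Z by (intro exI[of _ "qadj q"]) (simp add: GL2Q_inv_mat_of)
  qed
  show "a \<otimes>\<^bsub>GL2Q\<^esub> b \<in> carrier SL2Z" if ab: "a \<in> carrier SL2Z" "b \<in> carrier SL2Z" for a b
  proof -
    obtain q r where q: "qdet q = 1" "a = mat_of q" "qdet r = 1" "b = mat_of r" using ab by (auto simp: carrier_SL2Z)
    then show ?thesis unfolding carrier_SL2Z by (intro exI[of _ "qmul q r"]) (simp add: mat_of_qmul)
  qed
qed

lemma SL2Z_eq: "SL2Z = GL2Q\<lparr>carrier := carrier SL2Z\<rparr>"
  by (simp add: SL2Z_def)

lemma subgroup_SL2Z_imp_GL2Q: "subgroup \<Gamma> SL2Z \<Longrightarrow> subgroup \<Gamma> GL2Q"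
  using group.incl_subgroup[OF group_GL2Q subgroup_SL2Z] SL2Z_eq by simp

text \<open>Congruence to the identity modulo N, with explicit quotients so that conjugation becomes
  a polynomial identity.\<close>

definition unit_mod :: "int \<Rightarrow> quad \<Rightarrow> bool" where
  "unit_mod N q \<longleftrightarrow> (\<exists>r. q = (1 + N * fst r, N * fst (snd r), N * fst (snd (snd r)), 1 + N * snd (snd (snd r))))"

lemma congruence_subgroup_unit_mod:
  assumes "congruence_subgroup \<Gamma>"
  obtains N where "N \<ge> 1" "\<And>q. qdet q = 1 \<Longrightarrow> unit_mod N q \<Longrightarrow> mat_of q \<in> \<Gamma>"
proof -
  obtain N where N: "N \<ge> 1" "kernel SL2Z (SL2_mod N) (canonical_hom N) \<subseteq> \<Gamma>"
    using assms by (auto simp: congruence_subgroup_def)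
  have "mat_of q \<in> \<Gamma>" if q: "qdet q = 1" "unit_mod N q" for q
  proof -
    obtain a b c d where r: "q = (1 + N * a, N * b, N * c, 1 + N * d)" using q(2) by (auto simp: unit_mod_def)
    have "canonical_hom N (mat_of q) = reduce N (mat 1)"
      by (simp add: canonical_hom_def reduce_def vec_eq_iff forall_2 r mat_def del: of_int_add of_int_mult)
    moreover have "mat_of q \<in> carrier SL2Z" using q(1) carrier_SL2Z by blast
    ultimately have "mat_of q \<in> kernel SL2Z (SL2_mod N) (canonical_hom N)"
      by (simp add: kernel_def SL2_mod_def)
    then show ?thesis using N(2) by blast
  qed
  then show ?thesis using that N(1) by blast
qed

type_synonym fracs = "(int \<times> int) \<times> (int \<times> int) \<times> (int \<times> int) \<times> (int \<times> int)"

text \<open>The matrix times the product of its four denominators, each entry's own one being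
  cancelled. Any nonzero multiple induces the same conjugation.\<close>

definition clear_denominators :: "fracs \<Rightarrow> quad" where
  "clear_denominators r = (
     let p = fst r; q = fst (snd r); s = fst (snd (snd r)); t = snd (snd (snd r)) in
     (fst p * snd q * snd s * snd t, fst q * snd p * snd s * snd t,
      fst s * snd p * snd q * snd t, fst t * snd p * snd q * snd s))"

definition fracs_of :: "rat^2^2 \<Rightarrow> fracs" where
  "fracs_of g = (quotient_of (g $ 1 $ 1), quotient_of (g $ 1 $ 2), quotient_of (g $ 2 $ 1), quotient_of (g $ 2 $ 2))"

lemma clear_denominators:
  "\<exists>s\<noteq>0. \<forall>i j. mat_of (clear_denominators (fracs_of g)) $ i $ j = s * g $ i $ j"
proof -
  obtain a1 b1 a2 b2 a3 b3 a4 b4 where q: "quotient_of (g $ 1 $ 1) = (a1, b1)" "quotient_of (g $ 1 $ 2) = (a2, b2)"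
    "quotient_of (g $ 2 $ 1) = (a3, b3)" "quotient_of (g $ 2 $ 2) = (a4, b4)" by (metis surj_pair)
  note nz = q[THEN quotient_of_denom_pos]
  note eq = q[THEN quotient_of_div]
  have "clear_denominators (fracs_of g) = (a1 * b2 * b3 * b4, a2 * b1 * b3 * b4, a3 * b1 * b2 * b4, a4 * b1 * b2 * b3)"
    by (simp add: clear_denominators_def fracs_of_def q Let_def)
  then show ?thesis
    by (intro exI[of _ "of_int (b1 * b2 * b3 * b4)"]) (use nz in \<open>simp add: forall_2 eq\<close>)
qed

lemma coded_GL2Q:
  assumes \<Gamma>: "subgroup \<Gamma> SL2Z" and g: "g \<in> carrier GL2Q"
  defines "P \<equiv> \<lambda>q. qdet q = 1 \<and> mat_of q \<in> \<Gamma>" and "M \<equiv> clear_denominators (fracs_of g)"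
  shows "coded GL2Q \<Gamma> g P M mat_of" and "qdet M \<noteq> 0"
    and "\<And>z x. qmul M z = qmul x M \<longleftrightarrow> g ** mat_of z = mat_of x ** g"
proof -
  interpret group GL2Q by (rule group_GL2Q)
  obtain s where s: "s \<noteq> 0" "\<And>i j. mat_of M $ i $ j = s * g $ i $ j"
    using clear_denominators[of g] by (auto simp: M_def)
  have "of_int (qdet M) = s * s * det g"
    unfolding det_mat_of[symmetric] by (simp add: det_2 s algebra_simps)
  then show M: "qdet M \<noteq> 0" using s(1) g by (auto simp: carrier_GL2Q_iff)
  show comm: "qmul M z = qmul x M \<longleftrightarrow> g ** mat_of z = mat_of x ** g" for z x
  proof -
    have "(mat_of M ** mat_of z) $ i $ j = s * (g ** mat_of z) $ i $ j"
      "(mat_of x ** mat_of M) $ i $ j = s * (mat_of x ** g) $ i $ j" for i j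
      by (simp_all add: mat2_mult_nth s algebra_simps)
    then show ?thesis
      using s(1) unfolding mat_of_inj[symmetric] mat_of_qmul mat2_eq_iff by simp
  qed
  \<comment> \<open>Multiplying M z = x M by the adjugate gives adj(M) x M = det(M) z, so all
    divisions in \<open>qconj\<close> are exact.\<close>
  have qconj: "qconj M x = z" if "qmul M z = qmul x M" for x z
  proof -
    have "qmul (qmul (qadj M) x) M = qmul (qadj M) (qmul M z)" by (simp add: that qmul_assoc)
    also have "\<dots> = (qdet M * fst z, qdet M * fst (snd z), qdet M * fst (snd (snd z)), qdet M * snd (snd (snd z)))"
      by (cases M; cases z) (simp add: algebra_simps)
    finally show ?thesis using M by (simp add: qconj_def)
  qed
  have car: "mat_of x \<in> carrier GL2Q" if "qdet x = 1" for x using that by (simp add: carrier_GL2Q_iff det_mat_of)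
  have conj1: "g \<otimes>\<^bsub>GL2Q\<^esub> z \<otimes>\<^bsub>GL2Q\<^esub> inv\<^bsub>GL2Q\<^esub> g = x \<longleftrightarrow> g ** z = x ** g" if "x \<in> carrier GL2Q" "z \<in> carrier GL2Q" for x z
    using inv_solve_right'[of x "g \<otimes>\<^bsub>GL2Q\<^esub> z" g] that g unfolding GL2Q_mult[symmetric] by blast
  have conj2: "z = inv\<^bsub>GL2Q\<^esub> g \<otimes>\<^bsub>GL2Q\<^esub> x \<otimes>\<^bsub>GL2Q\<^esub> g"
    if "g ** z = x ** g" "x \<in> carrier GL2Q" "z \<in> carrier GL2Q" for x z
  proof -
    have "z = inv\<^bsub>GL2Q\<^esub> g \<otimes>\<^bsub>GL2Q\<^esub> (x \<otimes>\<^bsub>GL2Q\<^esub> g)"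
      using inv_solve_left[of z g "x \<otimes>\<^bsub>GL2Q\<^esub> g"] that g m_closed[of x g] by simp
    then show ?thesis using m_assoc[of "inv\<^bsub>GL2Q\<^esub> g" x g] that(2) g by (simp del: GL2Q_mult)
  qed
  have \<Gamma>E: "\<exists>x. qdet x = 1 \<and> y = mat_of x" if "y \<in> \<Gamma>" for y
    using that subgroup.subset[OF \<Gamma>] carrier_SL2Z by blast
  show "coded GL2Q \<Gamma> g P M mat_of"
  proof (rule coded.intro[OF group_GL2Q], rule coded_axioms.intro)
    show "subgroup \<Gamma> GL2Q" using \<Gamma> by (rule subgroup_SL2Z_imp_GL2Q)
    fix x assume x: "qdet x = 1"
    show "hmem P M x \<longleftrightarrow> mat_of x \<in> \<Gamma> \<inter> (\<lambda>x. g \<otimes>\<^bsub>GL2Q\<^esub> x \<otimes>\<^bsub>GL2Q\<^esub> inv\<^bsub>GL2Q\<^esub> g) ` \<Gamma>"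
    proof
      assume "hmem P M x"
      then have h: "mat_of x \<in> \<Gamma>" "qdet (qconj M x) = 1" "mat_of (qconj M x) \<in> \<Gamma>" "qmul M (qconj M x) = qmul x M"
        by (simp_all add: hmem_def P_def)
      then have "g \<otimes>\<^bsub>GL2Q\<^esub> mat_of (qconj M x) \<otimes>\<^bsub>GL2Q\<^esub> inv\<^bsub>GL2Q\<^esub> g = mat_of x"
        using conj1[OF car[OF x] car[OF h(2)]] comm by simp
      then show "mat_of x \<in> \<Gamma> \<inter> (\<lambda>x. g \<otimes>\<^bsub>GL2Q\<^esub> x \<otimes>\<^bsub>GL2Q\<^esub> inv\<^bsub>GL2Q\<^esub> g) ` \<Gamma>"
        using h(1,3) by (metis IntI imageI)
    next
      assume *: "mat_of x \<in> \<Gamma> \<inter> (\<lambda>x. g \<otimes>\<^bsub>GL2Q\<^esub> x \<otimes>\<^bsub>GL2Q\<^esub> inv\<^bsub>GL2Q\<^esub> g) ` \<Gamma>"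
      then obtain y where y: "y \<in> \<Gamma>" "g \<otimes>\<^bsub>GL2Q\<^esub> y \<otimes>\<^bsub>GL2Q\<^esub> inv\<^bsub>GL2Q\<^esub> g = mat_of x" by auto
      obtain z where z: "qdet z = 1" "y = mat_of z" using \<Gamma>E[OF y(1)] by blast
      have "qmul M z = qmul x M" using conj1[OF car[OF x] car[OF z(1)]] y(2) z(2) comm by simp
      then show "hmem P M x" using qconj * x y(1) z by (simp add: hmem_def P_def)
    qed
  next
    fix x assume "hmem P M x"
    then have h: "qdet x = 1" "qdet (qconj M x) = 1" "qmul M (qconj M x) = qmul x M"
      by (simp_all add: hmem_def P_def)
    then show "mat_of (qconj M x) = inv\<^bsub>GL2Q\<^esub> g \<otimes>\<^bsub>GL2Q\<^esub> mat_of x \<otimes>\<^bsub>GL2Q\<^esub> g"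
      using conj2[OF _ car[OF h(1)] car[OF h(2)]] comm by simp
  qed (use g car \<Gamma>E in \<open>auto simp: P_def mat_of_inj mat_of_qmul mat_of_one\<close>)
qed

text \<open>Conjugating 1 + N' X by M yields 1 + N' adj(M) X M / det(M). For N' = N |det(M)| this is
  integral and congruent to 1 modulo N, so \<Gamma>' contains the principal congruence subgroup of
  level N'. That has finitely many cosets, and one ball meets them all.\<close>

lemma covers_GL2Q:
  assumes \<Gamma>: "congruence_subgroup \<Gamma>" and g: "g \<in> carrier GL2Q"
  defines "P \<equiv> \<lambda>q. qdet q = 1 \<and> mat_of q \<in> \<Gamma>" and "M \<equiv> clear_denominators (fracs_of g)"
  shows "\<exists>D. coded.covers P M D"
proof -
  have sub: "subgroup \<Gamma> SL2Z" using \<Gamma> by (simp add: congruence_subgroup_def)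
  have M: "qdet M \<noteq> 0" unfolding M_def by (rule coded_GL2Q(2)[OF sub g])
  interpret coded GL2Q \<Gamma> g P M mat_of
    unfolding P_def M_def by (rule coded_GL2Q(1)[OF sub g])
  obtain N where N: "N \<ge> 1" "\<And>q. qdet q = 1 \<Longrightarrow> unit_mod N q \<Longrightarrow> mat_of q \<in> \<Gamma>"
    using congruence_subgroup_unit_mod[OF \<Gamma>] by blast
  define N' where "N' = N * \<bar>qdet M\<bar>"
  have N': "N' \<ge> 1" unfolding N'_def using N(1) M by (simp add: int_one_le_iff_zero_less)
  have unit: "hmem P M y" if y: "qdet y = 1" "unit_mod N' y" for y
  proof -
    obtain a b c d where r: "y = (1 + N' * a, N' * b, N' * c, 1 + N' * d)" using y(2) by (auto simp: unit_mod_def)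
    \<comment> \<open>The sign makes N' equal to e det(M), whatever the sign of the
      determinant.\<close>
    define e where "e = N * sgn (qdet M)"
    have N'e: "N' = e * qdet M" by (simp add: e_def N'_def abs_sgn mult.commute mult.left_commute)
    define t where "t = qmul (qmul (qadj M) (a, b, c, d)) M"
    define z where "z = (1 + e * fst t, e * fst (snd t), e * fst (snd (snd t)), 1 + e * snd (snd (snd t)))"
    have conj: "qmul (qmul (qadj M) y) M =
       (qdet M * fst z, qdet M * fst (snd z), qdet M * fst (snd (snd z)), qdet M * snd (snd (snd z)))"
      unfolding z_def t_def r N'e by (cases M) (simp add: algebra_simps)
    have qc: "qconj M y = z" using M by (simp add: qconj_def conj)
    have "qmul M z = qmul y M"
    proof -
      obtain m1 m2 m3 m4 where m: "M = (m1, m2, m3, m4)" by (metis prod_cases4)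
      show ?thesis unfolding z_def t_def r N'e m by (simp add: algebra_simps)
    qed
    moreover from this have "qdet M * qdet z = qdet M" using y(1) by (metis qdet_qmul mult.commute mult_1)
    then have "qdet z = 1" using M by simp
    moreover have "unit_mod N z"
    proof -
      have "z = (1 + N * (sgn (qdet M) * fst t), N * (sgn (qdet M) * fst (snd t)),
          N * (sgn (qdet M) * fst (snd (snd t))), 1 + N * (sgn (qdet M) * snd (snd (snd t))))"
        by (simp add: z_def e_def mult.assoc)
      then show ?thesis unfolding unit_mod_def
        by (intro exI[of _ "(sgn (qdet M) * fst t, sgn (qdet M) * fst (snd t), sgn (qdet M) * fst (snd (snd t)), sgn (qdet M) * snd (snd (snd t)))"]) simp
    qed
    moreover have "unit_mod N y"
    proof -
      have "y = (1 + N * (\<bar>qdet M\<bar> * a), N * (\<bar>qdet M\<bar> * b), N * (\<bar>qdet M\<bar> * c), 1 + N * (\<bar>qdet M\<bar> * d))"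
        by (simp add: r N'_def mult.assoc)
      then show ?thesis unfolding unit_mod_def
        by (intro exI[of _ "(\<bar>qdet M\<bar> * a, \<bar>qdet M\<bar> * b, \<bar>qdet M\<bar> * c, \<bar>qdet M\<bar> * d)"]) simp
    qed
    ultimately show "hmem P M y" using N(2) y(1) by (simp add: hmem_def P_def qc)
  qed
  \<comment> \<open>There are finitely many residues; each one that occurs has a representative in
    some ball, and a common radius is taken.\<close>
  define red where "red q = (fst q mod N', fst (snd q) mod N', fst (snd (snd q)) mod N', snd (snd (snd q)) mod N')" for q :: quad
  have "red ` {q. qdet q = 1} \<subseteq> {0..<N'} \<times> {0..<N'} \<times> {0..<N'} \<times> {0..<N'}"
    using N' by (auto simp: red_def)
  then have "finite (red ` {q. qdet q = 1})" by (rule finite_subset) simp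
  then have "\<exists>D\<ge>0. \<forall>v\<in>red ` {q. qdet q = 1}. \<exists>u\<in>set (qball D). red u = v"
    by (rule finite_uniform_bound) (use qball_covers qball_mono in blast)+
  then obtain D where D: "\<And>y. qdet y = 1 \<Longrightarrow> \<exists>u\<in>set (qball D). red u = red y" by blast
  have "\<exists>u\<in>set (qball D). hmem P M (qmul y (qadj u))" if y: "qdet y = 1" for y
  proof -
    obtain u where u: "u \<in> set (qball D)" "red u = red y" using D[OF y] by blast
    obtain a b c d where u': "u = (a, b, c, d)" by (metis prod_cases4)
    obtain a' b' c' d' where y': "y = (a', b', c', d')" by (metis prod_cases4)
    have "N' dvd a' - a" "N' dvd b' - b" "N' dvd c' - c" "N' dvd d' - d"
      using u(2) by (simp_all add: red_def u' y' mod_eq_dvd_iff[symmetric])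
    then obtain p q r s where pq: "a' = a + N' * p" "b' = b + N' * q" "c' = c + N' * r" "d' = d + N' * s"
      unfolding dvd_def by (metis diff_add_cancel add.commute)
    have du: "a * d - b * c = 1" using qdet_qball[OF u(1)] by (simp add: u')
    \<comment> \<open>From y = u + N' X, with X = (p, q, r, s), one gets y u^{-1} = 1 + N' X
      u^{-1}.\<close>
    define w where "w = qmul (p, q, r, s) (qadj u)"
    have "qmul y (qadj u) = (1 + N' * fst w, N' * fst (snd w), N' * fst (snd (snd w)), 1 + N' * snd (snd (snd w)))"
      using du by (simp add: w_def u' y' pq algebra_simps)
    then have "unit_mod N' (qmul y (qadj u))" unfolding unit_mod_def by blast
    moreover have "qdet (qmul y (qadj u)) = 1" using y qdet_qball[OF u(1)] by simp
    ultimately show ?thesis using unit u(1) by blast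
  qed
  then show ?thesis unfolding covers_def by blast
qed

section \<open>Decidability of certificates\<close>

lemma computable_qmul [computable_intros]:
  assumes "computable f" "computable g" shows "computable (\<lambda>P x. qmul (f P x) (g P x))"
  unfolding qmul_def by (intro computable_intros assms)

lemma computable_qadj [computable_intros]:
  assumes "computable f" shows "computable (\<lambda>P x. qadj (f P x))"
  unfolding qadj_def by (intro computable_intros assms)

lemma computable_qdet [computable_intros]:
  assumes "computable f" shows "computable (\<lambda>P x. qdet (f P x))"
  unfolding qdet_def by (intro computable_intros assms)

lemma computable_qconj [computable_intros]:
  assumes "computable f" "computable g" shows "computable (\<lambda>P x. qconj (f P x) (g P x))"
  unfolding qconj_def Let_def by (intro computable_intros assms)

lemma decidable_hmem [computable_intros]:
  assumes "computable f" "computable g" shows "decidable (\<lambda>P x. hmem P (f P x) (g P x))"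
  unfolding hmem_def by (intro computable_intros assms)

lemma computable_qball [computable_intros]:
  assumes "computable n" shows "computable (\<lambda>P x. qball (n P x))"
proof -
  have "computable (\<lambda>P x. rec_nat qH (\<lambda>k r. r @ concat (map (\<lambda>b. map (\<lambda>h. qmul (qmul b qS) h) qH) r)) (n P x))"
    by (intro computable_intros assms)
  moreover have "rec_nat qH (\<lambda>k r. r @ concat (map (\<lambda>b. map (\<lambda>h. qmul (qmul b qS) h) qH) r)) m = qball m" for m
    by (induction m) simp_all
  ultimately show ?thesis by simp
qed

lemma computable_hrep [computable_intros]:
  assumes "computable M" "computable D" "computable y" shows "computable (\<lambda>P x. hrep P (M P x) (D P x) (y P x))"
proof -
  have "computable (\<lambda>P z. hrep P (fst z) (fst (snd z)) (snd (snd z)))"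
    unfolding hrep_def by (intro computable_intros)
  from computable_comp3[OF this assms] show ?thesis .
qed

lemma computable_hreps [computable_intros]:
  assumes "computable M" "computable D" shows "computable (\<lambda>P x. hreps P (M P x) (D P x))"
proof -
  have "computable (\<lambda>P z. hreps P (fst z) (snd z))"
    unfolding hreps_def by (intro computable_intros)
  from computable_comp2[OF this assms] show ?thesis .
qed

lemma computable_hact [computable_intros]:
  assumes "computable M" "computable D" "computable r" "computable y"
  shows "computable (\<lambda>P x. hact P (M P x) (D P x) (r P x) (y P x))"
  unfolding hact_def by (intro computable_intros assms)

lemma computable_n_lists [computable_intros]:
  fixes xs :: "_ \<Rightarrow> _ \<Rightarrow> 'b::enc list"
  assumes "computable k" "computable xs" shows "computable (\<lambda>P x. List.n_lists (k P x) (xs P x))"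
proof -
  have "computable (\<lambda>P z. rec_nat [[]] (\<lambda>_ r. concat (map (\<lambda>ys. map (\<lambda>y. y # ys) (snd z :: 'b list)) r)) (fst z))"
    by (intro computable_intros)
  moreover have "rec_nat [[]] (\<lambda>_ r. concat (map (\<lambda>ys. map (\<lambda>y. y # ys) S) r)) m = List.n_lists m S" for m and S :: "'b list"
    by (induction m) simp_all
  ultimately have "computable (\<lambda>P z. List.n_lists (fst z) (snd z :: 'b list))" by simp
  from computable_comp2[OF this assms] show ?thesis .
qed

lemma computable_tupl [computable_intros]:
  assumes "computable d" "computable k" shows "computable (\<lambda>P x. tupl P (d P x) (k P x))"
proof -
  have "computable (\<lambda>P z. tupl P (fst z) (snd z))"
    unfolding tupl_def by (intro computable_intros)
  from computable_comp2[OF this assms] show ?thesis .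
qed

lemma computable_prev [computable_intros]:
  assumes "computable d" "computable k" shows "computable (\<lambda>P x. prev P (d P x) (k P x))"
  unfolding prev_def by (intro computable_intros assms)

lemma computable_qnorm [computable_intros]:
  assumes "computable xs" shows "computable (\<lambda>P x. qnorm (xs P x))"
proof -
  have "computable (\<lambda>P xs. qnorm xs)" unfolding qnorm_def by (intro computable_intros)
  from computable_comp[OF this assms] show ?thesis .
qed

lemma computable_val [computable_intros]:
  assumes "computable l" "computable k" shows "computable (\<lambda>P x. val (l P x) (k P x))"
proof -
  have "computable (\<lambda>P z. val (fst z) (snd z))" unfolding val_def by (intro computable_intros)
  from computable_comp2[OF this assms] show ?thesis .
qed

lemma computable_cob [computable_intros]:
  assumes "computable z" "computable y" shows "computable (\<lambda>P x. cob (z P x) (y P x))"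
proof -
  have "computable (\<lambda>P z. cob (fst z) (snd z))" unfolding cob_def by (intro computable_intros)
  from computable_comp2[OF this assms] show ?thesis .
qed

lemma computable_heckev [computable_intros]:
  assumes "computable M" "computable D" "computable z" "computable y"
  shows "computable (\<lambda>P x. heckev P (M P x) (D P x) (z P x) (y P x))"
proof -
  have "computable (\<lambda>P z. heckev P (fst (fst z)) (snd (fst z)) (fst (snd z)) (snd (snd z)))"
    unfolding heckev_def by (intro computable_intros)
  from computable_comp2[OF this computable_Pair[OF assms(1,2)] computable_Pair[OF assms(3,4)]] show ?thesis by simp
qed

type_synonym cert_output = "nat \<times> int list list \<times> int list list"
type_synonym cert_witness = "nat \<times> nat \<times> cochain_list list \<times> cochain_list list \<times>
  ((quad list \<times> quad list) \<times> int) list \<times> int"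

definition accepts :: "(quad \<Rightarrow> bool) \<Rightarrow> nat \<times> fracs \<Rightarrow> cert_output \<times> cert_witness \<Rightarrow> bool" where
  "accepts P x y \<longleftrightarrow> (let w = snd y in
     cert P (clear_denominators (snd x)) (fst x) (fst (fst y)) (fst (snd (fst y))) (snd (snd (fst y)))
       (fst w) (fst (snd w)) (fst (snd (snd w))) (fst (snd (snd (snd w))))
       (fst (snd (snd (snd (snd w))))) (snd (snd (snd (snd (snd w))))))"

lemma decidable_accepts: "decidable (\<lambda>P z. accepts P (fst z) (snd z))"
  unfolding accepts_def cert_def clear_denominators_def Let_def
  by (intro computable_intros)

lemma enc_pair: "enc (x, y) = prod_encode (enc x, enc y)"
  by (simp add: enc_prod_def)

lemma dec_pair: "dec (prod_encode (i, j)) = (dec i, dec j)"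
  by (simp add: dec_prod_def)

text \<open>The search runs over codes of pairs of an output and a witness, and the output is then
  projected out. Halting is claimed only for inputs that have an accepted pair, whereas
  \<open>computable_on_Least\<close> asks for one on every input; hence the explicit use of
  \<open>Mu\<close>.\<close>

lemma search_program:
  "\<exists>p. \<forall>t P m q1 q2 q3 q4. oracle_for t P \<longrightarrow> (\<exists>y. accepts P (m, q1, q2, q3, q4) y) \<longrightarrow>
     (\<exists>y. accepts P (m, q1, q2, q3, q4) y \<and>
        runs_with t p [m, enc q1, enc q2, enc q3, enc q4] (enc (fst y)))"
proof -
  let ?F = "\<lambda>P z. if accepts P (fst z) (snd z) then 0 else 1 :: nat"
  \<comment> \<open>The five input numbers come after the search variable, which is argument 0; they
    are packed into the code of the pair that \<open>accepts\<close> expects.\<close>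
  let ?code = "\<lambda>ys. prod_encode (prod_encode (ys ! 1, prod_encode (ys ! 2,
      prod_encode (ys ! 3, prod_encode (ys ! 4, ys ! 5)))), ys ! 0)"
  have "computable ?F" by (intro computable_intros decidable_accepts)
  then have "computable_on 1 (\<lambda>P xs. ?F P (dec (hd xs)))"
    by (simp only: computable_def enc_nat_def)
  moreover have "computable_on 6 (\<lambda>P ys. ?code ys)"
    by (intro computable_on_prod_encode computable_on_nth) simp_all
  ultimately have "computable_on 6 (\<lambda>P ys. ?F P (dec (?code ys)))"
    by (rule computable_on_comp1[of "\<lambda>P n. ?F P (dec n)"])
  then obtain p where p: "\<And>t P ys. oracle_for t P \<Longrightarrow> length ys = 6 \<Longrightarrow> runs_with t p ys (?F P (dec (?code ys)))"
    unfolding computable_on_def by blast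
  have "computable_on 1 (\<lambda>P xs. fst (prod_decode (hd xs)))"
    by (intro computable_on_prod_decode(1) computable_on_hd) simp
  then obtain q where q: "\<And>t P xs. oracle_for t P \<Longrightarrow> length xs = 1 \<Longrightarrow> runs_with t q xs (fst (prod_decode (hd xs)))"
    unfolding computable_on_def by blast
  show ?thesis
  proof (intro exI[of _ "Comp q [Mu p]"] allI impI)
    fix t P m and q1 q2 q3 q4 :: "int \<times> int"
    assume t: "oracle_for t P" and ex: "\<exists>y. accepts P (m, q1, q2, q3, q4) y"
    let ?xs = "[m, enc q1, enc q2, enc q3, enc q4]"
    have run: "evaluates (runs t) p (k # ?xs) (if accepts P (m, q1, q2, q3, q4) (dec k) then 0 else 1)" for k
    proof -
      have "?code (k # ?xs) = enc ((m, q1, q2, q3, q4), k)"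
        by (simp only: enc_pair enc_nat_def nth_Cons_0 nth_Cons_numeral) (simp add: enc_pair)
      then have "dec (?code (k # ?xs)) = ((m, q1, q2, q3, q4), dec k :: cert_output \<times> cert_witness)"
        by (simp only: enc_pair enc_nat_def dec_nat_def dec_pair dec_enc id_apply)
      then show ?thesis using p[OF t, of "k # ?xs"] by (simp add: runs_with_def)
    qed
    define k where "k = (LEAST k. accepts P (m, q1, q2, q3, q4) (dec k))"
    obtain y where "accepts P (m, q1, q2, q3, q4) y" using ex by blast
    then have "accepts P (m, q1, q2, q3, q4) (dec (enc y))" by simp
    then have k: "accepts P (m, q1, q2, q3, q4) (dec k)" unfolding k_def by (rule LeastI)
    have less: "\<not> accepts P (m, q1, q2, q3, q4) (dec i)" if "i < k" for i
      using not_less_Least[OF that[unfolded k_def]] .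
    have "evaluates (runs t) (Mu p) ?xs k"
    proof (rule evaluates.Mu)
      show "evaluates (runs t) p (k # ?xs) 0" using run[of k] k by simp
      show "\<forall>i<k. \<exists>y. evaluates (runs t) p (i # ?xs) (Suc y)"
      proof (intro allI impI)
        fix i assume "i < k"
        then show "\<exists>y. evaluates (runs t) p (i # ?xs) (Suc y)"
          using run[of i] less[of i] by (intro exI[of _ 0]) simp
      qed
    qed
    moreover have "evaluates (runs t) q [k] (fst (prod_decode k))"
      using q[OF t, of "[k]"] by (simp add: runs_with_def)
    ultimately have "runs_with t (Comp q [Mu p]) ?xs (fst (prod_decode k))"
      unfolding runs_with_def by (intro evaluates.Comp[where ys = "[k]"]) simp_all
    moreover have "fst (prod_decode k) = enc (fst (dec k :: cert_output \<times> cert_witness))"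
      by (simp add: dec_prod_def[of k])
    ultimately show "\<exists>y. accepts P (m, q1, q2, q3, q4) y \<and> runs_with t (Comp q [Mu p]) ?xs (enc (fst y))"
      using k by metis
  qed
qed

section \<open>Input, output and the final program\<close>

lemma oracle_for_membership_test:
  assumes "membership_test t \<Gamma>"
  shows "oracle_for t (\<lambda>q. qdet q = 1 \<and> mat_of q \<in> \<Gamma>)"
  unfolding oracle_for_def
proof (intro allI)
  fix a b c d :: int
  have "runs t [enc a, enc b, enc c, enc d] (if mat_of (a, b, c, d) \<in> \<Gamma> then 1 else 0)" if "a * d - b * c = 1"
  proof -
    have "mat_of (a, b, c, d) \<in> carrier SL2Z"
      unfolding carrier_SL2Z using that by (intro exI[of _ "(a, b, c, d)"]) simp
    then show ?thesis using assms by (auto simp: membership_test_def entries_def enc_int_def)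
  qed
  then show "if a * d - b * c = 1
     then runs t [enc a, enc b, enc c, enc d] (if qdet (a, b, c, d) = 1 \<and> mat_of (a, b, c, d) \<in> \<Gamma> then 1 else 0)
     else \<not> (qdet (a, b, c, d) = 1 \<and> mat_of (a, b, c, d) \<in> \<Gamma>)" by simp
qed

lemma hecke_input_eq:
  "hecke_input g m = [m, enc (quotient_of (g $ 1 $ 1)), enc (quotient_of (g $ 1 $ 2)),
     enc (quotient_of (g $ 2 $ 1)), enc (quotient_of (g $ 2 $ 2))]"
  by (simp add: hecke_input_def entries_def rat_encode_def enc_prod_def enc_int_def split_beta)

lemma hecke_output_eq: "hecke_output n rels A = enc (n, rels, A)"
proof -
  have "(enc :: int list \<Rightarrow> nat) = (\<lambda>r. list_encode (map int_encode r))"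
    by (rule ext) (simp add: enc_list_def enc_int_def)
  then show ?thesis
    by (simp add: hecke_output_def matrix_encode_def enc_pair enc_nat_def enc_list_def[of A] enc_list_def[of rels])
qed

theorem proposition6p1:
  shows "\<exists>p :: recf. \<forall>(\<Gamma> :: (rat^2^2) set) (t :: recf) (g :: rat^2^2) (m :: nat).
    congruence_subgroup \<Gamma> \<longrightarrow> membership_test t \<Gamma> \<longrightarrow> g \<in> carrier GL2Q \<longrightarrow>
    (\<exists>n rels A.
       runs_with t p (hecke_input g m) (hecke_output n rels A) \<and>
       integer_matrix n rels \<and>
       (\<exists>\<tau>. describes_endomorphism n rels A \<tau> \<and>
         (\<exists>\<phi> \<in> iso (presented_group n rels) (cohomology (GL2Q\<lparr>carrier := \<Gamma>\<rparr>) m).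
            \<forall>x\<in>carrier (presented_group n rels).
              \<phi> (\<tau> x) = hecke_operator GL2Q \<Gamma> g m (\<phi> x))))"
proof -
  \<comment> \<open>The program is obtained before the subgroup, the test, the matrix and the degree
    are fixed, so it is uniform in all of them.\<close>
  obtain p where p: "\<And>t P m q1 q2 q3 q4. oracle_for t P \<Longrightarrow> \<exists>y. accepts P (m, q1, q2, q3, q4) y \<Longrightarrow>
     \<exists>y. accepts P (m, q1, q2, q3, q4) y \<and> runs_with t p [m, enc q1, enc q2, enc q3, enc q4] (enc (fst y))"
    using search_program by blast
  show ?thesis
  proof (intro exI[of _ p] allI impI)
    fix \<Gamma> :: "(rat^2^2) set" and t :: recf and g :: "rat^2^2" and m :: nat
    assume \<Gamma>: "congruence_subgroup \<Gamma>" and t: "membership_test t \<Gamma>" and g: "g \<in> carrier GL2Q"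
    define P where "P = (\<lambda>q. qdet q = 1 \<and> mat_of q \<in> \<Gamma>)"
    define M where "M = clear_denominators (fracs_of g)"
    have sub: "subgroup \<Gamma> SL2Z" using \<Gamma> by (simp add: congruence_subgroup_def)
    interpret coded GL2Q \<Gamma> g P M mat_of
      unfolding P_def M_def by (rule coded_GL2Q(1)[OF sub g])
    obtain D where "covers D" using covers_GL2Q[OF \<Gamma> g] unfolding P_def M_def by blast
    from cert_exists[OF this, of m] obtain n rels B d zs ws L c where "cert P M m n rels B D d zs ws L c" by blast
    then have "accepts P (m, fracs_of g) ((n, rels, B), D, d, zs, ws, L, c)"
      by (simp add: accepts_def M_def)
    then have "\<exists>y. accepts P (m, fracs_of g) y" by blast
    from p[OF oracle_for_membership_test[OF t, folded P_def], OF this[unfolded fracs_of_def]]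
    \<comment> \<open>The certificate found may differ from the one just shown to exist; soundness
      holds for any accepted certificate.\<close>
    obtain y where y: "accepts P (m, fracs_of g) y" "runs_with t p (hecke_input g m) (enc (fst y))"
      unfolding hecke_input_eq fracs_of_def by blast
    obtain n rels B where out: "fst y = (n, rels, B)" by (cases "fst y") auto
    have "runs_with t p (hecke_input g m) (hecke_output n rels B)"
      using y(2) by (simp add: out hecke_output_eq)
    moreover have "integer_matrix n rels \<and> (\<exists>\<tau>. describes_endomorphism n rels B \<tau> \<and>
      (\<exists>\<phi> \<in> iso (presented_group n rels) (cohomology H m).
        \<forall>x\<in>carrier (presented_group n rels). \<phi> (\<tau> x) = hecke_operator GL2Q \<Gamma> g m (\<phi> x)))"
      using y(1) unfolding accepts_def Let_def out fst_conv snd_conv M_def[symmetric] by (rule cert_correct)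
    ultimately show "\<exists>n rels A.
       runs_with t p (hecke_input g m) (hecke_output n rels A) \<and>
       integer_matrix n rels \<and>
       (\<exists>\<tau>. describes_endomorphism n rels A \<tau> \<and>
         (\<exists>\<phi> \<in> iso (presented_group n rels) (cohomology (GL2Q\<lparr>carrier := \<Gamma>\<rparr>) m).
            \<forall>x\<in>carrier (presented_group n rels).
              \<phi> (\<tau> x) = hecke_operator GL2Q \<Gamma> g m (\<phi> x)))" by blast
  qed
qed

end
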